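(* Fix $k$ and an initial point $x_{k-1}\in\mathcal{S}^\mathcal{D}$ at time $t_{k-1}$, and let $\tau_k=t_k-t_{k-1}$. Let $\mathbb{P}_k$ and $\mathbb{P}^{\mathrm{Euler}}_k$ be the path measures on $[t_{k-1},t_k]$ of the jump processes started at $x_{k-1}$ with transition rates $Q_t$ and $Q^{\mathrm{Euler}}_t$, respectively. Assume $Q_t(x,z)>0$ for all $x,z\in\mathcal{S}^\mathcal{D}$ with $d^H(x,z)=1$ and all $t\in[t_{k-1},t_k]$. If $\tau_kQ_{t_{k-1}}(x_{k-1},x_{k-1})\ge-\log 2$, then $$D_{KL}(\mathbb{P}^{\mathrm{Euler}}_k\|\mathbb{P}_k)\ge\tfrac14\tau_k\mathcal{D}|\mathcal{S}|L'_k+\tfrac1{32}\mathcal{D}^2|\mathcal{S}|^2\tau_k^2\eta_k,$$ where $L'_k=\inf_{d^H(x,z)=1}\int_{t_{k-1}}^{t_k}\frac1{\tau_k}D_F(Q_{t_{k-1}}(x,z)\|Q_s(x,z))\,ds$ and $\eta_k=\inf\{Q^d_{t_{k-1}}(x_{k-1},x^d)\,D_F(Q^{d'}_{t_{k-1}}(x_{k-1},z^{d'})\|Q^{d'}_s(x,z^{d'}))\}$, the latter infimum being over $d'\ne d\in[\mathcal{D}]$, $z^{d'}\ne x^{d'}$, $x^d\ne x^d_{k-1}$, $d^H(x,x_{k-1})=1$ and $s\in[t_{k-1},t_k]$.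
   Context: $\mathcal{S}=\{1,\dots,|\mathcal{S}|\}$; for $x\in\mathcal{S}^\mathcal{D}$, $x^d$ is its $d$-th coordinate, $x^{\setminus d}$ the other coordinates, $\delta_a(b)$ the Kronecker delta, $d^H$ the Hamming distance. $p_1$ is a data pmf on $\mathcal{S}^\mathcal{D}$, $p_0=\prod_dp_0^d$ a source distribution, $\kappa:[0,1]\to[0,1]$ non-decreasing, continuous (differentiable), $\kappa_0=0,\kappa_1=1$. With $X(1)\sim p_1$ and, given $X(1)=x_1$, independent coordinates $P(X^d(t)=y\mid X(1)=x_1)=(1-\kappa_t)p^d_0(y)+\kappa_t\delta_{x_1^d}(y)$, the posterior is $p^d_{1|t}(y\mid x)=P(X^d(1)=y\mid X(t)=x)$. For $z^d\ne x^d$, $Q^d_t(x,z^d)=\frac{\dot\kappa_t}{1-\kappa_t}p^d_{1|t}(z^d\mid x)$, and the oracle rate is $Q_t(x,z)=\sum_d\delta_{x^{\setminus d}}(z^{\setminus d})Q^d_t(x,z^d)$ for $z\ne x$, $Q_t(x,x)=-\sum_{z\ne x}Q_t(x,z)$. The Euler rate on $[t_{k-1},t_k]$ is $Q^{\mathrm{Euler}}_t(x,z)=\sum_d\delta_{x^{\setminus d}}(z^{\setminus d})\delta_{x^d_{k-1}}(x^d)Q^d_{t_{k-1}}(x_{k-1},z^d)$ for $z\neq x$ (with diagonal minus the row sum). $D_F(a\|b)=a\log(a/b)-a+b$. *)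

theory Defs
  imports "HOL-Probability.Probability"
begin

definition hamming :: "('d::finite \<Rightarrow> 's) \<Rightarrow> ('d \<Rightarrow> 's) \<Rightarrow> nat" where
  "hamming x z = card {d. x d \<noteq> z d}"

definition DF :: "real \<Rightarrow> real \<Rightarrow> real" where
  "DF a b = a * ln (a / b) - a + b"

definition joint_law ::
  "('d::finite \<Rightarrow> 's) pmf \<Rightarrow> ('d \<Rightarrow> 's pmf) \<Rightarrow> (real \<Rightarrow> real) \<Rightarrow> real \<Rightarrow> (('d \<Rightarrow> 's) \<times> ('d \<Rightarrow> 's)) pmf" where
  "joint_law p1 p0 \<kappa> t =
     bind_pmf p1 (\<lambda>x1.
       bind_pmf (Pi_pmf UNIV undefined
                   (\<lambda>d. bind_pmf (bernoulli_pmf (\<kappa> t)) (\<lambda>b. if b then return_pmf (x1 d) else p0 d)))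
         (\<lambda>xt. return_pmf (xt, x1)))"

definition posterior ::
  "('d::finite \<Rightarrow> 's) pmf \<Rightarrow> ('d \<Rightarrow> 's pmf) \<Rightarrow> (real \<Rightarrow> real) \<Rightarrow> real \<Rightarrow> 'd \<Rightarrow> 's \<Rightarrow> ('d \<Rightarrow> 's) \<Rightarrow> real" where
  "posterior p1 p0 \<kappa> t d y x =
     measure_pmf.prob (joint_law p1 p0 \<kappa> t) {(xt, x1). xt = x \<and> x1 d = y}
     / measure_pmf.prob (joint_law p1 p0 \<kappa> t) {(xt, x1). xt = x}"

text \<open>Coordinate rate Q^d_t(x, y) = kappa'_t / (1 - kappa_t) p^d_{1|t}(y | x) (used for y \<noteq> x^d);
  dk is the derivative of kappa.\<close>
definition Qd ::
  "('d::finite \<Rightarrow> 's) pmf \<Rightarrow> ('d \<Rightarrow> 's pmf) \<Rightarrow> (real \<Rightarrow> real) \<Rightarrow> (real \<Rightarrow> real) \<Rightarrow> real \<Rightarrow> ('d \<Rightarrow> 's) \<Rightarrow> 'd \<Rightarrow> 's \<Rightarrow> real" where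
  "Qd p1 p0 \<kappa> dk t x d y = dk t / (1 - \<kappa> t) * posterior p1 p0 \<kappa> t d y x"

definition Qoff ::
  "('d::finite \<Rightarrow> 's) pmf \<Rightarrow> ('d \<Rightarrow> 's pmf) \<Rightarrow> (real \<Rightarrow> real) \<Rightarrow> (real \<Rightarrow> real) \<Rightarrow> real \<Rightarrow> ('d \<Rightarrow> 's) \<Rightarrow> ('d \<Rightarrow> 's) \<Rightarrow> real" where
  "Qoff p1 p0 \<kappa> dk t x z =
     (\<Sum>d\<in>UNIV. if (\<forall>e. e \<noteq> d \<longrightarrow> z e = x e) then Qd p1 p0 \<kappa> dk t x d (z d) else 0)"

definition Qrate ::
  "('d::finite \<Rightarrow> 's::finite) pmf \<Rightarrow> ('d \<Rightarrow> 's pmf) \<Rightarrow> (real \<Rightarrow> real) \<Rightarrow> (real \<Rightarrow> real) \<Rightarrow> real \<Rightarrow> ('d \<Rightarrow> 's) \<Rightarrow> ('d \<Rightarrow> 's) \<Rightarrow> real" where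
  "Qrate p1 p0 \<kappa> dk t x z =
     (if z \<noteq> x then Qoff p1 p0 \<kappa> dk t x z
      else - (\<Sum>z'\<in>{z'. z' \<noteq> x}. Qoff p1 p0 \<kappa> dk t x z'))"

definition QEoff ::
  "('d::finite \<Rightarrow> 's) pmf \<Rightarrow> ('d \<Rightarrow> 's pmf) \<Rightarrow> (real \<Rightarrow> real) \<Rightarrow> (real \<Rightarrow> real) \<Rightarrow> real \<Rightarrow> ('d \<Rightarrow> 's) \<Rightarrow> ('d \<Rightarrow> 's) \<Rightarrow> ('d \<Rightarrow> 's) \<Rightarrow> real" where
  "QEoff p1 p0 \<kappa> dk t0 x0 x z =
     (\<Sum>d\<in>UNIV. if (\<forall>e. e \<noteq> d \<longrightarrow> z e = x e) \<and> x d = x0 d then Qd p1 p0 \<kappa> dk t0 x0 d (z d) else 0)"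

definition QEuler ::
  "('d::finite \<Rightarrow> 's::finite) pmf \<Rightarrow> ('d \<Rightarrow> 's pmf) \<Rightarrow> (real \<Rightarrow> real) \<Rightarrow> (real \<Rightarrow> real) \<Rightarrow> real \<Rightarrow> ('d \<Rightarrow> 's) \<Rightarrow> ('d \<Rightarrow> 's) \<Rightarrow> ('d \<Rightarrow> 's) \<Rightarrow> real" where
  "QEuler p1 p0 \<kappa> dk t0 x0 x z =
     (if z \<noteq> x then QEoff p1 p0 \<kappa> dk t0 x0 x z
      else - (\<Sum>z'\<in>{z'. z' \<noteq> x}. QEoff p1 p0 \<kappa> dk t0 x0 x z'))"

text \<open>Construction by competing exponential clocks: in state y entered at time T, target z \<noteq> y
  fires at the first time s with integral from T to s of R(r,y,z) dr \<ge> -ln u, u uniform on (0,1).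
  The value b + 1 encodes "no jump in [T, b]".\<close>
definition clock_time :: "(real \<Rightarrow> 'x \<Rightarrow> 'x \<Rightarrow> real) \<Rightarrow> real \<Rightarrow> real \<Rightarrow> 'x \<Rightarrow> 'x \<Rightarrow> real \<Rightarrow> real" where
  "clock_time R b T y z u =
     (let S = {s\<in>{T..b}. integral {T..s} (\<lambda>r. R r y z) \<ge> - ln u}
      in if z = y \<or> S = {} then b + 1 else Inf S)"

definition jump_step :: "(real \<Rightarrow> 'x::finite \<Rightarrow> 'x \<Rightarrow> real) \<Rightarrow> real \<Rightarrow> real \<times> 'x \<Rightarrow> ('x \<Rightarrow> real) \<Rightarrow> real \<times> 'x" where
  "jump_step R b Ty \<omega> =
     (let T = fst Ty; y = snd Ty; c = (\<lambda>z. clock_time R b T y z (\<omega> z)); m = Min (range c)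
      in if m > b then (b + 1, y) else (m, SOME z. c z = m))"

primrec jump_chain :: "(real \<Rightarrow> 'x::finite \<Rightarrow> 'x \<Rightarrow> real) \<Rightarrow> real \<Rightarrow> real \<Rightarrow> 'x \<Rightarrow> ('x \<Rightarrow> real) stream \<Rightarrow> nat \<Rightarrow> real \<times> 'x" where
  "jump_chain R a b x0 \<omega> 0 = (a, x0)"
| "jump_chain R a b x0 \<omega> (Suc i) = jump_step R b (jump_chain R a b x0 \<omega> i) (\<omega> !! i)"

definition jump_path :: "(real \<Rightarrow> 'x::finite \<Rightarrow> 'x \<Rightarrow> real) \<Rightarrow> real \<Rightarrow> real \<Rightarrow> 'x \<Rightarrow> ('x \<Rightarrow> real) stream \<Rightarrow> real \<Rightarrow> 'x" where
  "jump_path R a b x0 \<omega> s =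
     snd (jump_chain R a b x0 \<omega> (LEAST i. fst (jump_chain R a b x0 \<omega> (Suc i)) > s))"

definition path_measure :: "(real \<Rightarrow> 'x::finite \<Rightarrow> 'x \<Rightarrow> real) \<Rightarrow> real \<Rightarrow> real \<Rightarrow> 'x \<Rightarrow> (real \<Rightarrow> 'x) measure" where
  "path_measure R a b x0 =
     distr (stream_space (Pi\<^sub>M (UNIV :: 'x set) (\<lambda>_. uniform_measure lborel {0<..<1::real})))
           (Pi\<^sub>M {a..b} (\<lambda>_. count_space UNIV))
           (\<lambda>\<omega>. restrict (jump_path R a b x0 \<omega>) {a..b})"

definition KL_div :: "'a measure \<Rightarrow> 'a measure \<Rightarrow> ereal" where
  "KL_div P Q =
     (if absolutely_continuous Q P \<and> integrable P (\<lambda>x. ln (enn2real (RN_deriv Q P x)))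
      then ereal (\<integral>x. ln (enn2real (RN_deriv Q P x)) \<partial>P) else \<infinity>)"

end

theory Submission
  imports Defs
begin

text \<open>For any weight \<open>W > 0\<close> on path space with \<open>\<integral> W dP \<le> 1\<close> the Donsker--Varadhan inequality
  gives \<open>KL PE P \<ge> \<integral> ln W dPE\<close>. Take for \<open>W\<close> the Girsanov density restricted to the first two jumps
  of the path. By the law of competing clocks and an integration by parts, its expected
  logarithm is the integral of the Bregman costs \<open>DF\<close> of all target states up to the second jump.
  Under the step size condition the Euler process has not jumped, respectively has jumped
  to a given neighbour at time \<open>u\<close> and stayed there, with density at least half of that
  without killing; the two cases give the two terms of the bound.

  Two points make this rigorous without regularity of \<open>\<kappa>'\<close>. The rates are \<open>\<kappa>'\<close> times a continuous
  function of \<open>\<kappa>\<close>, hence everywhere derivatives, so the fundamental theorem of calculus applies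
  although they may be unbounded. And instead of the Euler rates \<open>RE\<close>, which may vanish, the mixture
  \<open>(1 - \<theta>) RE + \<theta> R\<close> is used in \<open>W\<close>; this bounds \<open>ln W\<close> below and costs only a factor \<open>1 - \<theta>\<close>.\<close>

section \<open>Bregman cost and the variational bound\<close>

text \<open>\<open>KL_div\<close> is defined through \<open>RN_deriv\<close>, so an exact formula
  would require the density on the whole path space; a lower bound requires only one admissible test
  function. Two jumps suffice for it. Until the first jump the Euler rates are the oracle rates of
  \<open>x0\<close> frozen at \<open>t0\<close>, which produces the term with \<open>L'\<close>. The
  price is that both jumps have to be recovered measurably from a path. The Bregman costs may have
  infinite integral, so they are estimated as extended non-negative integrals, and the logarithm of
  the weight is shifted by a constant to become non-negative. The constants are powers of 1/2. The
  first term loses one factor to survival and one to \<open>CARD('s) - 1 \<ge> CARD('s) / 2\<close>.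
  The second loses one to survival, one to the area of the triangle of pairs (jump time, later
  time), and three to replacing \<open>CARD('s) - 1\<close> twice and \<open>CARD('d) - 1\<close>
  once.\<close>

lemma DF_0_left [simp]: "DF 0 b = b"
  by (simp add: DF_def)

text \<open>For \<open>a > 0\<close> and \<open>b = 0\<close> the classical value is infinite, which
  a real-valued \<open>DF\<close> cannot represent; the third hypothesis excludes this case.
  Otherwise apply \<open>ln w \<le> w - 1\<close> at \<open>w = b / a\<close>.\<close>

lemma DF_nonneg:
  assumes "0 \<le> a" "0 \<le> b" "b = 0 \<Longrightarrow> a = 0"
  shows "0 \<le> DF a b"
proof (cases "a = 0")
  case False
  then have a: "a > 0" and b: "b > 0" using assms by (auto simp: order_le_less)
  have "ln (b / a) \<le> b / a - 1" using a b by (intro ln_le_minus_one) auto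
  then have "a * ln (b / a) \<le> b - a"
    using a by (simp add: field_simps)
  moreover have "ln (b / a) = - ln (a / b)" using a b by (simp add: ln_div)
  ultimately show ?thesis by (simp add: DF_def)
qed (use assms in simp)

text \<open>Concavity of \<open>ln\<close> between \<open>a / b\<close> and 1 gives the logarithmic
  part, and the linear parts agree exactly, since \<open>b - ((1 - \<theta>) * a + \<theta> * b) =
  (1 - \<theta>) * (b - a)\<close>. This is the price of using mixed rates in the weight.\<close>

lemma DF_interpolate_le:
  assumes "0 \<le> a" "0 < b" "0 < \<theta>" "\<theta> < 1"
  shows "(1 - \<theta>) * DF a b \<le> a * ln (((1 - \<theta>) * a + \<theta> * b) / b) - ((1 - \<theta>) * a + \<theta> * b) + b"
proof (cases "a = 0")
  case False
  then have a: "a > 0" using assms by simp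
  have "convex_on {0<..} (\<lambda>x. - ln x :: real)"
    using minus_log_convex[of "exp 1"] by (simp add: log_def)
  from convex_onD[OF this, of \<theta> "a / b" 1]
  have "(1 - \<theta>) * ln (a / b) \<le> ln ((1 - \<theta>) * (a / b) + \<theta>)"
    using assms a by (simp add: algebra_simps)
  also have "(1 - \<theta>) * (a / b) + \<theta> = ((1 - \<theta>) * a + \<theta> * b) / b"
    using assms by (simp add: field_simps)
  finally have "a * ((1 - \<theta>) * ln (a / b)) \<le> a * ln (((1 - \<theta>) * a + \<theta> * b) / b)"
    using a by (intro mult_left_mono) auto
  then show ?thesis by (simp add: DF_def algebra_simps)
qed (use assms in \<open>simp add: algebra_simps\<close>)

lemma KL_div_variational:
  fixes P PE :: "'a measure" and W :: "'a \<Rightarrow> real" and C :: real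
  assumes P: "prob_space P" and PE: "prob_space PE" and sets: "sets PE = sets P"
    and W [measurable]: "W \<in> borel_measurable P"
    and Wlb: "\<And>x. exp (- C) \<le> W x"
    and Wint: "(\<integral>\<^sup>+x. ennreal (W x) \<partial>P) \<le> 1"
  shows "enn2ereal (\<integral>\<^sup>+x. ennreal (ln (W x) + C) \<partial>PE) \<le> KL_div PE P + ereal C"
proof (cases "absolutely_continuous P PE \<and> integrable PE (\<lambda>x. ln (enn2real (RN_deriv P PE x)))")
  case False
  then show ?thesis by (auto simp: KL_div_def)
next
  case True
  interpret P: prob_space P by fact
  interpret PE: prob_space PE by fact
  define r where "r = RN_deriv P PE"
  have ac: "absolutely_continuous P PE" using True by simp
  have int: "integrable PE (\<lambda>x. ln (enn2real (r x)))" using True by (simp add: r_def)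
  have rm [measurable]: "r \<in> borel_measurable P" by (simp add: r_def)
  have dens: "PE = density P r"
    using P.density_RN_deriv[OF ac sets] by (simp add: r_def)
  have [measurable_cong]: "sets PE = sets P" by fact
  have fin: "AE x in P. r x \<noteq> \<infinity>"
    using P.RN_deriv_finite[OF _ ac sets] PE.sigma_finite_measure_axioms by (simp add: r_def)
  have finE: "AE x in PE. r x \<noteq> \<infinity>"
    unfolding dens using fin by (subst AE_density) auto
  have posE: "AE x in PE. 0 < r x"
    unfolding dens by (subst AE_density) auto
  have Wpos: "0 < W x" for x using Wlb[of x] exp_gt_zero[of "- C"] by linarith
  have lnW: "0 \<le> ln (W x) + C" for x
    using Wlb[of x] Wpos[of x] ln_ge_iff[of "W x" "- C"] by simp
  define v where "v x = W x / enn2real (r x)" for x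
  have vm [measurable]: "v \<in> borel_measurable P" unfolding v_def by measurable
  have v0: "0 \<le> v x" for x using Wpos[of x] by (simp add: v_def)
  have "(\<integral>\<^sup>+x. ennreal (v x) \<partial>PE) = (\<integral>\<^sup>+x. r x * ennreal (v x) \<partial>P)"
    unfolding dens by (subst nn_integral_density) auto
  \<comment> \<open>Only an inequality: where \<open>r\<close> vanishes, \<open>W\<close> may still
    carry mass under \<open>P\<close>.\<close>
  also have "\<dots> \<le> (\<integral>\<^sup>+x. ennreal (W x) \<partial>P)"
  proof (rule nn_integral_mono_AE, use fin in eventually_elim)
    fix x assume x: "r x \<noteq> \<infinity>"
    show "r x * ennreal (v x) \<le> ennreal (W x)"
    proof (cases "r x = 0")
      case False
      with x have p: "0 < enn2real (r x)"
        by (simp add: enn2real_positive_iff less_top top.not_eq_extremum zero_less_iff_neq_zero)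
      have "r x = ennreal (enn2real (r x))" using x by (simp add: less_top)
      then have "r x * ennreal (v x) = ennreal (enn2real (r x) * v x)"
        by (metis ennreal_mult enn2real_nonneg v0)
      also have "enn2real (r x) * v x = W x" using p by (simp add: v_def)
      finally show ?thesis by simp
    qed simp
  qed
  finally have vle: "(\<integral>\<^sup>+x. ennreal (v x) \<partial>PE) \<le> 1" using Wint by simp
  have vint: "integrable PE v"
    by (rule integrableI_nonneg) (use vle v0 in \<open>auto intro: le_less_trans\<close>)
  have vle': "(\<integral>x. v x \<partial>PE) \<le> 1"
    using vle v0 by (subst integral_eq_nn_integral) (auto intro: enn2real_leI)
  have lnle: "AE x in PE. ln (W x) + C \<le> ln (enn2real (r x)) + v x - 1 + C"
    using finE posE
  proof eventually_elim
    case (elim x)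
    then have p: "0 < enn2real (r x)"
      by (simp add: enn2real_positive_iff less_top)
    have "ln (v x) \<le> v x - 1"
      using p Wpos[of x] by (intro ln_le_minus_one) (simp add: v_def)
    also have "ln (v x) = ln (W x) - ln (enn2real (r x))"
      using p Wpos[of x] by (simp add: v_def ln_div)
    finally show ?case by simp
  qed
  have i2: "integrable PE (\<lambda>x. ln (enn2real (r x)) + v x - 1 + C)"
    using int vint by auto
  \<comment> \<open>\<open>ln (W x) + C\<close> is squeezed between 0 and an integrable function, so
    its integrability follows here and is not an assumption.\<close>
  have i1: "integrable PE (\<lambda>x. ln (W x) + C)"
    by (rule Bochner_Integration.integrable_bound[OF i2])
       (use lnle lnW in \<open>auto elim!: eventually_mono\<close>)
  have "(\<integral>x. ln (W x) + C \<partial>PE) \<le> (\<integral>x. ln (enn2real (r x)) + v x - 1 + C \<partial>PE)"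
    by (rule integral_mono_AE[OF i1 i2 lnle])
  also have "\<dots> = (\<integral>x. ln (enn2real (r x)) \<partial>PE) + (\<integral>x. v x \<partial>PE) - 1 + C"
    using int vint by (simp add: PE.prob_space)
  also have "\<dots> \<le> (\<integral>x. ln (enn2real (r x)) \<partial>PE) + C" using vle' by simp
  finally have le: "(\<integral>x. ln (W x) + C \<partial>PE) \<le> (\<integral>x. ln (enn2real (r x)) \<partial>PE) + C" .
  have "(\<integral>\<^sup>+x. ennreal (ln (W x) + C) \<partial>PE) = ennreal (\<integral>x. ln (W x) + C \<partial>PE)"
    by (rule nn_integral_eq_integral[OF i1]) (use lnW in auto)
  moreover have "0 \<le> (\<integral>x. ln (W x) + C \<partial>PE)" by (rule integral_nonneg_AE) (use lnW in auto)
  ultimately show ?thesis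
    using le True by (simp add: KL_div_def r_def enn2ereal_ennreal)
qed

section \<open>Competing clocks\<close>

text \<open>The selection rule of \<open>jump_step\<close>, separated from the clocks that feed it,
  so that \<open>obs_step\<close> can apply the same rule to times observed on a path.\<close>

definition first_clock :: "real \<Rightarrow> 'x::finite \<Rightarrow> ('x \<Rightarrow> real) \<Rightarrow> real \<times> 'x" where
  "first_clock b y c = (let m = Min (range c) in if m > b then (b + 1, y) else (m, SOME z. c z = m))"

lemma jump_step_first_clock:
  "jump_step R b Ty \<omega> = first_clock b (snd Ty) (\<lambda>z. clock_time R b (fst Ty) (snd Ty) z (\<omega> z))"
  by (simp add: jump_step_def first_clock_def Let_def)

lemma first_clock_none: "(\<And>z. b < c z) \<Longrightarrow> first_clock b y c = (b + 1, y)"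
  by (simp add: first_clock_def)

lemma first_clock_eq:
  assumes "c z \<le> b" "\<And>z'. z' \<noteq> z \<Longrightarrow> c z < c z'"
  shows "first_clock b y c = (c z, z)"
proof -
  have m: "Min (range c) = c z"
    by (rule Min_eqI) (use assms(2) in \<open>force simp: less_le\<close>)+
  have "(SOME z'. c z' = c z) = z"
    by (rule some_equality) (use assms(2) in force)+
  then show ?thesis using assms m by (simp add: first_clock_def Let_def)
qed

lemma first_clock_cases:
  obtains "first_clock b y c = (b + 1, y)" "\<And>z. b < c z"
    | z where "first_clock b y c = (c z, z)" "c z \<le> b" "\<And>z'. c z \<le> c z'"
proof (cases "b < Min (range c)")
  case True
  then show ?thesis using that(1) by (simp add: first_clock_def)
next
  case False
  let ?m = "Min (range c)"
  have "?m \<in> range c" by (rule Min_in) auto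
  then have "\<exists>z. c z = ?m" by (metis rangeE)
  then have "c (SOME z. c z = ?m) = ?m" by (rule someI_ex)
  then show ?thesis
    using that(2)[of "SOME z. c z = ?m"] False by (auto simp: first_clock_def Let_def)
qed

text \<open>The choice among tied clocks depends on the sample point only through the finite set
  \<open>A w\<close> of minimisers. This is a measurable map into a discrete space, where every
  choice function is measurable.\<close>

lemma measurable_first_clock:
  fixes c :: "'x::finite \<Rightarrow> 'a \<Rightarrow> real"
  assumes [measurable]: "y \<in> measurable M (count_space UNIV)" "\<And>z. c z \<in> borel_measurable M"
  shows "(\<lambda>w. first_clock b (y w) (\<lambda>z. c z w)) \<in> M \<rightarrow>\<^sub>M borel \<Otimes>\<^sub>M count_space UNIV"
proof -
  define m where "m w = Min (range (\<lambda>z. c z w))" for w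
  have [measurable]: "m \<in> borel_measurable M"
    unfolding m_def by (rule borel_measurable_Min) auto
  define A where "A w = {z. c z w = m w}" for w
  have [measurable]: "A \<in> measurable M (count_space UNIV)"
  proof (subst measurable_count_space_eq2, simp, safe)
    fix B :: "'x set"
    have "A -` {B} \<inter> space M = {w\<in>space M. \<forall>z. (c z w = m w) = (z \<in> B)}"
      by (auto simp: A_def)
    also have "\<dots> \<in> sets M" by measurable
    finally show "A -` {B} \<inter> space M \<in> sets M" .
  qed auto
  have [measurable]: "(\<lambda>w. SOME z. z \<in> A w) \<in> measurable M (count_space UNIV)"
    by (rule measurable_compose[OF \<open>A \<in> _\<close>]) simp
  have "(\<lambda>w. first_clock b (y w) (\<lambda>z. c z w)) = (\<lambda>w. if m w > b then (b + 1, y w) else (m w, SOME z. z \<in> A w))"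
    by (auto simp: first_clock_def m_def A_def Let_def)
  then show ?thesis by simp
qed

text \<open>For the gauge integral this holds for every derivative, bounded or not. The densities of
  the jump times are integrated through it.\<close>

lemma has_integral_deriv_within:
  fixes G g :: "real \<Rightarrow> real"
  assumes "\<And>s. s \<in> {a..b} \<Longrightarrow> (G has_real_derivative g s) (at s within {a..b})"
    and "a \<le> u" "u \<le> v" "v \<le> b"
  shows "(g has_integral (G v - G u)) {u..v}"
proof (rule fundamental_theorem_of_calculus[OF assms(3)])
  fix s assume "s \<in> {u..v}"
  then show "(G has_vector_derivative g s) (at s within {u..v})"
    using has_field_derivative_subset[OF assms(1)[of s], of "{u..v}"] assms(2-)
    by (auto simp: has_real_derivative_iff_has_vector_derivative)
qed

section \<open>Uniform clocks, cumulative hazards and firing times\<close>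

abbreviation unit_clock :: "real measure" where
  "unit_clock \<equiv> uniform_measure lborel {0<..<1}"

abbreviation clocks :: "('x \<Rightarrow> real) measure" where
  "clocks \<equiv> Pi\<^sub>M UNIV (\<lambda>_. unit_clock)"

lemma prob_space_unit_clock: "prob_space unit_clock"
  by (rule prob_space_uniform_measure) auto

lemma prob_space_clocks: "prob_space (clocks :: ('x \<Rightarrow> real) measure)"
  by (rule prob_space_PiM) (rule prob_space_unit_clock)

lemma clock_component_measurable: "(\<lambda>w. w z) \<in> borel_measurable clocks"
proof -
  have "(\<lambda>w. w z) \<in> clocks \<rightarrow>\<^sub>M unit_clock" by (rule measurable_component_singleton) simp
  then show ?thesis
    by (simp only: measurable_cong_sets[OF refl sets_uniform_measure] measurable_lborel1 measurable_lborel2)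
qed

lemma AE_unit_clock: "AE u in unit_clock. 0 < u \<and> u < 1"
  by (rule AE_uniform_measureI) auto

text \<open>The antiderivative \<open>H\<close> is required at every point, not only almost everywhere: this
  gives the fundamental theorem of calculus for \<open>exp (- H)\<close> without any regularity of \<open>R\<close>.\<close>

locale jump_rates =
  fixes R :: "real \<Rightarrow> 'x::finite \<Rightarrow> 'x \<Rightarrow> real" and H :: "'x \<Rightarrow> 'x \<Rightarrow> real \<Rightarrow> real" and a b :: real
  assumes ab: "a < b"
    and rate_nonneg: "\<And>s y z. s \<in> {a..b} \<Longrightarrow> y \<noteq> z \<Longrightarrow> 0 \<le> R s y z"
    and H_deriv: "\<And>s y z. s \<in> {a..b} \<Longrightarrow> y \<noteq> z \<Longrightarrow> (H y z has_real_derivative R s y z) (at s within {a..b})"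
    and rate_measurable: "\<And>y z. y \<noteq> z \<Longrightarrow> (\<lambda>s. indicator {a..b} s * R s y z) \<in> borel_measurable borel"
begin

text \<open>\<open>H\<close> is controlled only on \<open>{a..b}\<close>. Composition with
  \<open>clip\<close> extends the hazards to the whole line, constant outside the interval, so that
  \<open>haz y z T\<close> is continuous and monotone everywhere.\<close>

definition clip :: "real \<Rightarrow> real" where "clip s = max a (min b s)"

definition r :: "'x \<Rightarrow> 'x \<Rightarrow> real \<Rightarrow> real" where
  "r y z s = (if z = y then 0 else indicator {a..b} s * R s y z)"

definition haz :: "'x \<Rightarrow> 'x \<Rightarrow> real \<Rightarrow> real \<Rightarrow> real" where
  "haz y z T s = (if z = y then 0 else H y z (clip s) - H y z (clip T))"

definition Haz :: "'x \<Rightarrow> real \<Rightarrow> real \<Rightarrow> real" where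
  "Haz y T s = (\<Sum>z\<in>UNIV. haz y z T s)"

lemma clip_id [simp]: "s \<in> {a..b} \<Longrightarrow> clip s = s"
  by (simp add: clip_def)

lemma clip_range: "clip s \<in> {a..b}"
  using ab by (simp add: clip_def)

lemma clip_mono: "s \<le> t \<Longrightarrow> clip s \<le> clip t"
  by (auto simp: clip_def)

lemma r_nonneg: "0 \<le> r y z s"
  using rate_nonneg[of s y z] by (auto simp: r_def indicator_def)

lemma r_measurable [measurable]: "r y z \<in> borel_measurable borel"
  using rate_measurable[of y z] by (cases "z = y") (auto simp: r_def[abs_def])

lemma continuous_H_clip: "z \<noteq> y \<Longrightarrow> continuous_on UNIV (\<lambda>s. H y z (clip s))"
proof -
  assume "z \<noteq> y"
  then have "continuous_on {a..b} (H y z)"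
    using H_deriv[of _ y z] by (intro DERIV_continuous_on) auto
  moreover have "continuous_on UNIV clip" unfolding clip_def by (intro continuous_intros)
  ultimately show ?thesis
    using clip_range by (intro continuous_on_compose2[of "{a..b}" "H y z" UNIV clip]) auto
qed

lemma haz_measurable [measurable]:
  "(\<lambda>x. haz y z (fst x) (snd x)) \<in> borel_measurable (borel \<Otimes>\<^sub>M borel)"
proof (cases "z = y")
  case False
  have [measurable]: "(\<lambda>s. H y z (clip s)) \<in> borel_measurable borel"
    by (rule borel_measurable_continuous_onI[OF continuous_H_clip[OF False]])
  show ?thesis using False by (simp add: haz_def)
qed (simp add: haz_def)

lemma haz_measurable' [measurable (raw)]:
  assumes "T \<in> borel_measurable M" "s \<in> borel_measurable M"
  shows "(\<lambda>x. haz y z (T x) (s x)) \<in> borel_measurable M"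
  using measurable_compose[OF measurable_Pair[OF assms] haz_measurable] by simp

lemma Haz_measurable' [measurable (raw)]:
  assumes [measurable]: "T \<in> borel_measurable M" "s \<in> borel_measurable M"
  shows "(\<lambda>x. Haz y (T x) (s x)) \<in> borel_measurable M"
  unfolding Haz_def by measurable

lemma continuous_haz: "continuous_on UNIV (haz y z T)"
proof (cases "z = y")
  case False
  then show ?thesis
    unfolding haz_def by (simp, intro continuous_intros continuous_H_clip[OF False])
qed (simp add: haz_def)

lemma haz_deriv:
  assumes s: "s \<in> {a..b}"
  shows "(haz y z T has_real_derivative r y z s) (at s within {a..b})"
proof (cases "z = y")
  case False
  have "((\<lambda>s. H y z s - H y z (clip T)) has_real_derivative R s y z) (at s within {a..b})"
    using H_deriv[OF s, of y z] False by (auto intro!: derivative_eq_intros)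
  then have "(haz y z T has_real_derivative R s y z) (at s within {a..b})"
    unfolding has_field_derivative_def
    by (rule has_derivative_transform[OF s, rotated]) (use False in \<open>auto simp: haz_def\<close>)
  then show ?thesis using False s by (simp add: r_def)
qed (simp add: haz_def[abs_def] r_def)

lemma Haz_deriv:
  assumes "s \<in> {a..b}"
  shows "(Haz y T has_real_derivative (\<Sum>z\<in>UNIV. r y z s)) (at s within {a..b})"
  unfolding Haz_def[abs_def] by (intro DERIV_sum haz_deriv assms)

lemma haz_self [simp]: "haz y z T T = 0"
  by (simp add: haz_def)

lemma Haz_self [simp]: "Haz y T T = 0"
  by (simp add: Haz_def)

lemma haz_mono:
  assumes "s \<le> t"
  shows "haz y z T s \<le> haz y z T t"
proof -
  have "(r y z has_integral (haz y z T (clip t) - haz y z T (clip s))) {clip s..clip t}"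
    by (rule has_integral_deriv_within[OF haz_deriv])
       (use clip_range[of s] clip_range[of t] clip_mono[OF assms] in auto)
  then have "0 \<le> haz y z T (clip t) - haz y z T (clip s)"
    by (rule has_integral_nonneg) (rule r_nonneg)
  then show ?thesis using clip_range by (simp add: haz_def split: if_splits)
qed

lemma haz_nonneg: "T \<le> s \<Longrightarrow> 0 \<le> haz y z T s"
  using haz_mono[of T s y z T] by simp

lemma Haz_nonneg: "T \<le> s \<Longrightarrow> 0 \<le> Haz y T s"
  unfolding Haz_def by (intro sum_nonneg haz_nonneg)

text \<open>Valid for \<open>T\<close> and \<open>s\<close> in either order:
  \<open>haz y z T s = haz y z a s - haz y z a T\<close>, where the first term is at most its value
  at \<open>b\<close> and the second is non-negative. It later bounds the likelihood ratios
  uniformly.\<close>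

lemma Haz_le: "Haz y T s \<le> Haz y a b"
proof -
  have "haz y z T s \<le> haz y z a b" for z
  proof (cases "z = y")
    case False
    have "haz y z a s \<le> haz y z a b"
      using haz_mono[of "clip s" b y z a] clip_range[of s] False by (simp add: haz_def)
    moreover have "0 \<le> haz y z a T"
      using haz_nonneg[of a "clip T" y z] clip_range[of T] False by (simp add: haz_def)
    ultimately show ?thesis using False by (simp add: haz_def)
  qed (simp add: haz_def)
  then show ?thesis unfolding Haz_def by (intro sum_mono)
qed

lemma integral_rate:
  assumes "a \<le> T" "T \<le> s" "s \<le> b" "z \<noteq> y"
  shows "integral {T..s} (\<lambda>t. R t y z) = haz y z T s"
proof -
  have "((\<lambda>t. R t y z) has_integral (H y z s - H y z T)) {T..s}"
    by (rule has_integral_deriv_within[OF H_deriv]) (use assms in auto)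
  then show ?thesis using assms by (simp add: haz_def integral_unique)
qed

lemma clock_time_self [simp]: "clock_time R b T y y u = b + 1"
  by (simp add: clock_time_def)

text \<open>Continuity of the hazard makes the set of admissible firing times closed, so its infimum
  is attained; monotonicity then reduces the event to one inequality at \<open>min c b\<close>. The
  disjunct \<open>b + 1 \<le> c\<close> accounts for the value that encodes no jump. Measurability
  and law of the clocks both rest on this.\<close>

lemma clock_time_le_iff:
  assumes T: "a \<le> T" and zy: "z \<noteq> y"
  shows "clock_time R b T y z u \<le> c \<longleftrightarrow> b + 1 \<le> c \<or> T \<le> min c b \<and> - ln u \<le> haz y z T (min c b)"
proof -
  define S where "S = {s\<in>{T..b}. - ln u \<le> haz y z T s}"
  have S: "{s \<in> {T..b}. integral {T..s} (\<lambda>r. R r y z) \<ge> - ln u} = S"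
    using T zy by (auto simp: S_def integral_rate)
  have ct: "clock_time R b T y z u = (if S = {} then b + 1 else Inf S)"
    unfolding clock_time_def Let_def S using zy by simp
  show ?thesis
  proof (cases "S = {}")
    case True
    then show ?thesis by (auto simp: ct S_def)
  next
    case False
    have cl: "closed S"
    proof -
      have "closed {s. - ln u \<le> haz y z T s}"
        by (rule closed_Collect_le) (auto intro: continuous_haz)
      moreover have "S = {T..b} \<inter> {s. - ln u \<le> haz y z T s}" by (auto simp: S_def)
      ultimately show ?thesis by (simp add: closed_Int)
    qed
    have bdd: "bdd_below S" by (rule bdd_belowI[of _ T]) (simp add: S_def)
    have I: "Inf S \<in> S" by (rule closed_contains_Inf[OF False bdd cl])
    show ?thesis
    proof
      assume "clock_time R b T y z u \<le> c"
      then have c: "Inf S \<le> c" using False by (simp add: ct)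
      then have "Inf S \<le> min c b" using I by (auto simp: S_def)
      from haz_mono[OF this, of y z T] this I
      show "b + 1 \<le> c \<or> T \<le> min c b \<and> - ln u \<le> haz y z T (min c b)" by (auto simp: S_def)
    next
      assume "b + 1 \<le> c \<or> T \<le> min c b \<and> - ln u \<le> haz y z T (min c b)"
      then show "clock_time R b T y z u \<le> c"
      proof
        assume "b + 1 \<le> c"
        then show ?thesis using False I by (auto simp: ct S_def)
      next
        assume "T \<le> min c b \<and> - ln u \<le> haz y z T (min c b)"
        then have "min c b \<in> S" by (auto simp: S_def)
        then have "Inf S \<le> min c b" using bdd by (rule cInf_lower)
        then show ?thesis using False by (simp add: ct)
      qed
    qed
  qed
qed

lemma clock_time_gt:
  assumes "a \<le> T" "T \<le> b" "0 < u" "u < 1"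
  shows "T < clock_time R b T y z u"
proof (cases "z = y")
  case False
  then have "\<not> clock_time R b T y z u \<le> T"
    using clock_time_le_iff[of T z y u T] assms by simp
  then show ?thesis by simp
qed (use assms in simp)

lemma clock_time_expired: "b < T \<Longrightarrow> clock_time R b T y z u = b + 1"
  by (simp add: clock_time_def)

lemma clock_time_measurable:
  assumes [measurable]: "T \<in> borel_measurable M" "u \<in> borel_measurable M"
    and T: "\<And>w. w \<in> space M \<Longrightarrow> a \<le> T w"
  shows "(\<lambda>w. clock_time R b (T w) y z (u w)) \<in> borel_measurable M"
proof (cases "z = y")
  case False
  show ?thesis
  proof (rule borel_measurableI_le)
    fix c
    have "{w \<in> space M. clock_time R b (T w) y z (u w) \<le> c} =
        {w \<in> space M. b + 1 \<le> c \<or> T w \<le> min c b \<and> - ln (u w) \<le> haz y z (T w) (min c b)}"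
      using clock_time_le_iff[OF T False] by auto
    also have "\<dots> \<in> sets M" by measurable
    finally show "{w \<in> space M. clock_time R b (T w) y z (u w) \<le> c} \<in> sets M" .
  qed
qed simp

lemma jump_step_measurable:
  assumes [measurable]: "Ty \<in> M \<rightarrow>\<^sub>M borel \<Otimes>\<^sub>M count_space UNIV" "U \<in> M \<rightarrow>\<^sub>M clocks"
    and T: "\<And>w. w \<in> space M \<Longrightarrow> a \<le> fst (Ty w)"
  shows "(\<lambda>w. jump_step R b (Ty w) (U w)) \<in> M \<rightarrow>\<^sub>M borel \<Otimes>\<^sub>M count_space UNIV"
  unfolding jump_step_first_clock
proof (rule measurable_first_clock)
  show "(\<lambda>w. snd (Ty w)) \<in> M \<rightarrow>\<^sub>M count_space UNIV" by measurable
  fix z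
  have Uz [measurable]: "(\<lambda>w. U w z) \<in> borel_measurable M"
    by (rule measurable_compose[OF assms(2) clock_component_measurable])
  show "(\<lambda>w. clock_time R b (fst (Ty w)) (snd (Ty w)) z (U w z)) \<in> borel_measurable M"
  proof (rule measurable_compose_countable'[where I=UNIV and f="\<lambda>y w. clock_time R b (fst (Ty w)) y z (U w z)"])
    show "(\<lambda>w. clock_time R b (fst (Ty w)) y z (U w z)) \<in> borel_measurable M" for y
      by (rule clock_time_measurable[OF _ Uz T]) measurable
    show "(\<lambda>w. snd (Ty w)) \<in> M \<rightarrow>\<^sub>M count_space UNIV" by measurable
  qed (simp add: countable_finite)
qed

text \<open>\<open>- ln u\<close> is a standard exponential variable, so the clock survives past
  \<open>c\<close> exactly when \<open>u < exp (- haz y z T c)\<close>. For \<open>z = y\<close> the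
  clock never fires and the hazard is 0.\<close>

lemma emeasure_clock_time_gt:
  assumes "a \<le> T" "T \<le> c" "c \<le> b"
  shows "emeasure unit_clock {u. c < clock_time R b T y z u} = ennreal (exp (- haz y z T c))"
proof (cases "z = y")
  case True
  have "emeasure unit_clock (space unit_clock) = 1"
    by (rule prob_space.emeasure_space_1[OF prob_space_unit_clock])
  then show ?thesis using True assms by (simp add: haz_def)
next
  case False
  have [measurable]: "clock_time R b T y z \<in> borel_measurable borel"
    using assms by (intro clock_time_measurable) auto
  have "{u \<in> space borel. c < clock_time R b T y z u} \<in> sets borel" by measurable
  then have m: "{u. c < clock_time R b T y z u} \<in> sets borel" by simp
  have h: "0 \<le> haz y z T c" using assms by (intro haz_nonneg)
  have "{0<..<1} \<inter> {u. c < clock_time R b T y z u} = {0<..<exp (- haz y z T c)}"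
  proof (intro set_eqI)
    fix u :: real
    have "c < clock_time R b T y z u \<longleftrightarrow> haz y z T c < - ln u"
      using clock_time_le_iff[OF assms(1) False, of u c] assms by (auto simp: not_le[symmetric])
    moreover have "haz y z T c < - ln u \<longleftrightarrow> u < exp (- haz y z T c)" if "0 < u"
    proof -
      have "haz y z T c < - ln u \<longleftrightarrow> ln u < - haz y z T c" by linarith
      also have "\<dots> \<longleftrightarrow> u < exp (- haz y z T c)" using that by (metis exp_less_cancel_iff exp_ln)
      finally show ?thesis .
    qed
    moreover have "exp (- haz y z T c) \<le> 1" using h by simp
    ultimately show "u \<in> {0<..<1} \<inter> {u. c < clock_time R b T y z u} \<longleftrightarrow> u \<in> {0<..<exp (- haz y z T c)}"
      by (auto intro: less_le_trans)
  qed
  then show ?thesis using m by (simp add: emeasure_uniform_measure divide_ennreal_def)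
qed

end

section \<open>Laws of one clock, of the first clock and of one jump step\<close>

context jump_rates begin

lemma clock_time_measurable1 [measurable]:
  "a \<le> T \<Longrightarrow> clock_time R b T y z \<in> borel_measurable borel"
  by (intro clock_time_measurable) auto

lemma haz_exp_has_integral:
  assumes "a \<le> u" "u \<le> v" "v \<le> b"
  shows "((\<lambda>s. r y z s * exp (- haz y z T s)) has_integral (exp (- haz y z T u) - exp (- haz y z T v))) {u..v}"
proof -
  have "((\<lambda>s. - exp (- haz y z T s)) has_real_derivative r y z s * exp (- haz y z T s)) (at s within {a..b})"
    if "s \<in> {a..b}" for s
    using haz_deriv[OF that, of y z T] by (auto intro!: derivative_eq_intros)
  from has_integral_deriv_within[OF this assms] show ?thesis by simp
qed

lemma Haz_exp_has_integral:
  assumes "a \<le> u" "u \<le> v" "v \<le> b"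
  shows "((\<lambda>s. (\<Sum>z\<in>UNIV. r y z s) * exp (- Haz y T s)) has_integral (exp (- Haz y T u) - exp (- Haz y T v))) {u..v}"
proof -
  have "((\<lambda>s. - exp (- Haz y T s)) has_real_derivative (\<Sum>z\<in>UNIV. r y z s) * exp (- Haz y T s)) (at s within {a..b})"
    if "s \<in> {a..b}" for s
    using Haz_deriv[OF that, of y T] by (auto intro!: derivative_eq_intros)
  from has_integral_deriv_within[OF this assms] show ?thesis by simp
qed

text \<open>The law of the clock restricted to \<open>{..b}\<close> and the measure with the stated
  density agree on all rays \<open>{x<..}\<close> and are finite there, which identifies them. The
  factor \<open>indicator {..b}\<close> removes the atom at \<open>b + 1\<close>.\<close>

lemma clock_time_law:
  assumes T: "a \<le> T" "T \<le> b" and h [measurable]: "h \<in> borel_measurable borel"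
  shows "(\<integral>\<^sup>+u. h (clock_time R b T y z u) * indicator {..b} (clock_time R b T y z u) \<partial>unit_clock)
    = (\<integral>\<^sup>+s. h s * ennreal (indicator {T..b} s * r y z s * exp (- haz y z T s)) \<partial>lborel)"
proof -
  let ?c = "clock_time R b T y z"
  note clock_time_measurable1[OF T(1), measurable]
  have cm [measurable]: "?c \<in> borel_measurable unit_clock"
    by (simp add: measurable_cong_sets[OF sets_uniform_measure refl])
  interpret U: prob_space unit_clock by (rule prob_space_unit_clock)
  define d where "d s = ennreal (indicator {T..b} s * r y z s * exp (- haz y z T s))" for s
  have d [measurable]: "d \<in> borel_measurable borel" unfolding d_def by measurable
  define N1 where "N1 = density (distr unit_clock borel ?c) (indicator {..b})"
  define N2 where "N2 = density lborel d"
  have eq: "emeasure N1 {x<..} = emeasure N2 {x<..}" and fin: "emeasure N1 {x<..} < \<infinity>" for x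
  proof -
    have "emeasure N1 {x<..} = (\<integral>\<^sup>+s. indicator {..b} s * indicator {x<..} s \<partial>distr unit_clock borel ?c)"
      unfolding N1_def by (simp add: emeasure_density)
    also have "\<dots> = (\<integral>\<^sup>+s. indicator {x<..b} s \<partial>distr unit_clock borel ?c)"
      by (intro nn_integral_cong) (auto simp: indicator_def)
    also have "\<dots> = emeasure (distr unit_clock borel ?c) {x<..b}" by simp
    also have "\<dots> = emeasure unit_clock (?c -` {x<..b} \<inter> space unit_clock)"
      by (rule emeasure_distr) auto
    finally have N1: "emeasure N1 {x<..} = emeasure unit_clock (?c -` {x<..b})" by simp
    then show "emeasure N1 {x<..} < \<infinity>" using U.emeasure_finite by (simp add: less_top[symmetric])
    have N2: "emeasure N2 {x<..} = (\<integral>\<^sup>+s. d s * indicator {x<..} s \<partial>lborel)"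
      unfolding N2_def by (simp add: emeasure_density)
    show "emeasure N1 {x<..} = emeasure N2 {x<..}"
    proof (cases "b \<le> x")
      case True
      have "(\<lambda>s. d s * indicator {x<..} s) = (\<lambda>_. 0)"
        using True by (auto simp: d_def indicator_def)
      moreover have "{x<..b} = {}" using True by auto
      ultimately show ?thesis by (simp add: N1 N2)
    next
      case False
      \<comment> \<open>The survival formula starts at \<open>T\<close>; no mass lies below, because
        the clock is almost surely strictly later than \<open>T\<close>.\<close>
      define x' where "x' = max T x"
      have x': "T \<le> x'" "x' \<le> b" using T False by (auto simp: x'_def)
      have s [measurable]: "{u. w < ?c u} \<in> sets borel" for w
        using borel_measurable_less[of "\<lambda>_. w" borel ?c] by simp
      have s2: "?c -` {x<..b} \<in> sets borel"
        using measurable_sets[OF clock_time_measurable1[OF T(1)], of "{x<..b}" y z] by simp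
      have "emeasure unit_clock (?c -` {x<..b}) = emeasure unit_clock ({u. x' < ?c u} - {u. b < ?c u})"
      proof (rule emeasure_eq_AE)
        show "AE u in unit_clock. (u \<in> ?c -` {x<..b}) = (u \<in> {u. x' < ?c u} - {u. b < ?c u})"
          using AE_unit_clock by eventually_elim (use clock_time_gt[OF T, of _ y z] in \<open>auto simp: x'_def\<close>)
      qed (use s2 in auto)
      also have "\<dots> = emeasure unit_clock {u. x' < ?c u} - emeasure unit_clock {u. b < ?c u}"
        by (rule emeasure_Diff) (use x' U.emeasure_finite in \<open>auto simp del: emeasure_uniform_measure\<close>)
      also have "\<dots> = ennreal (exp (- haz y z T x')) - ennreal (exp (- haz y z T b))"
        using T x' by (simp add: emeasure_clock_time_gt del: emeasure_uniform_measure)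
      also have "\<dots> = ennreal (exp (- haz y z T x') - exp (- haz y z T b))"
        by (simp add: ennreal_minus)
      also have "\<dots> = (\<integral>\<^sup>+s. ennreal (r y z s * exp (- haz y z T s)) * indicator {x'..b} s \<partial>lborel)"
        by (rule nn_integral_has_integral_lebesgue'[symmetric])
           (use T x' r_nonneg in \<open>auto intro!: haz_exp_has_integral\<close>)
      also have "\<dots> = (\<integral>\<^sup>+s. d s * indicator {x<..} s \<partial>lborel)"
        by (rule nn_integral_cong_AE, rule eventually_mono[OF AE_lborel_singleton[of x]])
           (auto simp: d_def indicator_def x'_def)
      finally show ?thesis by (simp add: N1 N2)
    qed
  qed
  have "N1 = N2"
  proof (rule measure_eqI_lessThan)
    show "sets N1 = sets borel" "sets N2 = sets borel" by (simp_all add: N1_def N2_def)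
  qed (rule fin eq)+
  then have "(\<integral>\<^sup>+s. h s \<partial>N1) = (\<integral>\<^sup>+s. h s \<partial>N2)" by simp
  moreover have "(\<integral>\<^sup>+s. h s \<partial>N1) = (\<integral>\<^sup>+u. h (?c u) * indicator {..b} (?c u) \<partial>unit_clock)"
    unfolding N1_def by (subst nn_integral_density, simp, simp, subst nn_integral_distr) (auto simp: mult.commute)
  moreover have "(\<integral>\<^sup>+s. h s \<partial>N2) = (\<integral>\<^sup>+s. h s * d s \<partial>lborel)"
    unfolding N2_def by (subst nn_integral_density) (auto simp: mult.commute)
  ultimately show ?thesis by (simp add: d_def)
qed

lemma clock_time_ge:
  assumes "a \<le> T" "T \<le> b"
  shows "T \<le> clock_time R b T y z u"
  using clock_time_le_iff[OF assms(1), of z y u "clock_time R b T y z u"] assms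
  by (cases "z = y") auto

lemma component_clock_measurable [measurable]:
  assumes "a \<le> T"
  shows "(\<lambda>\<omega>. clock_time R b T y z (\<omega> z)) \<in> borel_measurable clocks"
  by (rule measurable_compose[OF clock_component_measurable clock_time_measurable1[OF assms]])

lemma exp_Haz_split:
  "ennreal (exp (- Haz y T s)) = ennreal (exp (- haz y z T s)) * (\<Prod>z'\<in>UNIV - {z}. ennreal (exp (- haz y z' T s)))"
proof -
  have "exp (- Haz y T s) = (\<Prod>z'\<in>UNIV. exp (- haz y z' T s))"
    by (simp add: Haz_def exp_sum[symmetric] sum_negf)
  also have "\<dots> = exp (- haz y z T s) * (\<Prod>z'\<in>UNIV - {z}. exp (- haz y z' T s))"
    by (rule prod.remove) auto
  finally show ?thesis by (simp add: ennreal_mult prod_nonneg prod_ennreal)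
qed

text \<open>Fubini with the clock of \<open>z\<close> outermost: once it fires at \<open>s\<close>,
  the other independent clocks must all survive past \<open>s\<close>, and their survival
  probabilities multiply with \<open>exp (- haz y z T s)\<close> to
  \<open>exp (- Haz y T s)\<close>.\<close>

lemma first_clock_law:
  fixes y z :: 'x
  assumes T: "a \<le> T" "T \<le> b" and h [measurable]: "h \<in> borel_measurable borel"
  defines "c \<equiv> \<lambda>z \<omega>. clock_time R b T y z (\<omega> z)"
  shows "(\<integral>\<^sup>+\<omega>. h (c z \<omega>) * indicator {\<omega>\<in>space clocks. c z \<omega> \<le> b \<and> (\<forall>z'. z' \<noteq> z \<longrightarrow> c z \<omega> < c z' \<omega>)} \<omega> \<partial>clocks)
    = (\<integral>\<^sup>+s. h s * ennreal (indicator {T..b} s * r y z s * exp (- Haz y T s)) \<partial>lborel)"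
proof -
  interpret U: prob_space unit_clock by (rule prob_space_unit_clock)
  interpret PU: product_prob_space "\<lambda>_::'x. unit_clock" ..
  let ?c = "clock_time R b T y" and ?I = "UNIV - {z}"
  note clock_time_measurable1[OF T(1), measurable] component_clock_measurable[OF T(1), measurable]
  have c1 [measurable]: "?c z \<in> borel_measurable unit_clock" for z
    by (simp add: measurable_cong_sets[OF sets_uniform_measure refl])
  define A where "A = {\<omega>\<in>space clocks. c z \<omega> \<le> b \<and> (\<forall>z'. z' \<noteq> z \<longrightarrow> c z \<omega> < c z' \<omega>)}"
  have A [measurable]: "A \<in> sets clocks" unfolding A_def c_def by measurable
  have U: "insert z ?I = UNIV" by auto
  have f: "(\<lambda>\<omega>. h (c z \<omega>) * indicator A \<omega>) \<in> borel_measurable clocks"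
    unfolding c_def by measurable
  have "(\<integral>\<^sup>+\<omega>. h (c z \<omega>) * indicator A \<omega> \<partial>clocks)
      = (\<integral>\<^sup>+u. \<integral>\<^sup>+x. h (c z (x(z:=u))) * indicator A (x(z:=u)) \<partial>Pi\<^sub>M ?I (\<lambda>_. unit_clock) \<partial>unit_clock)"
    using PU.product_nn_integral_insert_rev[of ?I z, unfolded U, OF _ _ f] by simp
  also have "\<dots> = (\<integral>\<^sup>+u. h (?c z u) * (\<Prod>z'\<in>?I. ennreal (exp (- haz y z' T (?c z u)))) * indicator {..b} (?c z u) \<partial>unit_clock)"
  proof (rule nn_integral_cong)
    fix u
    have "h (c z (x(z:=u))) * indicator A (x(z:=u))
        = h (?c z u) * indicator {..b} (?c z u) * (\<Prod>z'\<in>?I. indicator {u'. ?c z u < ?c z' u'} (x z'))" for x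
    proof -
      have "(\<Prod>z'\<in>?I. indicator {u'. ?c z u < ?c z' u'} (x z') :: ennreal) =
          (if \<forall>z'. z' \<noteq> z \<longrightarrow> ?c z u < ?c z' (x z') then 1 else 0)"
        by (auto simp: indicator_def intro!: prod.neutral)
      then show ?thesis
        by (auto simp: c_def A_def indicator_def space_PiM PiE_def)
    qed
    then have "(\<integral>\<^sup>+x. h (c z (x(z:=u))) * indicator A (x(z:=u)) \<partial>Pi\<^sub>M ?I (\<lambda>_. unit_clock)) =
       (\<integral>\<^sup>+x. h (?c z u) * indicator {..b} (?c z u) * (\<Prod>z'\<in>?I. indicator {u'. ?c z u < ?c z' u'} (x z')) \<partial>Pi\<^sub>M ?I (\<lambda>_. unit_clock))"
      by simp
    also have "\<dots> = h (?c z u) * indicator {..b} (?c z u) * (\<integral>\<^sup>+x. (\<Prod>z'\<in>?I. indicator {u'. ?c z u < ?c z' u'} (x z')) \<partial>Pi\<^sub>M ?I (\<lambda>_. unit_clock))"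
      by (rule nn_integral_cmult) measurable
    also have "(\<integral>\<^sup>+x. (\<Prod>z'\<in>?I. indicator {u'. ?c z u < ?c z' u'} (x z')) \<partial>Pi\<^sub>M ?I (\<lambda>_. unit_clock))
        = (\<Prod>z'\<in>?I. emeasure unit_clock {u'. ?c z u < ?c z' u'})"
      by (subst PU.product_nn_integral_prod) auto
    also have "h (?c z u) * indicator {..b} (?c z u) * \<dots> =
       h (?c z u) * (\<Prod>z'\<in>?I. ennreal (exp (- haz y z' T (?c z u)))) * indicator {..b} (?c z u)"
    proof (cases "?c z u \<le> b")
      case True
      then show ?thesis
        using T by (simp add: emeasure_clock_time_gt[OF T(1) clock_time_ge[OF T]] del: emeasure_uniform_measure)
    qed simp
    finally show "(\<integral>\<^sup>+x. h (c z (x(z:=u))) * indicator A (x(z:=u)) \<partial>Pi\<^sub>M ?I (\<lambda>_. unit_clock)) =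
       h (?c z u) * (\<Prod>z'\<in>?I. ennreal (exp (- haz y z' T (?c z u)))) * indicator {..b} (?c z u)" .
  qed
  also have "\<dots> = (\<integral>\<^sup>+s. h s * (\<Prod>z'\<in>?I. ennreal (exp (- haz y z' T s))) *
      ennreal (indicator {T..b} s * r y z s * exp (- haz y z T s)) \<partial>lborel)"
    by (rule clock_time_law[OF T, where h="\<lambda>s. h s * (\<Prod>z'\<in>?I. ennreal (exp (- haz y z' T s)))"]) measurable
  also have "\<dots> = (\<integral>\<^sup>+s. h s * ennreal (indicator {T..b} s * r y z s * exp (- Haz y T s)) \<partial>lborel)"
    by (intro nn_integral_cong) (simp add: ennreal_mult r_nonneg exp_Haz_split[of y T _ z] mult_ac)
  finally show ?thesis by (simp add: A_def)
qed

text \<open>Up to a null set the sample space splits into the events \<open>A z\<close>, that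
  \<open>z\<close> fires strictly first, and \<open>A0\<close>, that nothing fires up to
  \<open>b\<close>. The former are evaluated by \<open>first_clock_law\<close>, the latter is a
  product of survival probabilities.\<close>

lemma jump_step_law:
  assumes T: "a \<le> T" "T \<le> b" and g [measurable]: "g \<in> borel_measurable (borel \<Otimes>\<^sub>M count_space UNIV)"
  shows "(\<integral>\<^sup>+\<omega>. g (jump_step R b (T, y) \<omega>) \<partial>clocks)
    = (\<Sum>z\<in>UNIV. \<integral>\<^sup>+s. g (s, z) * ennreal (indicator {T..b} s * r y z s * exp (- Haz y T s)) \<partial>lborel)
      + g (b + 1, y) * ennreal (exp (- Haz y T b))"
proof -
  interpret U: prob_space unit_clock by (rule prob_space_unit_clock)
  interpret PU: product_prob_space "\<lambda>_::'x. unit_clock" ..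
  interpret C: prob_space "clocks :: ('x \<Rightarrow> real) measure" by (rule prob_space_clocks)
  note clock_time_measurable1[OF T(1), measurable] component_clock_measurable[OF T(1), measurable]
  have c1 [measurable]: "clock_time R b T y z \<in> borel_measurable unit_clock" for z
    by (simp add: measurable_cong_sets[OF sets_uniform_measure refl])
  define c where "c = (\<lambda>z \<omega>. clock_time R b T y z (\<omega> z))"
  have cm [measurable]: "c z \<in> borel_measurable clocks" for z unfolding c_def by measurable
  define A where "A z = {\<omega>\<in>space clocks. c z \<omega> \<le> b \<and> (\<forall>z'. z' \<noteq> z \<longrightarrow> c z \<omega> < c z' \<omega>)}" for z
  define A0 where "A0 = {\<omega>\<in>space clocks. \<forall>z. b < c z \<omega>}"
  have A [measurable]: "A z \<in> sets clocks" for z unfolding A_def by measurable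
  have A0 [measurable]: "A0 \<in> sets clocks" unfolding A0_def by measurable
  have gs [measurable]: "(\<lambda>s. g (s, z)) \<in> borel_measurable borel" for z by measurable
  have inA: "(\<Sum>z\<in>UNIV. \<phi> z * indicator (A z) \<omega>) + \<psi> * indicator A0 \<omega> = \<phi> z0"
    if "\<omega> \<in> A z0" for \<omega> z0 \<psi> and \<phi> :: "'x \<Rightarrow> ennreal"
  proof -
    have "\<omega> \<notin> A0" using that by (auto simp: A_def A0_def not_less)
    moreover have "indicator (A z) \<omega> = (if z = z0 then 1 else 0 :: ennreal)" for z
    proof (cases "z = z0")
      case False
      have "\<omega> \<notin> A z"
      proof
        assume "\<omega> \<in> A z"
        then have "c z \<omega> < c z0 \<omega>" "c z0 \<omega> < c z \<omega>"
          using that False unfolding A_def by auto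
        then show False by simp
      qed
      then show ?thesis using False by simp
    qed (use that in simp)
    ultimately show ?thesis by (simp add: if_distrib[of "\<lambda>x. _ * x"] cong: if_cong)
  qed
  have inA0: "(\<Sum>z\<in>UNIV. \<phi> z * indicator (A z) \<omega>) + \<psi> * indicator A0 \<omega> = \<psi>"
    if "\<omega> \<in> A0" for \<omega> \<psi> and \<phi> :: "'x \<Rightarrow> ennreal"
  proof -
    have "\<omega> \<notin> A z" for z using that by (auto simp: A_def A0_def not_le)
    then show ?thesis using that by simp
  qed
  have i0: "emeasure clocks A0 = ennreal (exp (- Haz y T b))"
  proof -
    have "indicator A0 \<omega> = (\<Prod>z\<in>UNIV. indicator {u. b < clock_time R b T y z u} (\<omega> z) :: ennreal)"
      if "\<omega> \<in> space clocks" for \<omega>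
      using that by (auto simp: A0_def c_def indicator_def intro!: prod.neutral[symmetric])
    then have "emeasure clocks A0 = (\<integral>\<^sup>+\<omega>. (\<Prod>z\<in>UNIV. indicator {u. b < clock_time R b T y z u} (\<omega> z)) \<partial>clocks)"
      unfolding nn_integral_indicator[symmetric, OF A0] by (rule nn_integral_cong)
    also have "\<dots> = (\<Prod>z\<in>UNIV. emeasure unit_clock {u. b < clock_time R b T y z u})"
      by (subst PU.product_nn_integral_prod) auto
    also have "\<dots> = ennreal (exp (- Haz y T b))"
      using T by (simp add: emeasure_clock_time_gt prod_ennreal Haz_def exp_sum[symmetric] sum_negf
          del: emeasure_uniform_measure)
    finally show ?thesis .
  qed
  have iA: "(\<integral>\<^sup>+\<omega>. h (c z \<omega>) * indicator (A z) \<omega> \<partial>clocks) =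
     (\<integral>\<^sup>+s. h s * ennreal (indicator {T..b} s * r y z s * exp (- Haz y T s)) \<partial>lborel)"
    if "h \<in> borel_measurable borel" for h z
    using first_clock_law[OF T that, of y z] by (simp add: A_def c_def)
  \<comment> \<open>Ties are null by counting mass: the densities of the \<open>A z\<close> add up
    to the derivative of \<open>- exp (- Haz y T s)\<close>, so their integral and the mass of
    \<open>A0\<close> sum to exactly 1.\<close>
  define B where "B = A0 \<union> (\<Union>z. A z)"
  have B [measurable]: "B \<in> sets clocks" unfolding B_def by measurable
  have "emeasure clocks B = (\<integral>\<^sup>+\<omega>. (\<Sum>z\<in>UNIV. 1 * indicator (A z) \<omega>) + 1 * indicator A0 \<omega> \<partial>clocks)"
  proof (subst nn_integral_indicator[symmetric, OF B], rule nn_integral_cong)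
    fix \<omega>
    show "(indicator B \<omega> :: ennreal) = (\<Sum>z\<in>UNIV. 1 * indicator (A z) \<omega>) + 1 * indicator A0 \<omega>"
    proof (cases "\<omega> \<in> B")
      case True
      then consider "\<omega> \<in> A0" | z where "\<omega> \<in> A z" unfolding B_def by auto
      then have "(\<Sum>z\<in>UNIV. 1 * indicator (A z) \<omega>) + 1 * indicator A0 \<omega> = (1 :: ennreal)"
        by cases (rule inA0, assumption, rule inA)
      then show ?thesis using True by simp
    qed (auto simp: B_def)
  qed
  also have "\<dots> = (\<Sum>z\<in>UNIV. \<integral>\<^sup>+\<omega>. 1 * indicator (A z) \<omega> \<partial>clocks) + emeasure clocks A0"
    by (simp add: nn_integral_add nn_integral_sum)
  also have "\<dots> = (\<Sum>z\<in>UNIV. \<integral>\<^sup>+s. ennreal (indicator {T..b} s * r y z s * exp (- Haz y T s)) \<partial>lborel) + ennreal (exp (- Haz y T b))"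
    using iA[of "\<lambda>_. 1"] by (simp add: i0)
  also have "(\<Sum>z\<in>UNIV. \<integral>\<^sup>+s. ennreal (indicator {T..b} s * r y z s * exp (- Haz y T s)) \<partial>lborel)
     = (\<integral>\<^sup>+s. ennreal ((\<Sum>z\<in>UNIV. r y z s) * exp (- Haz y T s)) * indicator {T..b} s \<partial>lborel)"
    by (subst nn_integral_sum[symmetric])
       (auto intro!: nn_integral_cong simp: sum_ennreal r_nonneg sum_distrib_right indicator_def)
  also have "\<dots> = ennreal (exp (- Haz y T T) - exp (- Haz y T b))"
    by (rule nn_integral_has_integral_lebesgue'[OF _ Haz_exp_has_integral[OF T order_refl]])
       (auto intro!: sum_nonneg mult_nonneg_nonneg r_nonneg)
  also have "\<dots> + ennreal (exp (- Haz y T b)) = 1"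
    using T Haz_nonneg[of T b y] by (subst ennreal_plus[symmetric]) auto
  finally have "C.prob B = 1" by (simp add: measure_def)
  then have AEB: "AE \<omega> in clocks. \<omega> \<in> B" by (rule C.AE_prob_1)
  have step: "g (jump_step R b (T, y) \<omega>) = (\<Sum>z\<in>UNIV. g (c z \<omega>, z) * indicator (A z) \<omega>) + g (b + 1, y) * indicator A0 \<omega>"
    if inB: "\<omega> \<in> B" for \<omega>
  proof (cases "\<omega> \<in> A0")
    case True
    then have "jump_step R b (T, y) \<omega> = (b + 1, y)"
      unfolding jump_step_first_clock fst_conv snd_conv by (intro first_clock_none) (simp add: A0_def c_def)
    then show ?thesis unfolding inA0[OF True] by simp
  next
    case False
    then obtain z where z: "\<omega> \<in> A z" using inB by (auto simp: B_def)
    have "jump_step R b (T, y) \<omega> = (c z \<omega>, z)"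
      unfolding jump_step_first_clock c_def fst_conv snd_conv
      by (intro first_clock_eq[where c="\<lambda>z. clock_time R b T y z (\<omega> z)"]) (use z in \<open>simp_all add: A_def c_def\<close>)
    then show ?thesis unfolding inA[OF z] by simp
  qed
  have "(\<integral>\<^sup>+\<omega>. g (jump_step R b (T, y) \<omega>) \<partial>clocks) =
     (\<integral>\<^sup>+\<omega>. (\<Sum>z\<in>UNIV. g (c z \<omega>, z) * indicator (A z) \<omega>) + g (b + 1, y) * indicator A0 \<omega> \<partial>clocks)"
    by (rule nn_integral_cong_AE) (use AEB in \<open>eventually_elim, simp add: step\<close>)
  also have "\<dots> = (\<Sum>z\<in>UNIV. \<integral>\<^sup>+\<omega>. g (c z \<omega>, z) * indicator (A z) \<omega> \<partial>clocks) + g (b + 1, y) * emeasure clocks A0"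
    by (simp add: nn_integral_add nn_integral_sum nn_integral_cmult del: sum_mult_indicator)
  finally show ?thesis using iA[OF gs] by (simp add: i0)
qed

end

section \<open>Reading the jumps off a path\<close>

text \<open>The product sigma-algebra only sees countably many coordinates, so the jumps of a path are
  read off along the rationals; the right end point is added to detect a jump exactly there.\<close>

definition hit_time :: "real \<Rightarrow> real \<Rightarrow> (real \<Rightarrow> 'x) \<Rightarrow> real \<Rightarrow> 'x \<Rightarrow> 'x \<Rightarrow> real" where
  "hit_time a b p T y z = (INF q\<in>insert b (\<rat> \<inter> {a..b}). if z \<noteq> y \<and> T \<le> q \<and> p q = z then q else b + 1)"

text \<open>Counterpart of \<open>jump_step\<close> on the path side, with observed hitting times in
  place of the random clocks.\<close>

definition obs_step :: "real \<Rightarrow> real \<Rightarrow> (real \<Rightarrow> 'x::finite) \<Rightarrow> real \<times> 'x \<Rightarrow> real \<times> 'x" where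
  "obs_step a b p Ty = first_clock b (snd Ty) (hit_time a b p (fst Ty) (snd Ty))"

lemma hit_time_bdd:
  fixes a b T :: real
  shows "bdd_below ((\<lambda>q. if z \<noteq> y \<and> T \<le> q \<and> p q = z then q else b + 1) ` insert b (\<rat> \<inter> {a..b}))"
  by (rule bdd_belowI2[of _ "min a b"]) (auto simp: min_def)

lemma hit_time_ge:
  assumes "t \<le> b + 1" "\<And>q. a \<le> q \<Longrightarrow> q \<le> b \<Longrightarrow> T \<le> q \<Longrightarrow> q < t \<Longrightarrow> z \<noteq> y \<Longrightarrow> p q \<noteq> z" "a < b"
  shows "t \<le> hit_time a b p T y z"
  unfolding hit_time_def
proof (rule cINF_greatest)
  fix q assume "q \<in> insert b (\<rat> \<inter> {a..b})"
  then have "a \<le> q" "q \<le> b" using assms(3) by auto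
  then show "t \<le> (if z \<noteq> y \<and> T \<le> q \<and> p q = z then q else b + 1)"
    using assms(1) assms(2)[of q] by (auto simp: not_less[symmetric])
qed simp

lemma hit_time_le:
  assumes "q \<in> insert b (\<rat> \<inter> {a..b})" "T \<le> q" "p q = z" "z \<noteq> y"
  shows "hit_time a b p T y z \<le> q"
  using cINF_lower[OF hit_time_bdd assms(1), of z y T p] assms by (simp add: hit_time_def)

text \<open>The path stays at \<open>z\<close> for a while after \<open>t\<close>, so rationals
  decreasing to \<open>t\<close> show that the hitting time of \<open>z\<close> is \<open>t\<close>;
  for \<open>t = b\<close> there is no room to the right and the added end point is used. Any other
  target is hit only after \<open>z\<close> has been left.\<close>

lemma obs_step_jump:
  fixes p :: "real \<Rightarrow> 'x::finite"
  assumes ab: "a < b" and aT: "a \<le> T" "T \<le> t" "t \<le> b" "t < t'" and yz: "y \<noteq> z"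
    and before: "\<And>s. T \<le> s \<Longrightarrow> s < t \<Longrightarrow> p s = y"
    and after: "\<And>s. t \<le> s \<Longrightarrow> s < t' \<Longrightarrow> s \<le> b \<Longrightarrow> p s = z"
  shows "obs_step a b p (T, y) = (t, z)"
proof -
  let ?h = "hit_time a b p T y"
  have "?h z \<le> t"
  proof (rule field_le_epsilon)
    fix e :: real assume e: "0 < e"
    show "?h z \<le> t + e"
    proof (cases "t = b")
      case True
      then have "p b = z" using after[of t] assms(5) by simp
      then have "?h z \<le> b" using aT yz by (intro hit_time_le) auto
      then show ?thesis using True e by simp
    next
      case False
      define w where "w = min (t + e) (min t' b)"
      have "t < w" using False aT e by (auto simp: w_def)
      then obtain q where q: "q \<in> \<rat>" "t < q" "q < w" using Rats_dense_in_real by blast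
      then have "?h z \<le> q" using aT yz by (intro hit_time_le after) (auto simp: w_def)
      then show ?thesis using q by (simp add: w_def)
    qed
  qed
  moreover have "t \<le> ?h z"
    by (rule hit_time_ge[OF _ _ ab]) (use aT before yz in auto)
  ultimately have hz: "?h z = t" by simp
  have "t < ?h z'" if "z' \<noteq> z" for z'
  proof -
    \<comment> \<open>Up to \<open>t'\<close> the path shows only \<open>y\<close> and
      \<open>z\<close>; the cap \<open>b + 1\<close> is the value for a target that is never hit.
      Both exceed \<open>t\<close>.\<close>
    have "min t' (b + 1) \<le> ?h z'"
    proof (rule hit_time_ge[OF _ _ ab])
      fix q assume "q \<le> b" "T \<le> q" "q < min t' (b + 1)" "z' \<noteq> y"
      then show "p q \<noteq> z'" using before[of q] after[of q] that by (cases "q < t") auto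
    qed simp
    then show ?thesis using aT by simp
  qed
  then show ?thesis
    unfolding obs_step_def fst_conv snd_conv using first_clock_eq[of ?h z b y] hz aT by simp
qed

lemma obs_step_none:
  fixes p :: "real \<Rightarrow> 'x::finite"
  assumes ab: "a < b" and "\<And>s. T \<le> s \<Longrightarrow> s \<le> b \<Longrightarrow> p s = y"
  shows "obs_step a b p (T, y) = (b + 1, y)"
proof -
  have "b + 1 \<le> hit_time a b p T y z" for z
    by (rule hit_time_ge[OF _ _ ab]) (use assms(2) in auto)
  then show ?thesis
    unfolding obs_step_def fst_conv snd_conv by (intro first_clock_none) (meson less_add_one less_le_trans)
qed

lemma obs_step_measurable:
  fixes Ty :: "(real \<Rightarrow> 'x::finite) \<Rightarrow> real \<times> 'x"
  assumes Ty: "Ty \<in> Pi\<^sub>M {a..b} (\<lambda>_. count_space UNIV) \<rightarrow>\<^sub>M borel \<Otimes>\<^sub>M count_space UNIV" and ab: "a < b"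
  shows "(\<lambda>p. obs_step a b p (Ty p)) \<in> Pi\<^sub>M {a..b} (\<lambda>_. count_space UNIV) \<rightarrow>\<^sub>M borel \<Otimes>\<^sub>M count_space UNIV"
  unfolding obs_step_def
proof (rule measurable_first_clock)
  let ?M = "Pi\<^sub>M {a..b} (\<lambda>_. count_space (UNIV :: 'x set))"
  note Ty [measurable]
  show sn: "(\<lambda>p. snd (Ty p)) \<in> ?M \<rightarrow>\<^sub>M count_space UNIV" by measurable
  fix z
  have hm: "(\<lambda>p. hit_time a b p (fst (Ty p)) y z) \<in> borel_measurable ?M" for y
    unfolding hit_time_def
  proof (rule borel_measurable_cINF)
    show "countable (insert b (\<rat> \<inter> {a..b}))" by (simp add: countable_rat)
    fix q assume "q \<in> insert b (\<rat> \<inter> {a..b})"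
    then have "q \<in> {a..b}" using ab by auto
    then have [measurable]: "(\<lambda>p. p q) \<in> ?M \<rightarrow>\<^sub>M count_space UNIV"
      by (rule measurable_component_singleton)
    show "(\<lambda>p. if z \<noteq> y \<and> fst (Ty p) \<le> q \<and> p q = z then q else b + 1) \<in> borel_measurable ?M"
      by measurable
  qed (rule hit_time_bdd)
  show "(\<lambda>p. hit_time a b p (fst (Ty p)) (snd (Ty p)) z) \<in> borel_measurable ?M"
    by (rule measurable_compose_countable'[OF hm sn]) (simp add: countable_finite)
qed

section \<open>Almost surely the path determines the jump chain\<close>

context jump_rates begin

lemma jump_step_expired: "b < T \<Longrightarrow> jump_step R b (T, y) w = (b + 1, y)"
  unfolding jump_step_first_clock fst_conv snd_conv by (rule first_clock_none) (simp add: clock_time_expired)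

lemma jump_step_cases:
  assumes "a \<le> T" "T \<le> b" "\<And>z. 0 < w z \<and> w z < 1"
  obtains "jump_step R b (T, y) w = (b + 1, y)"
    | t z where "jump_step R b (T, y) w = (t, z)" "T < t" "t \<le> b" "y \<noteq> z"
proof (rule first_clock_cases[of b y "\<lambda>z. clock_time R b T y z (w z)"])
  assume "first_clock b y (\<lambda>z. clock_time R b T y z (w z)) = (b + 1, y)"
  then show ?thesis using that(1) unfolding jump_step_first_clock fst_conv snd_conv by blast
next
  fix z assume *: "first_clock b y (\<lambda>z. clock_time R b T y z (w z)) = (clock_time R b T y z (w z), z)"
    "clock_time R b T y z (w z) \<le> b"
  then have "y \<noteq> z" by auto
  then show ?thesis
    using that(2) * clock_time_gt[OF assms(1,2), of "w z" y z] assms(3)[of z]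
    unfolding jump_step_first_clock fst_conv snd_conv by blast
qed

lemma jump_step_ge:
  assumes "a \<le> fst Ty"
  shows "a \<le> fst (jump_step R b Ty w)"
proof (cases Ty)
  case (Pair T y)
  show ?thesis
  proof (cases "T \<le> b")
    case True
    show ?thesis
    proof (rule first_clock_cases[of b y "\<lambda>z. clock_time R b T y z (w z)"])
      fix z assume "first_clock b y (\<lambda>z. clock_time R b T y z (w z)) = (clock_time R b T y z (w z), z)"
      then show ?thesis
        unfolding jump_step_first_clock Pair fst_conv snd_conv
        using clock_time_ge[of T y z "w z"] True assms Pair by simp
    qed (use ab in \<open>simp add: jump_step_first_clock Pair\<close>)
  next
    case False
    then show ?thesis using ab by (simp add: Pair jump_step_expired)
  qed
qed

lemma jump_chain_ge: "a \<le> fst (jump_chain R a b x0 \<omega> i)"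
  by (induction i) (auto intro: jump_step_ge)

lemma jump_chain_measurable [measurable]:
  "(\<lambda>\<omega>. jump_chain R a b x0 \<omega> i) \<in> stream_space clocks \<rightarrow>\<^sub>M borel \<Otimes>\<^sub>M count_space UNIV"
proof (induction i)
  case (Suc i)
  show ?case unfolding jump_chain.simps
    by (rule jump_step_measurable[OF Suc measurable_snth jump_chain_ge])
qed simp

lemma jump_path_measurable [measurable]:
  "(\<lambda>\<omega>. restrict (jump_path R a b x0 \<omega>) {a..b}) \<in> stream_space clocks \<rightarrow>\<^sub>M Pi\<^sub>M {a..b} (\<lambda>_. count_space UNIV)"
proof (rule measurable_restrict)
  fix s
  have L: "(\<lambda>\<omega>. LEAST i. s < fst (jump_chain R a b x0 \<omega> (Suc i))) \<in> stream_space clocks \<rightarrow>\<^sub>M count_space UNIV"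
    by (rule measurable_Least) (simp del: jump_chain.simps)
  show "(\<lambda>\<omega>. jump_path R a b x0 \<omega> s) \<in> stream_space clocks \<rightarrow>\<^sub>M count_space UNIV"
    unfolding jump_path_def
    by (rule measurable_compose_countable[OF _ L, where f="\<lambda>i \<omega>. snd (jump_chain R a b x0 \<omega> i)"]) measurable
qed

lemma prob_space_path_measure: "prob_space (path_measure R a b x0)"
  unfolding path_measure_def
  by (rule prob_space.prob_space_distr[OF prob_space.prob_space_stream_space[OF prob_space_clocks] jump_path_measurable])

lemma sets_path_measure: "sets (path_measure R a b x0) = sets (Pi\<^sub>M {a..b} (\<lambda>_. count_space UNIV))"
  by (simp add: path_measure_def)

text \<open>Uniforms strictly inside the unit interval make all waiting times positive, so the jump
  times increase strictly until they pass \<open>b\<close>, and the path equals \<open>Y i\<close>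
  from \<open>T i\<close> until just before \<open>T (Suc i)\<close>. Only the next two jumps are
  inspected, so the argument stays local in \<open>i\<close> and a possible accumulation of jumps
  does not enter.\<close>

lemma obs_step_jump_path:
  fixes x0 :: 'x
  assumes w: "\<And>i z. 0 < (\<omega> !! i) z \<and> (\<omega> !! i) z < 1"
  defines "ch \<equiv> jump_chain R a b x0 \<omega>"
  shows "obs_step a b (restrict (jump_path R a b x0 \<omega>) {a..b}) (ch i) = ch (Suc i)"
proof -
  define T where "T i = fst (ch i)" for i
  define Y where "Y i = snd (ch i)" for i
  have ch: "ch i = (T i, Y i)" for i by (simp add: T_def Y_def)
  have Suc: "ch (Suc i) = jump_step R b (T i, Y i) (\<omega> !! i)" for i
    by (simp add: ch_def T_def Y_def)
  have aT: "a \<le> T i" for i using jump_chain_ge by (simp add: T_def ch_def)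
  have step: "(T (Suc i), Y (Suc i)) = (b + 1, Y i) \<or> T i < T (Suc i) \<and> T (Suc i) \<le> b \<and> Y i \<noteq> Y (Suc i)" if "T i \<le> b" for i
    by (rule jump_step_cases[OF aT that w[of i], of "Y i"]) (use Suc[of i] ch in auto)
  have exp: "(T (Suc i), Y (Suc i)) = (b + 1, Y i)" if "b < T i" for i
    using Suc[of i] jump_step_expired[OF that] ch by auto
  have lt: "T i < T (Suc i)" if "T i \<le> b" for i using step[OF that] that by auto
  have Tle: "T i \<le> b + 1" for i
  proof (cases i)
    case 0
    then show ?thesis using ab by (simp add: T_def ch_def)
  next
    case (Suc j)
    then show ?thesis using step[of j] exp[of j] by (cases "T j \<le> b") auto
  qed
  \<comment> \<open>Beyond the last jump the chain rests at \<open>b + 1\<close>, which is also the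
    upper bound of all \<open>T i\<close>; so monotonicity persists there.\<close>
  have "T i \<le> T (Suc i)" for i
    using lt[of i] exp[of i] Tle[of i] by (cases "T i \<le> b") auto
  then have mono: "T i \<le> T j" if "i \<le> j" for i j using that by (rule lift_Suc_mono_le)
  have path: "restrict (jump_path R a b x0 \<omega>) {a..b} s = Y i" if "T i \<le> s" "s < T (Suc i)" "s \<le> b" for i s
  proof -
    have "(LEAST i. s < T (Suc i)) = i"
    proof (rule Least_equality)
      fix j assume "s < T (Suc j)"
      then show "i \<le> j" using mono[of "Suc j" i] that(1) by (meson not_less_eq_eq le_less_trans not_le)
    qed fact
    moreover have "jump_path R a b x0 \<omega> s = Y (LEAST i. s < T (Suc i))"
      by (simp only: jump_path_def T_def Y_def ch_def)
    ultimately show ?thesis using that aT[of i] by simp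
  qed
  show ?thesis
  proof (cases "T i \<le> b")
    case False
    then show ?thesis
      using exp[of i] by (simp add: ch) (intro obs_step_none[OF ab], auto)
  next
    case True
    show ?thesis
    proof (cases "T (Suc i) \<le> b")
      case T2: True
      then have "Y i \<noteq> Y (Suc i)" using step[OF True] by auto
      then show ?thesis unfolding ch
        by (intro obs_step_jump[OF ab, where t'="T (Suc (Suc i))"] aT path)
           (use lt[OF True] lt[OF T2] T2 in auto)
    next
      case False
      then have "T (Suc i) = b + 1" "Y (Suc i) = Y i" using step[OF True] by auto
      then show ?thesis unfolding ch
        using obs_step_none[OF ab, of "T i" _ "Y i"] path[of i] by auto
    qed
  qed
qed

lemma AE_clocks_stream: "AE \<omega> in stream_space clocks. \<forall>i z. 0 < (\<omega> !! i) (z::'x) \<and> (\<omega> !! i) z < 1"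
proof -
  have "AE w in (clocks :: ('x \<Rightarrow> real) measure). 0 < w z \<and> w z < 1" for z
    by (rule AE_PiM_component[where M="\<lambda>_. unit_clock" and P="\<lambda>u. 0 < u \<and> u < 1"])
       (simp_all add: prob_space_unit_clock AE_unit_clock del: AE_conj_iff)
  then have 1: "AE w in (clocks :: ('x \<Rightarrow> real) measure). \<forall>z. 0 < w z \<and> w z < 1"
    by (simp add: AE_all_countable AE_finite_all)
  note clock_component_measurable [measurable]
  have "Measurable.pred clocks (\<lambda>w. \<forall>z::'x. 0 < w z \<and> w z < 1)" by measurable
  from prob_space.AE_stream_all[OF prob_space_clocks this 1]
  show ?thesis by (simp only: stream_all_def)
qed

text \<open>Almost surely the two observations are the first two links of \<open>jump_chain\<close>
  after its start, which use only the first two stream elements; splitting these off leaves two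
  independent families of clocks.\<close>

lemma nn_integral_path_measure:
  fixes x0 :: 'x
  assumes F [measurable]: "F \<in> borel_measurable ((borel \<Otimes>\<^sub>M count_space UNIV) \<Otimes>\<^sub>M (borel \<Otimes>\<^sub>M count_space UNIV))"
  defines "o1 \<equiv> \<lambda>p. obs_step a b p (a, x0)"
  shows "(\<integral>\<^sup>+p. F (o1 p, obs_step a b p (o1 p)) \<partial>path_measure R a b x0)
    = (\<integral>\<^sup>+w. \<integral>\<^sup>+w'. F (jump_step R b (a, x0) w, jump_step R b (jump_step R b (a, x0) w) w') \<partial>clocks \<partial>clocks)"
proof -
  interpret C: prob_space "clocks :: ('x \<Rightarrow> real) measure" by (rule prob_space_clocks)
  interpret S: prob_space "stream_space (clocks :: ('x \<Rightarrow> real) measure)" by (rule C.prob_space_stream_space)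
  have o1 [measurable]: "o1 \<in> Pi\<^sub>M {a..b} (\<lambda>_. count_space UNIV) \<rightarrow>\<^sub>M borel \<Otimes>\<^sub>M count_space UNIV"
    unfolding o1_def by (rule obs_step_measurable) (auto simp: ab)
  note obs_step_measurable[OF o1 ab, measurable]
  let ?p = "\<lambda>\<omega>. restrict (jump_path R a b x0 \<omega>) {a..b}" and ?ch = "jump_chain R a b x0"
  have "(\<integral>\<^sup>+p. F (o1 p, obs_step a b p (o1 p)) \<partial>path_measure R a b x0)
    = (\<integral>\<^sup>+\<omega>. F (o1 (?p \<omega>), obs_step a b (?p \<omega>) (o1 (?p \<omega>))) \<partial>stream_space clocks)"
    unfolding path_measure_def by (subst nn_integral_distr) measurable
  also have "\<dots> = (\<integral>\<^sup>+\<omega>. F (?ch \<omega> 1, ?ch \<omega> 2) \<partial>stream_space clocks)"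
  proof (rule nn_integral_cong_AE, use AE_clocks_stream in eventually_elim)
    fix \<omega> :: "('x \<Rightarrow> real) stream" assume w: "\<forall>i z. 0 < (\<omega> !! i) z \<and> (\<omega> !! i) z < 1"
    have "o1 (?p \<omega>) = ?ch \<omega> 1"
      using obs_step_jump_path[of \<omega> x0 0] w by (simp add: o1_def)
    moreover have "obs_step a b (?p \<omega>) (?ch \<omega> 1) = ?ch \<omega> 2"
      using obs_step_jump_path[of \<omega> x0 1] w by (simp add: numeral_2_eq_2)
    ultimately show "F (o1 (?p \<omega>), obs_step a b (?p \<omega>) (o1 (?p \<omega>))) = F (?ch \<omega> 1, ?ch \<omega> 2)" by simp
  qed
  also have "\<dots> = (\<integral>\<^sup>+w. \<integral>\<^sup>+\<omega>. F (?ch (w ## \<omega>) 1, ?ch (w ## \<omega>) 2) \<partial>stream_space clocks \<partial>clocks)"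
    by (rule C.nn_integral_stream_space) measurable
  also have "\<dots> = (\<integral>\<^sup>+w. \<integral>\<^sup>+\<omega>. F (jump_step R b (a, x0) w, jump_step R b (jump_step R b (a, x0) w) (shd \<omega>)) \<partial>stream_space clocks \<partial>clocks)"
    by (simp add: numeral_2_eq_2)
  also have "\<dots> = (\<integral>\<^sup>+w. \<integral>\<^sup>+w'. F (jump_step R b (a, x0) w, jump_step R b (jump_step R b (a, x0) w) w') \<partial>clocks \<partial>clocks)"
  proof (rule nn_integral_cong)
    fix w :: "'x \<Rightarrow> real"
    let ?s = "jump_step R b (a, x0) w"
    have "a \<le> fst ?s" by (rule jump_step_ge) simp
    then have sm: "jump_step R b ?s \<in> clocks \<rightarrow>\<^sub>M borel \<Otimes>\<^sub>M count_space UNIV"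
      by (intro jump_step_measurable[where U="\<lambda>w'. w'"] measurable_const)
         (auto simp: space_pair_measure mem_Times_iff)
    have Fm: "(\<lambda>w'. F (?s, jump_step R b ?s w')) \<in> borel_measurable clocks"
      by (rule measurable_compose[OF measurable_Pair[OF measurable_const sm] F])
         (auto simp: space_pair_measure mem_Times_iff)
    show "(\<integral>\<^sup>+\<omega>. F (?s, jump_step R b ?s (shd \<omega>)) \<partial>stream_space clocks) = (\<integral>\<^sup>+w'. F (?s, jump_step R b ?s w') \<partial>clocks)"
      by (subst C.nn_integral_stream_space[OF measurable_compose[OF measurable_shd Fm]])
         (simp add: S.emeasure_space_1)
  qed
  finally show ?thesis .
qed

end

section \<open>Divergence of two jump processes\<close>

text \<open>\<open>R\<close> drives the reference process and \<open>RE\<close> the process in the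
  first argument of the divergence; \<open>dominated\<close> is absolute continuity at the level of
  single jumps.\<close>

locale jump_rates_pair =
  P: jump_rates R H a b + E: jump_rates RE HE a b
  for R RE :: "real \<Rightarrow> 'x::finite \<Rightarrow> 'x \<Rightarrow> real" and H HE a b +
  assumes dominated: "\<And>s y z. s \<in> {a..b} \<Longrightarrow> y \<noteq> z \<Longrightarrow> R s y z = 0 \<Longrightarrow> RE s y z = 0"
begin

lemma r_dominated: "P.r y z s = 0 \<Longrightarrow> E.r y z s = 0"
  using dominated[of s y z] by (auto simp: P.r_def E.r_def indicator_def split: if_splits)

definition DFS :: "'x \<Rightarrow> real \<Rightarrow> real" where
  "DFS y s = (\<Sum>z\<in>UNIV. DF (E.r y z s) (P.r y z s))"

text \<open>The exponential is the probability that the \<open>RE\<close> process, having entered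
  its state at time \<open>fst Ty\<close>, is still there at time \<open>s\<close>. So this is the
  expected cost \<open>DFS\<close> accumulated until the next jump or until
  \<open>b\<close>.\<close>

definition step_cost :: "real \<times> 'x \<Rightarrow> ennreal" where
  "step_cost Ty = (\<integral>\<^sup>+s. ennreal (indicator {fst Ty..b} s * exp (- E.Haz (snd Ty) (fst Ty) s) * DFS (snd Ty) s) \<partial>lborel)"

lemma DF_r_nonneg: "0 \<le> DF (E.r y z s) (P.r y z s)"
  by (rule DF_nonneg[OF E.r_nonneg P.r_nonneg r_dominated])

lemma DFS_nonneg: "0 \<le> DFS y s"
  unfolding DFS_def by (intro sum_nonneg DF_r_nonneg)

lemma DFS_measurable [measurable]: "DFS y \<in> borel_measurable borel"
  unfolding DFS_def DF_def by measurable

lemma step_cost_expired: "b < T \<Longrightarrow> step_cost (T, y) = 0"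
  by (simp add: step_cost_def)

lemma step_cost_measurable [measurable]: "step_cost \<in> borel_measurable (borel \<Otimes>\<^sub>M count_space UNIV)"
proof -
  have [measurable]: "Measurable.pred (borel \<Otimes>\<^sub>M borel) (\<lambda>x :: real \<times> real. snd x \<in> {fst x..b})"
    unfolding atLeastAtMost_iff by measurable
  have *: "(\<lambda>x. ennreal (indicator {fst x..b} (snd x) * exp (- E.Haz y (fst x) (snd x)) * DFS y (snd x))) \<in> borel_measurable (borel \<Otimes>\<^sub>M lborel)" for y
    unfolding indicator_def of_bool_def by measurable
  have 1: "(\<lambda>T. step_cost (T, y)) \<in> borel_measurable borel" for y
    unfolding step_cost_def fst_conv snd_conv
    by (rule lborel.borel_measurable_nn_integral) (use * in \<open>simp add: case_prod_beta'\<close>)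
  have "(\<lambda>x. step_cost (fst x, snd x)) \<in> borel_measurable (borel \<Otimes>\<^sub>M count_space UNIV)"
    by (rule measurable_compose_countable'[OF measurable_compose[OF measurable_fst 1] measurable_snd])
       (simp add: countable_finite)
  then show ?thesis by simp
qed

end

section \<open>Mixed rates and the likelihood ratio of two jumps\<close>

locale tilted_rates = jump_rates_pair +
  fixes \<theta> :: real
  assumes \<theta>: "0 < \<theta>" "\<theta> < 1"
begin

definition RM :: "real \<Rightarrow> 'a \<Rightarrow> 'a \<Rightarrow> real" where
  "RM s y z = (1 - \<theta>) * RE s y z + \<theta> * R s y z"

definition HM :: "'a \<Rightarrow> 'a \<Rightarrow> real \<Rightarrow> real" where
  "HM y z s = (1 - \<theta>) * HE y z s + \<theta> * H y z s"

sublocale M: jump_rates RM HM a b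
  unfolding RM_def[abs_def] HM_def[abs_def]
proof
  show "a < b" by (rule P.ab)
  fix s y z assume "s \<in> {a..b}" "y \<noteq> (z::'a)"
  then show "0 \<le> (1 - \<theta>) * RE s y z + \<theta> * R s y z"
    using P.rate_nonneg E.rate_nonneg \<theta> by simp
  show "((\<lambda>s. (1 - \<theta>) * HE y z s + \<theta> * H y z s) has_real_derivative (1 - \<theta>) * RE s y z + \<theta> * R s y z) (at s within {a..b})"
    using P.H_deriv[of s y z] E.H_deriv[of s y z] \<open>s \<in> {a..b}\<close> \<open>y \<noteq> z\<close> by (auto intro!: derivative_eq_intros)
next
  fix y z :: 'a assume "y \<noteq> z"
  note P.rate_measurable[OF this, measurable] E.rate_measurable[OF this, measurable]
  have "(\<lambda>s. (1 - \<theta>) * (indicator {a..b} s * RE s y z) + \<theta> * (indicator {a..b} s * R s y z)) \<in> borel_measurable borel"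
    by measurable
  then show "(\<lambda>s. indicator {a..b} s * ((1 - \<theta>) * RE s y z + \<theta> * R s y z)) \<in> borel_measurable borel"
    by (simp add: algebra_simps)
qed

lemma M_r: "M.r y z s = (1 - \<theta>) * E.r y z s + \<theta> * P.r y z s"
  by (simp add: M.r_def E.r_def P.r_def RM_def algebra_simps)

text \<open>Where \<open>P.r\<close> vanishes, domination makes \<open>M.r\<close> vanish too, so
  that the value chosen there carries no mass; 1 preserves positivity and the lower bound
  \<open>\<theta>\<close>.\<close>

definition ratio :: "'a \<Rightarrow> 'a \<Rightarrow> real \<Rightarrow> real" where
  "ratio y z s = (if P.r y z s = 0 then 1 else M.r y z s / P.r y z s)"

text \<open>The likelihood ratio of one jump from \<open>Ty\<close> to \<open>sz\<close>; a jump time beyond \<open>b\<close> means no jump.\<close>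

definition weight :: "real \<times> 'a \<Rightarrow> real \<times> 'a \<Rightarrow> real" where
  "weight Ty sz = (let T = fst Ty; y = snd Ty; s = fst sz; z = snd sz in
     if b < T then 1
     else if b < s then exp (P.Haz y T b - M.Haz y T b)
     else ratio y z s * exp (P.Haz y T s - M.Haz y T s))"

text \<open>\<open>- K\<close> bounds \<open>ln (weight Ty sz)\<close> from below uniformly:
  \<open>ln \<theta>\<close> accounts for \<open>ratio\<close>, and the sum over all states
  dominates the hazard difference of any single state.\<close>

definition K :: real where
  "K = (\<Sum>y\<in>UNIV. P.Haz y a b + M.Haz y a b) - ln \<theta>"

lemma ratio_ge: "\<theta> \<le> ratio y z s"
proof (cases "P.r y z s = 0")
  case False
  then have "0 < P.r y z s" using P.r_nonneg[of y z s] by simp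
  then show ?thesis using \<theta> E.r_nonneg[of y z s] by (simp add: ratio_def M_r le_divide_eq)
qed (use \<theta> in \<open>simp add: ratio_def\<close>)

lemma ratio_pos: "0 < ratio y z s"
  using ratio_ge[of y z s] \<theta> by simp

lemma ratio_measurable [measurable]: "ratio y z \<in> borel_measurable borel"
  unfolding ratio_def by measurable

lemma Haz_diff_ge: "- (\<Sum>y\<in>UNIV. P.Haz y a b + M.Haz y a b) \<le> P.Haz y T s - M.Haz y T s"
proof -
  \<comment> \<open>Hazards are antisymmetric in their times, so \<open>Haz_le\<close> also yields a
    lower bound.\<close>
  have "P.Haz y T s = - P.Haz y s T"
    by (simp add: P.Haz_def P.haz_def sum_negf[symmetric] if_distrib cong: if_cong)
  then have "- P.Haz y a b - M.Haz y a b \<le> P.Haz y T s - M.Haz y T s"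
    using P.Haz_le[of y s T] M.Haz_le[of y T s] by simp
  moreover have "P.Haz y a b + M.Haz y a b \<le> (\<Sum>y\<in>UNIV. P.Haz y a b + M.Haz y a b)"
    by (rule member_le_sum) (use P.ab P.Haz_nonneg M.Haz_nonneg in auto)
  ultimately show ?thesis by simp
qed

lemma K_nonneg: "0 \<le> K"
proof -
  have "0 \<le> (\<Sum>y\<in>UNIV. P.Haz y a b + M.Haz y a b)"
    using P.ab P.Haz_nonneg M.Haz_nonneg by (intro sum_nonneg) (simp add: add_nonneg_nonneg)
  moreover have "ln \<theta> < 0" using \<theta> by simp
  ultimately show ?thesis by (simp add: K_def)
qed

lemma weight_pos: "0 < weight Ty sz"
  by (simp add: weight_def Let_def ratio_pos)

lemma ln_weight_ge: "0 \<le> ln (weight Ty sz) + K"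
proof -
  have "ln \<theta> \<le> ln (ratio y z s)" for y z s
    using ratio_ge[of y z s] \<theta> by simp
  moreover have "ln \<theta> < 0" using \<theta> by simp
  ultimately show ?thesis
    using Haz_diff_ge K_nonneg ratio_pos
    by (auto simp: weight_def Let_def ln_mult K_def add_increasing intro: order_trans[OF _ Haz_diff_ge])
       (smt (verit))+
qed

lemma weight_measurable [measurable]:
  "(\<lambda>x. weight (fst x) (snd x)) \<in> borel_measurable ((borel \<Otimes>\<^sub>M count_space UNIV) \<Otimes>\<^sub>M (borel \<Otimes>\<^sub>M count_space UNIV))"
    (is "_ \<in> borel_measurable ?N")
proof -
  have y: "(\<lambda>x. snd (fst x)) \<in> ?N \<rightarrow>\<^sub>M count_space (UNIV::'a set)" by measurable
  have z: "(\<lambda>x. snd (snd x)) \<in> ?N \<rightarrow>\<^sub>M count_space (UNIV::'a set)" by measurable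
  have c: "countable (UNIV :: 'a set)" by (simp add: countable_finite)
  have 1: "(\<lambda>x. weight (fst (fst x), y) (fst (snd x), z)) \<in> borel_measurable ?N" for y z
    unfolding weight_def Let_def fst_conv snd_conv by measurable
  have 2: "(\<lambda>x. weight (fst (fst x), y) (fst (snd x), snd (snd x))) \<in> borel_measurable ?N" for y
    by (rule measurable_compose_countable'[OF 1 z c])
  have "(\<lambda>x. weight (fst (fst x), snd (fst x)) (fst (snd x), snd (snd x))) \<in> borel_measurable ?N"
    by (rule measurable_compose_countable'[OF 2 y c])
  then show ?thesis by simp
qed

lemma weight_measurable2 [measurable]: "weight Ty \<in> borel_measurable (borel \<Otimes>\<^sub>M count_space UNIV)"
  using measurable_compose[OF measurable_Pair1'[of Ty "borel \<Otimes>\<^sub>M count_space UNIV"] weight_measurable]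
  by (simp add: space_pair_measure mem_Times_iff)

text \<open>Change of measure: multiplication by \<open>weight\<close> turns the jump density of
  \<open>R\<close> into one of at most that of \<open>RM\<close>, and the latter has total mass
  1.\<close>

lemma weight_normalized:
  assumes T: "a \<le> T" "T \<le> b"
  shows "(\<integral>\<^sup>+w. ennreal (weight (T, y) (jump_step R b (T, y) w)) \<partial>clocks) \<le> 1"
proof -
  interpret C: prob_space "clocks :: ('a \<Rightarrow> real) measure" by (rule prob_space_clocks)
  have "(\<integral>\<^sup>+w. ennreal (weight (T, y) (jump_step R b (T, y) w)) \<partial>clocks) =
    (\<Sum>z\<in>UNIV. \<integral>\<^sup>+s. ennreal (weight (T, y) (s, z)) * ennreal (indicator {T..b} s * P.r y z s * exp (- P.Haz y T s)) \<partial>lborel)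
      + ennreal (weight (T, y) (b + 1, y)) * ennreal (exp (- P.Haz y T b))"
    by (rule P.jump_step_law[OF T]) measurable
  also have "\<dots> \<le> (\<Sum>z\<in>UNIV. \<integral>\<^sup>+s. 1 * ennreal (indicator {T..b} s * M.r y z s * exp (- M.Haz y T s)) \<partial>lborel)
      + 1 * ennreal (exp (- M.Haz y T b))"
  proof (intro add_mono sum_mono nn_integral_mono)
    fix z s
    show "ennreal (weight (T, y) (s, z)) * ennreal (indicator {T..b} s * P.r y z s * exp (- P.Haz y T s))
      \<le> 1 * ennreal (indicator {T..b} s * M.r y z s * exp (- M.Haz y T s))"
    proof (cases "s \<in> {T..b}")
      case True
      have "ratio y z s * P.r y z s \<le> M.r y z s"
        using M.r_nonneg[of y z s] by (simp add: ratio_def)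
      then have "ratio y z s * P.r y z s * exp (- M.Haz y T s) \<le> M.r y z s * exp (- M.Haz y T s)"
        by (intro mult_right_mono) auto
      moreover have "weight (T, y) (s, z) * (P.r y z s * exp (- P.Haz y T s)) = ratio y z s * P.r y z s * exp (- M.Haz y T s)"
        using True by (simp add: weight_def exp_diff exp_minus field_simps)
      ultimately have "weight (T, y) (s, z) * (P.r y z s * exp (- P.Haz y T s)) \<le> M.r y z s * exp (- M.Haz y T s)"
        by (simp only:)
      then show ?thesis
        using True weight_pos[of "(T, y)" "(s, z)"] by (simp add: ennreal_mult'[symmetric] ennreal_leI)
    qed simp
    show "ennreal (weight (T, y) (b + 1, y)) * ennreal (exp (- P.Haz y T b)) \<le> 1 * ennreal (exp (- M.Haz y T b))"
      using T by (simp add: weight_def ennreal_mult'[symmetric] exp_diff exp_minus field_simps)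
  qed
  \<comment> \<open>The jump law of the \<open>RM\<close> process for the constant function 1, read
    from right to left.\<close>
  also have "\<dots> = (\<integral>\<^sup>+w. 1 \<partial>(clocks :: ('a \<Rightarrow> real) measure))"
    by (rule M.jump_step_law[OF T, symmetric]) simp
  also have "\<dots> = 1" by (simp add: C.emeasure_space_1)
  finally show ?thesis .
qed

text \<open>This is \<open>DF_interpolate_le\<close> where \<open>P.r\<close> is positive; elsewhere
  all terms vanish. \<open>M.r\<close> and \<open>P.r\<close> are kept apart because their sums will
  be matched with the derivative of the hazard difference.\<close>

lemma ln_ratio_ge: "(1 - \<theta>) * DF (E.r y z s) (P.r y z s) + M.r y z s \<le> E.r y z s * ln (ratio y z s) + P.r y z s"
proof (cases "P.r y z s = 0")
  case True
  then show ?thesis using r_dominated[OF True] by (simp add: M_r)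
next
  case False
  then have "0 < P.r y z s" using P.r_nonneg[of y z s] by simp
  from DF_interpolate_le[OF E.r_nonneg[of y z s] this \<theta>] show ?thesis
    using False by (simp add: ratio_def M_r)
qed

text \<open>Integration by parts. With \<open>A\<close> the hazard difference and \<open>e\<close>
  the survival probability under \<open>RE\<close>, the no-jump term \<open>v\<close> is the
  boundary value of \<open>e s * (A s + K)\<close> at \<open>b\<close>, and its value at
  \<open>T\<close> is \<open>K\<close>. By \<open>ln_ratio_ge\<close> the \<open>ln ratio\<close>
  part of the jump term compensates the difference of the total rates of \<open>RM\<close> and
  \<open>R\<close> and leaves \<open>(1 - \<theta>) * DFS\<close>.\<close>

lemma ln_weight_step:
  assumes T: "a \<le> T" "T \<le> b"
  shows "ennreal K + ennreal (1 - \<theta>) * step_cost (T, y)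
    \<le> (\<integral>\<^sup>+w. ennreal (ln (weight (T, y) (jump_step RE b (T, y) w)) + K) \<partial>clocks)"
proof -
  define A where "A s = P.Haz y T s - M.Haz y T s" for s
  define e where "e s = exp (- E.Haz y T s)" for s
  define v where "v = (A b + K) * e b"
  have [measurable]: "A \<in> borel_measurable borel" "e \<in> borel_measurable borel"
    unfolding A_def e_def by measurable
  have e0: "0 < e s" for s by (simp add: e_def)
  have AT: "A T = 0" "e T = 1" by (simp_all add: A_def e_def)
  have AK: "0 \<le> A s + K" for s
  proof -
    have "ln \<theta> < 0" using \<theta> by simp
    then show ?thesis using Haz_diff_ge[of y T s] by (simp add: A_def K_def)
  qed
  have v0: "0 \<le> v" using AK[of b] e0[of b] by (simp add: v_def)
  define tot where "tot f s = (\<Sum>z\<in>UNIV. f y z s)" for f :: "'a \<Rightarrow> 'a \<Rightarrow> real \<Rightarrow> real" and s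
  have tot0: "0 \<le> tot P.r s" "0 \<le> tot E.r s" "0 \<le> tot M.r s" for s
    unfolding tot_def by (auto intro!: sum_nonneg P.r_nonneg E.r_nonneg M.r_nonneg)
  have [measurable]: "tot P.r \<in> borel_measurable borel" "tot E.r \<in> borel_measurable borel" "tot M.r \<in> borel_measurable borel"
    unfolding tot_def by measurable
  \<comment> \<open>The derivative of \<open>- (e s * (A s + K))\<close> is
    \<open>gp s - gn s\<close>. Both parts are non-negative, so each can be integrated as an
    extended non-negative function on its own side of the inequality.\<close>
  define gn where "gn s = tot P.r s * e s" for s
  define gp where "gp s = (tot M.r s + tot E.r s * (A s + K)) * e s" for s
  define g1 where "g1 s = (1 - \<theta>) * (e s * DFS y s)" for s
  define X where "X s = e s * (\<Sum>z\<in>UNIV. E.r y z s * (ln (ratio y z s) + A s + K))" for s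
  have [measurable]: "gn \<in> borel_measurable borel" "gp \<in> borel_measurable borel" "g1 \<in> borel_measurable borel"
     "X \<in> borel_measurable borel"
    unfolding gn_def gp_def g1_def X_def by measurable
  have gn0: "0 \<le> gn s" and gp0: "0 \<le> gp s" and g10: "0 \<le> g1 s" for s
    using tot0[of s] e0[of s] AK[of s] DFS_nonneg[of y s] \<theta> by (simp_all add: gn_def gp_def g1_def)
  have le: "g1 s + gp s \<le> X s + gn s" for s
  proof -
    have "(1 - \<theta>) * DFS y s + tot M.r s \<le> (\<Sum>z\<in>UNIV. E.r y z s * ln (ratio y z s)) + tot P.r s"
      unfolding DFS_def tot_def sum_distrib_left sum.distrib[symmetric] by (intro sum_mono ln_ratio_ge)
    then have "((1 - \<theta>) * DFS y s + tot M.r s + tot E.r s * (A s + K)) * e s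
       \<le> ((\<Sum>z\<in>UNIV. E.r y z s * ln (ratio y z s)) + tot E.r s * (A s + K) + tot P.r s) * e s"
      using e0[of s] by (intro mult_right_mono) auto
    then show ?thesis
      by (simp add: g1_def gp_def X_def gn_def tot_def sum.distrib sum_distrib_left sum_distrib_right algebra_simps)
  qed
  have I2: "((\<lambda>s. gp s - gn s) has_integral (K - v)) {T..b}"
  proof -
    have "((\<lambda>s. - (e s * (A s + K))) has_real_derivative gp s - gn s) (at s within {a..b})" if "s \<in> {a..b}" for s
      using P.Haz_deriv[OF that, of y T] E.Haz_deriv[OF that, of y T] M.Haz_deriv[OF that, of y T]
      unfolding e_def A_def gp_def gn_def tot_def
      by (auto intro!: derivative_eq_intros simp: algebra_simps)
    from has_integral_deriv_within[OF this T order_refl] show ?thesis by (simp add: AT v_def algebra_simps)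
  qed
  \<comment> \<open>The integral \<open>I\<close> of \<open>gn\<close> will be cancelled at the end
    and must be finite: \<open>e\<close> is at most 1 and the total hazard of \<open>R\<close> is
    finite.\<close>
  have "(\<integral>\<^sup>+s. ennreal (indicator {T..b} s * gn s) \<partial>lborel) \<le> (\<integral>\<^sup>+s. ennreal (tot P.r s) * indicator {T..b} s \<partial>lborel)"
  proof (rule nn_integral_mono)
    fix s
    show "ennreal (indicator {T..b} s * gn s) \<le> ennreal (tot P.r s) * indicator {T..b} s"
    proof (cases "s \<in> {T..b}")
      case True
      have "e s \<le> 1" using True E.Haz_nonneg[of T s y] by (simp add: e_def)
      then show ?thesis
        using True tot0[of s] by (auto simp: gn_def intro!: ennreal_leI mult_left_le)
    qed simp
  qed
  also have "\<dots> = ennreal (P.Haz y T b - P.Haz y T T)"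
    by (rule nn_integral_has_integral_lebesgue'[OF _ has_integral_deriv_within[OF _ T order_refl]])
       (use tot0 P.Haz_deriv in \<open>auto simp: tot_def\<close>)
  finally have "(\<integral>\<^sup>+s. ennreal (indicator {T..b} s * gn s) \<partial>lborel) < \<infinity>"
    by (simp add: le_less_trans)
  then obtain I where I: "(\<integral>\<^sup>+s. ennreal (indicator {T..b} s * gn s) \<partial>lborel) = ennreal I" "0 \<le> I"
    by (cases "\<integral>\<^sup>+s. ennreal (indicator {T..b} s * gn s) \<partial>lborel") auto
  then have "((\<lambda>s. indicator {T..b} s * gn s) has_integral I) UNIV"
    by (intro nn_integral_has_integral) (use gn0 in auto)
  then have In: "(gn has_integral I) {T..b}"
    using has_integral_restrict_UNIV[of "{T..b}" gn I]
    by (simp add: indicator_def of_bool_def if_distrib[of "\<lambda>x. x * _"] cong: if_cong)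
  have "((\<lambda>s. (gp s - gn s) + gn s) has_integral (K - v) + I) {T..b}"
    by (rule has_integral_add[OF I2 In])
  then have Ip: "(gp has_integral (K - v + I)) {T..b}" by simp
  have Igp: "(\<integral>\<^sup>+s. ennreal (gp s) * indicator {T..b} s \<partial>lborel) = ennreal (K - v + I)"
    by (rule nn_integral_has_integral_lebesgue'[OF _ Ip]) (rule gp0)
  have Kv: "0 \<le> K - v + I" by (rule has_integral_nonneg[OF Ip gp0])
  have cost: "ennreal (1 - \<theta>) * step_cost (T, y) = (\<integral>\<^sup>+s. ennreal (g1 s) * indicator {T..b} s \<partial>lborel)"
    unfolding step_cost_def fst_conv snd_conv
    by (subst nn_integral_cmult[symmetric])
       (use \<theta> e0 in \<open>auto intro!: nn_integral_cong simp: g1_def e_def indicator_def ennreal_mult' mult.assoc\<close>)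
  have law: "(\<integral>\<^sup>+w. ennreal (ln (weight (T, y) (jump_step RE b (T, y) w)) + K) \<partial>clocks) =
    (\<Sum>z\<in>UNIV. \<integral>\<^sup>+s. ennreal (ln (weight (T, y) (s, z)) + K) * ennreal (indicator {T..b} s * E.r y z s * exp (- E.Haz y T s)) \<partial>lborel)
      + ennreal (ln (weight (T, y) (b + 1, y)) + K) * ennreal (exp (- E.Haz y T b))"
    by (rule E.jump_step_law[OF T]) measurable
  have "(\<Sum>z\<in>UNIV. \<integral>\<^sup>+s. ennreal (ln (weight (T, y) (s, z)) + K) * ennreal (indicator {T..b} s * E.r y z s * exp (- E.Haz y T s)) \<partial>lborel)
     = (\<integral>\<^sup>+s. (\<Sum>z\<in>UNIV. ennreal (ln (weight (T, y) (s, z)) + K) * ennreal (indicator {T..b} s * E.r y z s * exp (- E.Haz y T s))) \<partial>lborel)"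
    by (rule nn_integral_sum[symmetric]) measurable
  also have "\<dots> = (\<integral>\<^sup>+s. ennreal (X s) * indicator {T..b} s \<partial>lborel)"
  proof (rule nn_integral_cong)
    fix s
    show "(\<Sum>z\<in>UNIV. ennreal (ln (weight (T, y) (s, z)) + K) * ennreal (indicator {T..b} s * E.r y z s * exp (- E.Haz y T s)))
       = ennreal (X s) * indicator {T..b} s"
    proof (cases "s \<in> {T..b}")
      case True
      have "ennreal (ln (weight (T, y) (s, z)) + K) * ennreal (indicator {T..b} s * E.r y z s * exp (- E.Haz y T s))
         = ennreal (e s * (E.r y z s * (ln (ratio y z s) + A s + K)))" for z
      proof -
        have "ln (weight (T, y) (s, z)) = ln (ratio y z s) + A s"
          using True ratio_pos[of y z s] by (simp add: weight_def A_def ln_mult)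
        moreover have "0 \<le> ln (weight (T, y) (s, z)) + K" by (rule ln_weight_ge)
        ultimately show ?thesis
          using True by (simp add: ennreal_mult[symmetric] E.r_nonneg e_def mult_ac)
      qed
      moreover have "0 \<le> e s * (E.r y z s * (ln (ratio y z s) + A s + K))" for z
      proof -
        have "0 \<le> ln (weight (T, y) (s, z)) + K" by (rule ln_weight_ge)
        also have "ln (weight (T, y) (s, z)) = ln (ratio y z s) + A s"
          using True ratio_pos[of y z s] by (simp add: weight_def A_def ln_mult)
        finally show ?thesis using e0[of s] E.r_nonneg[of y z s] by (intro mult_nonneg_nonneg) auto
      qed
      ultimately show ?thesis using True by (simp add: sum_ennreal X_def sum_distrib_left)
    qed simp
  qed
  finally have X: "(\<integral>\<^sup>+w. ennreal (ln (weight (T, y) (jump_step RE b (T, y) w)) + K) \<partial>clocks)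
     = (\<integral>\<^sup>+s. ennreal (X s) * indicator {T..b} s \<partial>lborel) + ennreal v"
    using T AK[of b] unfolding law by (simp add: weight_def v_def e_def A_def ennreal_mult)
  have "ennreal (1 - \<theta>) * step_cost (T, y) + ennreal (K - v + I)
     = (\<integral>\<^sup>+s. ennreal (g1 s) * indicator {T..b} s + ennreal (gp s) * indicator {T..b} s \<partial>lborel)"
    unfolding cost Igp[symmetric] by (rule nn_integral_add[symmetric]) measurable
  also have "\<dots> \<le> (\<integral>\<^sup>+s. ennreal (X s) * indicator {T..b} s + ennreal (indicator {T..b} s * gn s) \<partial>lborel)"
  proof (rule nn_integral_mono)
    fix s
    have "ennreal (g1 s) + ennreal (gp s) = ennreal (g1 s + gp s)" using g10 gp0 by simp
    also have "\<dots> \<le> ennreal (X s + gn s)" by (rule ennreal_leI[OF le])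
    also have "\<dots> \<le> ennreal (X s) + ennreal (gn s)"
      using gn0[of s] by (cases "0 \<le> X s") (auto simp: ennreal_neg intro!: ennreal_leI)
    finally show "ennreal (g1 s) * indicator {T..b} s + ennreal (gp s) * indicator {T..b} s
      \<le> ennreal (X s) * indicator {T..b} s + ennreal (indicator {T..b} s * gn s)"
      by (auto simp: indicator_def)
  qed
  also have "\<dots> = (\<integral>\<^sup>+s. ennreal (X s) * indicator {T..b} s \<partial>lborel) + ennreal I"
    unfolding I(1)[symmetric] by (rule nn_integral_add) measurable
  finally have le2: "ennreal (1 - \<theta>) * step_cost (T, y) + ennreal (K - v + I) + ennreal v
      \<le> (\<integral>\<^sup>+s. ennreal (X s) * indicator {T..b} s \<partial>lborel) + ennreal I + ennreal v"
    by (rule add_right_mono)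
  have "ennreal I + (ennreal K + ennreal (1 - \<theta>) * step_cost (T, y))
      = ennreal (1 - \<theta>) * step_cost (T, y) + (ennreal K + ennreal I)"
    by (simp only: ac_simps)
  also have "ennreal K + ennreal I = ennreal (K - v + I) + ennreal v"
    using Kv v0 K_nonneg I(2) by (simp add: ennreal_plus[symmetric] del: ennreal_plus)
  also have "ennreal (1 - \<theta>) * step_cost (T, y) + \<dots> = ennreal (1 - \<theta>) * step_cost (T, y) + ennreal (K - v + I) + ennreal v"
    by (simp only: add.assoc)
  also note le2
  also have "(\<integral>\<^sup>+s. ennreal (X s) * indicator {T..b} s \<partial>lborel) + ennreal I + ennreal v
     = ennreal I + ((\<integral>\<^sup>+s. ennreal (X s) * indicator {T..b} s \<partial>lborel) + ennreal v)"
    by (simp only: ac_simps)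
  finally have "ennreal I + (ennreal K + ennreal (1 - \<theta>) * step_cost (T, y))
     \<le> ennreal I + ((\<integral>\<^sup>+s. ennreal (X s) * indicator {T..b} s \<partial>lborel) + ennreal v)" .
  then show ?thesis unfolding X by (simp add: ennreal_add_left_cancel_le)
qed

lemma weight_ge: "exp (- K) \<le> weight Ty sz"
  using ln_weight_ge[of Ty sz] weight_pos[of Ty sz] by (simp add: ln_ge_iff[symmetric])

lemma weight_normalized':
  assumes "a \<le> fst Ty"
  shows "(\<integral>\<^sup>+w. ennreal (weight Ty (jump_step R b Ty w)) \<partial>clocks) \<le> 1"
proof (cases "fst Ty \<le> b")
  case True
  then show ?thesis using weight_normalized[of "fst Ty" "snd Ty"] assms by simp
next
  case False
  interpret C: prob_space "clocks :: ('a \<Rightarrow> real) measure" by (rule prob_space_clocks)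
  show ?thesis using False by (simp add: weight_def C.emeasure_space_1)
qed

lemma ln_weight_step':
  assumes "a \<le> fst Ty"
  shows "ennreal K + ennreal (1 - \<theta>) * step_cost Ty
    \<le> (\<integral>\<^sup>+w. ennreal (ln (weight Ty (jump_step RE b Ty w)) + K) \<partial>clocks)"
proof (cases "fst Ty \<le> b")
  case True
  then show ?thesis using ln_weight_step[of "fst Ty" "snd Ty"] assms by simp
next
  case False
  interpret C: prob_space "clocks :: ('a \<Rightarrow> real) measure" by (rule prob_space_clocks)
  show ?thesis using False step_cost_expired[of "fst Ty" "snd Ty"] by (simp add: weight_def C.emeasure_space_1)
qed

text \<open>\<open>W\<close> is the product of the one-step weights of the two observed jumps. Its
  integral is at most 1 by normalising the second step for a fixed first one and then the first; its
  logarithm is a sum, to which each step contributes its cost and one copy of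
  \<open>K\<close>.\<close>

lemma KL_div_tilted:
  "enn2ereal (ennreal (1 - \<theta>) * (step_cost (a, x0) + (\<integral>\<^sup>+w. step_cost (jump_step RE b (a, x0) w) \<partial>clocks)))
    \<le> KL_div (path_measure RE a b x0) (path_measure R a b x0)"
proof -
  interpret C: prob_space "clocks :: ('a \<Rightarrow> real) measure" by (rule prob_space_clocks)
  let ?S = "borel \<Otimes>\<^sub>M count_space (UNIV :: 'a set)"
  define o1 where "o1 p = obs_step a b p (a, x0)" for p
  define W where "W p = weight (a, x0) (o1 p) * weight (o1 p) (obs_step a b p (o1 p))" for p
  define F where "F = (\<lambda>(e, e'). weight (a, x0) e * weight e e')"
  have Fm [measurable]: "F \<in> borel_measurable (?S \<Otimes>\<^sub>M ?S)"
    unfolding F_def case_prod_beta' by measurable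
  have o1m: "o1 \<in> Pi\<^sub>M {a..b} (\<lambda>_. count_space UNIV) \<rightarrow>\<^sub>M ?S"
    unfolding o1_def by (rule obs_step_measurable[OF _ P.ab]) simp
  note o2m = obs_step_measurable[OF o1m P.ab]
  have WF: "W p = F (o1 p, obs_step a b p (o1 p))" for p by (simp add: W_def F_def)
  have Wm: "W \<in> borel_measurable (path_measure R a b x0)"
    unfolding WF measurable_cong_sets[OF P.sets_path_measure refl]
    by (rule measurable_compose[OF measurable_Pair[OF o1m o2m] Fm])
  have stepm: "jump_step R b e \<in> clocks \<rightarrow>\<^sub>M ?S" "jump_step RE b e \<in> clocks \<rightarrow>\<^sub>M ?S" if "a \<le> fst e" for e
    using that by (auto intro!: P.jump_step_measurable[where U="\<lambda>w. w"] E.jump_step_measurable[where U="\<lambda>w. w"] measurable_const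
        simp: space_pair_measure mem_Times_iff)
  note step0 = stepm[of "(a, x0)", simplified, measurable]
  have Wint: "(\<integral>\<^sup>+p. ennreal (W p) \<partial>path_measure R a b x0) \<le> 1"
  proof -
    have "(\<integral>\<^sup>+p. ennreal (W p) \<partial>path_measure R a b x0) =
       (\<integral>\<^sup>+w. \<integral>\<^sup>+w'. ennreal (F (jump_step R b (a, x0) w, jump_step R b (jump_step R b (a, x0) w) w')) \<partial>clocks \<partial>clocks)"
      unfolding WF o1_def by (rule P.nn_integral_path_measure) measurable
    also have "\<dots> \<le> (\<integral>\<^sup>+w. ennreal (weight (a, x0) (jump_step R b (a, x0) w)) \<partial>clocks)"
    proof (rule nn_integral_mono)
      fix w :: "'a \<Rightarrow> real"
      let ?e = "jump_step R b (a, x0) w"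
      have e: "a \<le> fst ?e" by (rule P.jump_step_ge) simp
      note stepm(1)[OF e, measurable]
      have "(\<integral>\<^sup>+w'. ennreal (F (?e, jump_step R b ?e w')) \<partial>clocks)
         = ennreal (weight (a, x0) ?e) * (\<integral>\<^sup>+w'. ennreal (weight ?e (jump_step R b ?e w')) \<partial>clocks)"
        unfolding F_def prod.case ennreal_mult[OF less_imp_le[OF weight_pos] less_imp_le[OF weight_pos]]
        by (rule nn_integral_cmult) measurable
      also have "\<dots> \<le> ennreal (weight (a, x0) ?e) * 1"
        by (intro mult_left_mono weight_normalized' e) simp
      finally show "(\<integral>\<^sup>+w'. ennreal (F (?e, jump_step R b ?e w')) \<partial>clocks) \<le> ennreal (weight (a, x0) ?e)" by simp
    qed
    also have "\<dots> \<le> 1" by (rule weight_normalized') simp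
    finally show ?thesis .
  qed
  have Wlb: "exp (- (2 * K)) \<le> W p" for p
  proof -
    have "exp (- K) * exp (- K) \<le> W p"
      unfolding W_def by (intro mult_mono weight_ge) (auto simp: weight_pos less_imp_le)
    then show ?thesis by (simp add: exp_add[symmetric])
  qed
  let ?D = "step_cost (a, x0) + (\<integral>\<^sup>+w. step_cost (jump_step RE b (a, x0) w) \<partial>clocks)"
  have "ennreal (2 * K) + ennreal (1 - \<theta>) * ?D =
     (ennreal K + ennreal (1 - \<theta>) * step_cost (a, x0)) + (\<integral>\<^sup>+w. ennreal K + ennreal (1 - \<theta>) * step_cost (jump_step RE b (a, x0) w) \<partial>clocks)"
    using K_nonneg by (simp add: nn_integral_add nn_integral_cmult C.emeasure_space_1 distrib_left ac_simps
        flip: ennreal_plus)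
  also have "\<dots> \<le> (\<integral>\<^sup>+w. ennreal (ln (weight (a, x0) (jump_step RE b (a, x0) w)) + K) \<partial>clocks) +
     (\<integral>\<^sup>+w. ennreal K + ennreal (1 - \<theta>) * step_cost (jump_step RE b (a, x0) w) \<partial>clocks)"
    by (intro add_right_mono ln_weight_step') simp
  also have "\<dots> = (\<integral>\<^sup>+w. ennreal (ln (weight (a, x0) (jump_step RE b (a, x0) w)) + K) +
       (ennreal K + ennreal (1 - \<theta>) * step_cost (jump_step RE b (a, x0) w)) \<partial>clocks)"
    by (rule nn_integral_add[symmetric]) measurable
  also have "\<dots> \<le> (\<integral>\<^sup>+w. \<integral>\<^sup>+w'. ennreal (ln (F (jump_step RE b (a, x0) w, jump_step RE b (jump_step RE b (a, x0) w) w')) + 2 * K) \<partial>clocks \<partial>clocks)"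
  proof (rule nn_integral_mono)
    fix w :: "'a \<Rightarrow> real"
    let ?e = "jump_step RE b (a, x0) w"
    have e: "a \<le> fst ?e" by (rule E.jump_step_ge) simp
    note stepm(2)[OF e, measurable]
    have "ennreal (ln (weight (a, x0) ?e) + K) + (ennreal K + ennreal (1 - \<theta>) * step_cost ?e)
       \<le> ennreal (ln (weight (a, x0) ?e) + K) + (\<integral>\<^sup>+w'. ennreal (ln (weight ?e (jump_step RE b ?e w')) + K) \<partial>clocks)"
      by (intro add_left_mono ln_weight_step' e)
    also have "\<dots> = (\<integral>\<^sup>+w'. ennreal (ln (weight (a, x0) ?e) + K) + ennreal (ln (weight ?e (jump_step RE b ?e w')) + K) \<partial>clocks)"
      by (subst nn_integral_add) (auto simp: C.emeasure_space_1)
    also have "\<dots> = (\<integral>\<^sup>+w'. ennreal (ln (F (?e, jump_step RE b ?e w')) + 2 * K) \<partial>clocks)"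
    proof (rule nn_integral_cong)
      fix w'
      show "ennreal (ln (weight (a, x0) ?e) + K) + ennreal (ln (weight ?e (jump_step RE b ?e w')) + K)
        = ennreal (ln (F (?e, jump_step RE b ?e w')) + 2 * K)"
        using ln_weight_ge[of "(a, x0)" ?e] ln_weight_ge[of ?e "jump_step RE b ?e w'"]
          weight_pos[of "(a, x0)" ?e] weight_pos[of ?e "jump_step RE b ?e w'"]
        by (simp add: F_def ln_mult flip: ennreal_plus)
    qed
    finally show "ennreal (ln (weight (a, x0) ?e) + K) + (ennreal K + ennreal (1 - \<theta>) * step_cost ?e)
      \<le> (\<integral>\<^sup>+w'. ennreal (ln (F (?e, jump_step RE b ?e w')) + 2 * K) \<partial>clocks)" .
  qed
  also have "\<dots> = (\<integral>\<^sup>+p. ennreal (ln (W p) + 2 * K) \<partial>path_measure RE a b x0)"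
    unfolding WF o1_def by (rule E.nn_integral_path_measure[symmetric]) measurable
  finally have "enn2ereal (ennreal (2 * K) + ennreal (1 - \<theta>) * ?D)
     \<le> enn2ereal (\<integral>\<^sup>+p. ennreal (ln (W p) + 2 * K) \<partial>path_measure RE a b x0)"
    by (simp add: less_eq_ennreal.rep_eq)
  also have "\<dots> \<le> KL_div (path_measure RE a b x0) (path_measure R a b x0) + ereal (2 * K)"
    by (rule KL_div_variational[OF P.prob_space_path_measure E.prob_space_path_measure _ Wm Wlb Wint])
       (simp add: P.sets_path_measure E.sets_path_measure)
  finally have "ereal (2 * K) + enn2ereal (ennreal (1 - \<theta>) * ?D) \<le> ereal (2 * K) + KL_div (path_measure RE a b x0) (path_measure R a b x0)"
    using K_nonneg by (simp add: plus_ennreal.rep_eq add.commute)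
  \<comment> \<open>\<open>2 * K\<close> is finite, so it cancels even when the cost or the
    divergence is infinite.\<close>
  then show ?thesis
    by (cases "KL_div (path_measure RE a b x0) (path_measure R a b x0)"; cases "enn2ereal (ennreal (1 - \<theta>) * ?D)") auto
qed

end

context jump_rates_pair begin

text \<open>\<open>KL_div_tilted\<close> holds with every factor \<open>c\<close> strictly between 0
  and 1; letting \<open>c\<close> tend to 1 removes it. If the cost is infinite,
  \<open>c = 1/2\<close> already makes the divergence infinite.\<close>

theorem KL_div_path_measure_ge:
  "enn2ereal (step_cost (a, x0) +
     (\<Sum>z\<in>UNIV. \<integral>\<^sup>+s. step_cost (s, z) * ennreal (indicator {a..b} s * E.r x0 z s * exp (- E.Haz x0 a s)) \<partial>lborel))
    \<le> KL_div (path_measure RE a b x0) (path_measure R a b x0)"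
proof -
  let ?KL = "KL_div (path_measure RE a b x0) (path_measure R a b x0)"
  define D where "D = step_cost (a, x0) + (\<integral>\<^sup>+w. step_cost (jump_step RE b (a, x0) w) \<partial>clocks)"
  have tilt: "enn2ereal (ennreal c * D) \<le> ?KL" if "0 < c" "c < 1" for c
  proof -
    interpret tilted_rates R RE H HE a b "1 - c"
      by standard (use that in auto)
    show ?thesis using KL_div_tilted[of x0] by (simp add: D_def)
  qed
  have "enn2ereal D \<le> ?KL"
  proof (cases D)
    case (real d)
    have "enn2ereal (ennreal c * D) = ereal (c * d)" if "0 < c" for c
      using real that by (simp add: ennreal_mult'[symmetric])
    then have *: "ereal (c * d) \<le> ?KL" if "0 < c" "c < 1" for c
      using tilt[OF that] that by simp
    show ?thesis
    proof (cases "?KL")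
      case (real k)
      have "d \<le> k"
        by (rule field_le_mult_one_interval) (use * real in auto)
      then show ?thesis using real \<open>D = ennreal d\<close> \<open>0 \<le> d\<close> by simp
    next
      case MInf
      then show ?thesis using *[of "1/2"] by simp
    qed simp
  next
    case top
    then show ?thesis using tilt[of "1/2"] by (simp add: ennreal_mult_top)
  qed
  \<comment> \<open>The no-jump term of the jump law disappears, since a step that starts at
    \<open>b + 1\<close> costs nothing.\<close>
  also have "D = step_cost (a, x0) +
     (\<Sum>z\<in>UNIV. \<integral>\<^sup>+s. step_cost (s, z) * ennreal (indicator {a..b} s * E.r x0 z s * exp (- E.Haz x0 a s)) \<partial>lborel)"
    unfolding D_def using P.ab by (subst E.jump_step_law) (auto simp: step_cost_expired)
  finally show ?thesis .
qed

end

section \<open>The oracle and Euler rates\<close>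

text \<open>For \<open>k = \<kappa> t\<close> this is the probability that \<open>X(t) = x\<close>
  and \<open>X(1)\<close> lies in \<open>A\<close>. It is a polynomial in \<open>k\<close>, so the
  posterior depends on time only through a quotient of continuous functions of
  \<open>\<kappa>\<close>.\<close>

definition joint_mass :: "('d::finite \<Rightarrow> 's::finite) pmf \<Rightarrow> ('d \<Rightarrow> 's pmf) \<Rightarrow> ('d \<Rightarrow> 's) \<Rightarrow> ('d \<Rightarrow> 's) set \<Rightarrow> real \<Rightarrow> real" where
  "joint_mass p1 p0 x A k = (\<Sum>x1\<in>A. pmf p1 x1 * (\<Prod>d\<in>UNIV. (1 - k) * pmf (p0 d) (x d) + k * of_bool (x1 d = x d)))"

lemma joint_mass_nonneg:
  "0 \<le> k \<Longrightarrow> k \<le> 1 \<Longrightarrow> 0 \<le> joint_mass p1 p0 x A k"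
  unfolding joint_mass_def by (intro sum_nonneg mult_nonneg_nonneg prod_nonneg add_nonneg_nonneg) auto

lemma continuous_on_joint_mass: "continuous_on S (joint_mass p1 p0 x A)"
  unfolding joint_mass_def by (intro continuous_intros)

lemma pmf_joint_law:
  fixes p1 :: "('d::finite \<Rightarrow> 's::finite) pmf"
  assumes k: "\<kappa> t \<in> {0..1}"
  shows "pmf (joint_law p1 p0 \<kappa> t) (x, x1) =
    pmf p1 x1 * (\<Prod>d\<in>UNIV. (1 - \<kappa> t) * pmf (p0 d) (x d) + \<kappa> t * of_bool (x1 d = x d))"
proof -
  define B where "B u = Pi_pmf UNIV undefined (\<lambda>d. bind_pmf (bernoulli_pmf (\<kappa> t)) (\<lambda>b. if b then return_pmf (u d) else p0 d))" for u :: "'d \<Rightarrow> 's"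
  have coord: "pmf (bind_pmf (bernoulli_pmf (\<kappa> t)) (\<lambda>b. if b then return_pmf (u d) else p0 d)) v =
     (1 - \<kappa> t) * pmf (p0 d) v + \<kappa> t * of_bool (u d = v)" for u :: "'d \<Rightarrow> 's" and d v
    using k by (simp add: pmf_bind integral_bernoulli_pmf indicator_def)
  have B: "pmf (B u) x = (\<Prod>d\<in>UNIV. (1 - \<kappa> t) * pmf (p0 d) (x d) + \<kappa> t * of_bool (u d = x d))" for u
    unfolding B_def by (simp add: pmf_Pi coord)
  have "pmf (bind_pmf (B u) (\<lambda>xt. return_pmf (xt, u))) (x, x1) = (if u = x1 then pmf (B x1) x else 0)" for u
  proof (cases "u = x1")
    case True
    have "pmf (map_pmf (\<lambda>xt. (xt, x1)) (B x1)) (x, x1) = pmf (B x1) x"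
      by (rule pmf_map_inj'[of "\<lambda>xt. (xt, x1)" "B x1" x]) (auto simp: inj_def)
    then show ?thesis using True by (simp add: map_pmf_def)
  next
    case False
    then have "(x, x1) \<notin> set_pmf (bind_pmf (B u) (\<lambda>xt. return_pmf (xt, u)))" by auto
    then show ?thesis using False unfolding set_pmf_iff by simp
  qed
  then have "pmf (joint_law p1 p0 \<kappa> t) (x, x1) = measure_pmf.expectation p1 (\<lambda>u. if u = x1 then pmf (B x1) x else 0)"
    unfolding joint_law_def B_def[symmetric] by (subst pmf_bind) simp
  also have "\<dots> = (\<Sum>u\<in>UNIV. pmf p1 u * (if u = x1 then pmf (B x1) x else 0))"
    by (subst integral_measure_pmf_real[of UNIV]) (auto simp: mult.commute)
  also have "\<dots> = pmf p1 x1 * pmf (B x1) x" by (simp add: if_distrib[of "\<lambda>v. _ * v"] cong: if_cong)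
  finally show ?thesis by (simp add: B)
qed

lemma prob_joint_law:
  fixes p1 :: "('d::finite \<Rightarrow> 's::finite) pmf"
  assumes k: "\<kappa> t \<in> {0..1}"
  shows "measure_pmf.prob (joint_law p1 p0 \<kappa> t) {(xt, x1). xt = x \<and> x1 \<in> A} = joint_mass p1 p0 x A (\<kappa> t)"
proof -
  have "{(xt, x1). xt = x \<and> x1 \<in> A} = Pair x ` A" by auto
  then have "measure_pmf.prob (joint_law p1 p0 \<kappa> t) {(xt, x1). xt = x \<and> x1 \<in> A}
      = (\<Sum>e\<in>Pair x ` A. pmf (joint_law p1 p0 \<kappa> t) e)"
    by (simp add: measure_measure_pmf_finite)
  also have "\<dots> = (\<Sum>x1\<in>A. pmf (joint_law p1 p0 \<kappa> t) (x, x1))"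
    by (subst sum.reindex) (auto simp: inj_on_def)
  finally show ?thesis by (simp add: pmf_joint_law[where \<kappa>=\<kappa> and t=t, OF k] joint_mass_def)
qed

lemma posterior_eq:
  fixes p1 :: "('d::finite \<Rightarrow> 's::finite) pmf"
  assumes k: "\<kappa> t \<in> {0..1}"
  shows "posterior p1 p0 \<kappa> t d y x = joint_mass p1 p0 x {x1. x1 d = y} (\<kappa> t) / joint_mass p1 p0 x UNIV (\<kappa> t)"
  using prob_joint_law[where \<kappa>=\<kappa> and t=t, OF k, of p1 p0 x "{x1. x1 d = y}"]
    prob_joint_law[where \<kappa>=\<kappa> and t=t, OF k, of p1 p0 x UNIV]
  by (simp add: posterior_def)

lemma upd_iff: "(\<forall>e. e \<noteq> d \<longrightarrow> z e = x e) \<longleftrightarrow> z = x(d := z d)"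
  by (auto simp: fun_eq_iff)

lemma hamming_eq_1_iff: "hamming x z = 1 \<longleftrightarrow> (\<exists>d. z d \<noteq> x d \<and> z = x(d := z d))"
proof
  assume "hamming x z = 1"
  then obtain d where d: "{e. x e \<noteq> z e} = {d}" unfolding hamming_def by (auto simp: card_1_singleton_iff)
  then have "z d \<noteq> x d" by (metis (mono_tags) mem_Collect_eq singletonI)
  moreover have "z e = x e" if "e \<noteq> d" for e using d that by (metis (mono_tags) mem_Collect_eq singletonD)
  ultimately show "\<exists>d. z d \<noteq> x d \<and> z = x(d := z d)" by (metis upd_iff)
next
  assume "\<exists>d. z d \<noteq> x d \<and> z = x(d := z d)"
  then obtain d where d: "z d \<noteq> x d" "z = x(d := z d)" by auto
  have "z e = x e" if "e \<noteq> d" for e using fun_cong[OF d(2), of e] that by simp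
  then have "{e. x e \<noteq> z e} = {d}" using d(1) by force
  then show "hamming x z = 1" by (simp add: hamming_def)
qed

lemma hamming_upd: "y \<noteq> x d \<Longrightarrow> hamming x (x(d := y)) = 1"
  unfolding hamming_eq_1_iff by (intro exI[of _ d]) simp

lemma hamming_upd': "y \<noteq> x d \<Longrightarrow> hamming (x(d := y)) x = 1"
  unfolding hamming_eq_1_iff by (intro exI[of _ d]) simp

lemma sum_only_coordinate:
  fixes x :: "'d::finite \<Rightarrow> 's" and f :: "'d \<Rightarrow> real"
  assumes "y \<noteq> x d"
  shows "(\<Sum>e\<in>UNIV. if (\<forall>e'. e' \<noteq> e \<longrightarrow> (x(d := y)) e' = x e') then f e else 0) = f d"
proof -
  have "(\<forall>e'. e' \<noteq> e \<longrightarrow> (x(d := y)) e' = x e') \<longleftrightarrow> e = d" for e using assms by auto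
  then show ?thesis by simp
qed

lemma Qoff_upd: "y \<noteq> x d \<Longrightarrow> Qoff p1 p0 \<kappa> dk t x (x(d := y)) = Qd p1 p0 \<kappa> dk t x d y"
  unfolding Qoff_def
  using sum_only_coordinate[of y x d "\<lambda>e. Qd p1 p0 \<kappa> dk t x e ((x(d := y)) e)"] by simp

lemma QEoff_upd:
  "y \<noteq> x d \<Longrightarrow> QEoff p1 p0 \<kappa> dk t x0 x (x(d := y)) = (if x d = x0 d then Qd p1 p0 \<kappa> dk t x0 d y else 0)"
  unfolding QEoff_def
  using sum_only_coordinate[of y x d "\<lambda>e. if x e = x0 e then Qd p1 p0 \<kappa> dk t x0 e ((x(d := y)) e) else 0"]
  by (simp add: if_if_eq_conj cong: if_cong)

lemma Qoff_far: "(\<And>d. z \<noteq> x(d := z d)) \<Longrightarrow> Qoff p1 p0 \<kappa> dk t x z = 0"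
  unfolding Qoff_def upd_iff by simp

lemma QEoff_far: "(\<And>d. z \<noteq> x(d := z d)) \<Longrightarrow> QEoff p1 p0 \<kappa> dk t x0 x z = 0"
  unfolding QEoff_def upd_iff by simp

lemma QEoff_start: "QEoff p1 p0 \<kappa> dk t x0 x0 z = Qoff p1 p0 \<kappa> dk t x0 z"
  by (simp add: QEoff_def Qoff_def)

text \<open>The pairs \<open>(d, y)\<close> with \<open>y \<noteq> x d\<close> enumerate the states
  at Hamming distance 1 without repetition, because the changed coordinate and its new value can be
  read off the result.\<close>

lemma sum_neighbours:
  fixes x :: "'d::finite \<Rightarrow> 's::finite" and f :: "('d \<Rightarrow> 's) \<Rightarrow> real"
  assumes far: "\<And>z. z \<noteq> x \<Longrightarrow> (\<And>d. z \<noteq> x(d := z d)) \<Longrightarrow> f z = 0"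
  shows "(\<Sum>z\<in>{z. z \<noteq> x}. f z) = (\<Sum>d\<in>UNIV. \<Sum>y\<in>-{x d}. f (x(d := y)))"
proof -
  let ?S = "Sigma UNIV (\<lambda>d. -{x d})" and ?g = "\<lambda>(d, y). x(d := y)"
  have inj: "inj_on ?g ?S"
  proof (rule inj_onI)
    fix p q assume *: "p \<in> ?S" "q \<in> ?S" "?g p = ?g q"
    obtain d y d' y' where pq: "p = (d, y)" "q = (d', y')" by (metis surj_pair)
    have "x(d := y) = x(d' := y')" using * pq by simp
    from fun_cong[OF this, of d] have "y = (x(d' := y')) d" by simp
    moreover have "y \<noteq> x d" using * pq by simp
    ultimately show "p = q" using pq by (cases "d = d'") auto
  qed
  have "(\<Sum>z\<in>{z. z \<noteq> x}. f z) = (\<Sum>z\<in>?g ` ?S. f z)"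
  proof (rule sum.mono_neutral_right)
    show "?g ` ?S \<subseteq> {z. z \<noteq> x}" by (auto dest: fun_upd_idem_iff[THEN iffD1])
    show "\<forall>z\<in>{z. z \<noteq> x} - ?g ` ?S. f z = 0"
    proof
      fix z assume z: "z \<in> {z. z \<noteq> x} - ?g ` ?S"
      show "f z = 0"
      proof (rule far)
        show "z \<noteq> x" using z by simp
        show "z \<noteq> x(d := z d)" for d
        proof
          assume e: "z = x(d := z d)"
          then have "z d \<noteq> x d" using z by (metis (mono_tags) DiffD1 fun_upd_triv mem_Collect_eq)
          then have "z \<in> ?g ` ?S" using e by (intro image_eqI[of _ _ "(d, z d)"]) auto
          then show False using z by simp
        qed
      qed
    qed
  qed simp
  also have "\<dots> = (\<Sum>p\<in>?S. f (?g p))" by (rule sum.reindex[OF inj, unfolded o_def])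
  also have "\<dots> = (\<Sum>d\<in>UNIV. \<Sum>y\<in>-{x d}. f (x(d := y)))"
    by (subst sum.Sigma) (auto simp: case_prod_beta')
  finally show ?thesis .
qed

text \<open>The derivative is the pointwise limit of right difference quotients with steps
  \<open>1 / (n + 1)\<close>, each continuous in \<open>t\<close>. The gap \<open>v < c\<close>
  leaves room for the steps, and \<open>cl\<close> makes the quotients continuous on the whole
  line.\<close>

lemma borel_measurable_derivative_within:
  fixes f f' :: "real \<Rightarrow> real"
  assumes cont: "continuous_on {a..c} f" and abc: "a \<le> u" "u \<le> v" "v < c"
    and d: "\<And>t. t \<in> {a..c} \<Longrightarrow> (f has_real_derivative f' t) (at t within {a..c})"
  shows "(\<lambda>t. indicator {u..v} t * f' t) \<in> borel_measurable borel"
proof -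
  define cl where "cl s = max a (min c s)" for s
  define q where "q n t = (f (cl (t + 1 / real (Suc n))) - f (cl t)) * real (Suc n)" for n t
  have cc: "continuous_on UNIV (\<lambda>t. f (cl (t + e)))" for e
    unfolding cl_def
    by (rule continuous_on_compose2[OF cont]) (use abc in \<open>auto intro!: continuous_intros\<close>)
  have qm: "q n \<in> borel_measurable borel" for n
    unfolding q_def using cc[of "1 / real (Suc n)"] cc[of 0]
    by (intro borel_measurable_continuous_onI continuous_intros) auto
  have lim: "(\<lambda>n. q n t) \<longlonglongrightarrow> f' t" if t: "t \<in> {u..v}" for t
  proof -
    have ev: "eventually (\<lambda>n. 1 / real (Suc n) < c - v) sequentially"
      by (rule order_tendstoD[OF LIMSEQ_Suc[OF lim_1_over_n]]) (use abc in simp)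
    have "filterlim (\<lambda>n. t + 1 / real (Suc n)) (at t within {a..c}) sequentially"
      unfolding filterlim_at
    proof
      show "eventually (\<lambda>n. t + 1 / real (Suc n) \<in> {a..c} \<and> t + 1 / real (Suc n) \<noteq> t) sequentially"
        using ev by eventually_elim (use t abc in \<open>auto simp: add_increasing2\<close>)
      show "(\<lambda>n. t + 1 / real (Suc n)) \<longlonglongrightarrow> t"
        using tendsto_add[OF tendsto_const LIMSEQ_Suc[OF lim_1_over_n], of t] by simp
    qed
    moreover have "((\<lambda>s. (f s - f t) / (s - t)) \<longlongrightarrow> f' t) (at t within {a..c})"
      using d[of t] t abc by (simp add: has_field_derivative_iff)
    ultimately have "(\<lambda>n. (f (t + 1 / real (Suc n)) - f t) / (t + 1 / real (Suc n) - t)) \<longlonglongrightarrow> f' t"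
      by (rule filterlim_compose[rotated])
    then show ?thesis
    proof (rule Lim_transform_eventually)
      show "eventually (\<lambda>n. (f (t + 1 / real (Suc n)) - f t) / (t + 1 / real (Suc n) - t) = q n t) sequentially"
        using ev
      proof eventually_elim
        case (elim n)
        then have "cl (t + 1 / real (Suc n)) = t + 1 / real (Suc n)" "cl t = t"
          using t abc by (auto simp: cl_def max_def min_def add_increasing2)
        then show ?case by (simp add: q_def)
      qed
    qed
  qed
  show ?thesis
  proof (rule borel_measurable_LIMSEQ_real)
    show "(\<lambda>t. indicator {u..v} t * q n t) \<in> borel_measurable borel" for n
      using qm[of n] by measurable
    show "(\<lambda>n. indicator {u..v} t * q n t) \<longlonglongrightarrow> indicator {u..v} t * f' t" for t
      using lim[of t] by (cases "t \<in> {u..v}") auto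
  qed
qed

section \<open>The oracle and Euler rates as a dominated pair of jump rates\<close>

locale euler_step =
  fixes p1 :: "('d::finite \<Rightarrow> 's::finite) pmf"
    and p0 :: "'d \<Rightarrow> 's pmf"
    and \<kappa> dk :: "real \<Rightarrow> real"
    and t0 t1 :: real
    and x0 :: "'d \<Rightarrow> 's"
  assumes card_d: "CARD('d) \<ge> 2"
    and card_s: "CARD('s) \<ge> 2"
    and kappa_range: "\<forall>t\<in>{0..1}. \<kappa> t \<in> {0..1}"
    and kappa_mono: "mono_on {0..1} \<kappa>"
    and kappa_cont: "continuous_on {0..1} \<kappa>"
    and kappa_deriv: "\<forall>t\<in>{0..1}. (\<kappa> has_real_derivative dk t) (at t within {0..1})"
    and kappa0: "\<kappa> 0 = 0" and kappa1: "\<kappa> 1 = 1"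
    and times: "0 \<le> t0" "t0 < t1" "t1 \<le> 1"
    and pos: "\<forall>t\<in>{t0..t1}. \<forall>x z. hamming x z = 1 \<longrightarrow> Qrate p1 p0 \<kappa> dk t x z > 0"
    and step: "(t1 - t0) * Qrate p1 p0 \<kappa> dk t0 x0 x0 \<ge> - ln 2"
begin

abbreviation "Q \<equiv> Qrate p1 p0 \<kappa> dk"
abbreviation "QE \<equiv> QEuler p1 p0 \<kappa> dk t0 x0"
abbreviation "qd \<equiv> Qd p1 p0 \<kappa> dk"

lemma ex_other: "\<exists>y. y \<noteq> (v::'s)"
proof (rule ccontr)
  assume "\<not> ?thesis"
  then have "(UNIV::'s set) = {v}" by auto
  then have "CARD('s) = 1" by (metis card_1_singleton_iff One_nat_def)
  then show False using card_s by simp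
qed

lemma Q_upd: "y \<noteq> x d \<Longrightarrow> Q t x (x(d := y)) = qd t x d y"
  unfolding Qrate_def by (auto simp: Qoff_upd dest: fun_upd_idem_iff[THEN iffD1])

lemma qd_pos: "t \<in> {t0..t1} \<Longrightarrow> y \<noteq> x d \<Longrightarrow> 0 < qd t x d y"
  using pos hamming_upd[of y x d] Q_upd[of y x d t] by metis

lemma kappa_le: "t0 \<le> s \<Longrightarrow> s \<le> t \<Longrightarrow> t \<le> t1 \<Longrightarrow> \<kappa> s \<le> \<kappa> t"
  using kappa_mono times by (auto simp: monotone_on_def)

lemma kappa_t: "t \<in> {t0..t1} \<Longrightarrow> \<kappa> t \<in> {0..1}"
  using kappa_range times by auto

text \<open>Division by 0 gives 0, so \<open>\<kappa> t = 1\<close> would annihilate every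
  coordinate rate, against positivity. Since \<open>\<kappa> 1 = 1\<close>, it follows that
  \<open>t1 < 1\<close>, which is the room required by
  \<open>borel_measurable_derivative_within\<close>.\<close>

lemma kappa_less_1: "t \<in> {t0..t1} \<Longrightarrow> \<kappa> t < 1"
proof -
  assume t: "t \<in> {t0..t1}"
  obtain y where "y \<noteq> x0 undefined" using ex_other by blast
  then have "0 < qd t x0 undefined y" by (rule qd_pos[OF t])
  then have "\<kappa> t \<noteq> 1" by (auto simp: Qd_def)
  then show ?thesis using kappa_t[OF t] by simp
qed

lemma t1_less_1: "t1 < 1"
  using kappa_less_1[of t1] kappa1 times by (cases "t1 = 1") auto

text \<open>By the intermediate value theorem \<open>k = \<kappa> t\<close> for some
  \<open>t\<close> in the interval. Zero mass would make the posterior a division by 0, hence 0,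
  against positivity of the rates.\<close>

lemma joint_mass_pos:
  assumes "k \<in> {\<kappa> t0..\<kappa> t1}"
  shows "0 < joint_mass p1 p0 x UNIV k"
proof -
  have "continuous_on {t0..t1} \<kappa>" by (rule continuous_on_subset[OF kappa_cont]) (use times in auto)
  then obtain t where t: "t \<in> {t0..t1}" "\<kappa> t = k"
    using IVT'[of \<kappa> t0 k t1] assms times by auto
  obtain y where "y \<noteq> x undefined" using ex_other by blast
  then have "0 < qd t x undefined y" by (rule qd_pos[OF t(1)])
  then have "joint_mass p1 p0 x UNIV k \<noteq> 0"
    using posterior_eq[where \<kappa>=\<kappa> and t=t, OF kappa_t[OF t(1)], of p1 p0 undefined y x] t(2) by (auto simp: Qd_def)
  moreover have "0 \<le> joint_mass p1 p0 x UNIV k"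
    using kappa_t[OF t(1)] t(2) by (intro joint_mass_nonneg) auto
  ultimately show ?thesis by simp
qed

definition rate_factor :: "('d \<Rightarrow> 's) \<Rightarrow> 'd \<Rightarrow> 's \<Rightarrow> real \<Rightarrow> real" where
  "rate_factor x d y k = joint_mass p1 p0 x {x1. x1 d = y} k / joint_mass p1 p0 x UNIV k / (1 - k)"

lemma qd_factor: "t \<in> {t0..t1} \<Longrightarrow> qd t x d y = rate_factor x d y (\<kappa> t) * dk t"
  using posterior_eq[where \<kappa>=\<kappa> and t=t, OF kappa_t, of p1 p0 d y x] by (simp add: Qd_def rate_factor_def mult.commute)

lemma continuous_rate_factor: "continuous_on {\<kappa> t0..\<kappa> t1} (rate_factor x d y)"
proof -
  have "k \<noteq> 1" "joint_mass p1 p0 x UNIV k \<noteq> 0" if "k \<in> {\<kappa> t0..\<kappa> t1}" for k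
    using that kappa_less_1[of t1] times joint_mass_pos[OF that, of x] by auto
  then show ?thesis
    unfolding rate_factor_def[abs_def]
    by (intro continuous_on_divide continuous_on_joint_mass continuous_intros) auto
qed

text \<open>Change of variables \<open>k = \<kappa> s\<close>: the integrand is continuous in
  \<open>k\<close>, and \<open>dk\<close> enters only through the chain rule.\<close>

definition cum_qd :: "('d \<Rightarrow> 's) \<Rightarrow> 'd \<Rightarrow> 's \<Rightarrow> real \<Rightarrow> real" where
  "cum_qd x d y s = integral {\<kappa> t0..\<kappa> s} (rate_factor x d y)"

lemma cum_qd_deriv:
  assumes s: "s \<in> {t0..t1}"
  shows "(cum_qd x d y has_real_derivative qd s x d y) (at s within {t0..t1})"
proof -
  have im: "\<kappa> ` {t0..t1} \<subseteq> {\<kappa> t0..\<kappa> t1}" using kappa_le by auto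
  have "((\<lambda>k. integral {\<kappa> t0..k} (rate_factor x d y)) has_real_derivative rate_factor x d y (\<kappa> s)) (at (\<kappa> s) within {\<kappa> t0..\<kappa> t1})"
    by (rule integral_has_real_derivative[OF continuous_rate_factor]) (use kappa_le s in auto)
  then have 1: "((\<lambda>k. integral {\<kappa> t0..k} (rate_factor x d y)) has_real_derivative rate_factor x d y (\<kappa> s)) (at (\<kappa> s) within \<kappa> ` {t0..t1})"
    by (rule has_field_derivative_subset[OF _ im])
  have 2: "(\<kappa> has_real_derivative dk s) (at s within {t0..t1})"
    by (rule has_field_derivative_subset[of _ _ _ "{0..1}"]) (use kappa_deriv s times in auto)
  from DERIV_image_chain[OF 1 2] show ?thesis
    unfolding cum_qd_def[abs_def] by (simp add: o_def qd_factor[OF s])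
qed

lemma qd_measurable [measurable]: "(\<lambda>s. indicator {t0..t1} s * qd s x d y) \<in> borel_measurable borel"
proof -
  have 1 [measurable]: "(\<lambda>s. indicator {t0..t1} s * dk s) \<in> borel_measurable borel"
    by (rule borel_measurable_derivative_within[OF kappa_cont])
       (use times t1_less_1 kappa_deriv in auto)
  have "continuous_on {t0..t1} (\<lambda>s. rate_factor x d y (\<kappa> s))"
    by (rule continuous_on_compose2[OF continuous_rate_factor continuous_on_subset[OF kappa_cont]])
       (use times kappa_le in auto)
  then have 2 [measurable]: "(\<lambda>s. indicator {t0..t1} s *\<^sub>R rate_factor x d y (\<kappa> s)) \<in> borel_measurable borel"
    by (intro borel_measurable_continuous_on_indicator) auto
  have "(\<lambda>s. (indicator {t0..t1} s * dk s) * (indicator {t0..t1} s *\<^sub>R rate_factor x d y (\<kappa> s))) \<in> borel_measurable borel"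
    by measurable
  also have "(\<lambda>s. (indicator {t0..t1} s * dk s) * (indicator {t0..t1} s *\<^sub>R rate_factor x d y (\<kappa> s))) =
      (\<lambda>s. indicator {t0..t1} s * qd s x d y)"
    by (auto simp: fun_eq_iff indicator_def qd_factor)
  finally show ?thesis .
qed

definition cum_Q :: "('d \<Rightarrow> 's) \<Rightarrow> ('d \<Rightarrow> 's) \<Rightarrow> real \<Rightarrow> real" where
  "cum_Q x z s = (\<Sum>d\<in>UNIV. if (\<forall>e. e \<noteq> d \<longrightarrow> z e = x e) then cum_qd x d (z d) s else 0)"

lemma near_cases:
  assumes "(x::'d \<Rightarrow> 's) \<noteq> z"
  obtains d y where "y \<noteq> x d" "z = x(d := y)" | "\<And>d. z \<noteq> x(d := z d)"
proof (cases "\<exists>d. z = x(d := z d)")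
  case True
  then obtain d where d: "z = x(d := z d)" by blast
  moreover have "z d \<noteq> x d" using d assms by auto
  ultimately show ?thesis using that(1) by blast
qed (use that(2) in blast)

lemma Q_far: "x \<noteq> z \<Longrightarrow> (\<And>d. z \<noteq> x(d := z d)) \<Longrightarrow> Q t x z = 0"
  by (simp add: Qrate_def Qoff_far)

lemma QE_far: "x \<noteq> z \<Longrightarrow> (\<And>d. z \<noteq> x(d := z d)) \<Longrightarrow> QE x z = 0"
  by (simp add: QEuler_def QEoff_far)

lemma QE_upd: "y \<noteq> x d \<Longrightarrow> QE x (x(d := y)) = (if x d = x0 d then qd t0 x0 d y else 0)"
  unfolding QEuler_def using QEoff_upd[of y x d p1 p0 \<kappa> dk t0 x0] by (auto dest: fun_upd_idem_iff[THEN iffD1])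

lemma Q_nonneg: "s \<in> {t0..t1} \<Longrightarrow> x \<noteq> z \<Longrightarrow> 0 \<le> Q s x z"
  by (rule near_cases[of x z]) (auto simp: Q_far Q_upd qd_pos less_imp_le)

lemma QE_nonneg: "x \<noteq> z \<Longrightarrow> 0 \<le> QE x z"
  by (rule near_cases[of x z]) (use times in \<open>auto simp: QE_far QE_upd qd_pos less_imp_le\<close>)

text \<open>The Euler rates are constant in time, hence the linear antiderivative. Domination holds
  because the oracle rate is positive at Hamming distance 1 and both rates vanish at larger
  distance.\<close>

sublocale pair: jump_rates_pair Q "\<lambda>_. QE" cum_Q "\<lambda>x z s. s * QE x z" t0 t1
proof
  show "t0 < t1" by (rule times)
  fix s :: real and x z :: "'d \<Rightarrow> 's" assume s: "s \<in> {t0..t1}" and xz: "x \<noteq> z"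
  show "0 \<le> Q s x z" by (rule Q_nonneg[OF s xz])
  show "0 \<le> QE x z" by (rule QE_nonneg[OF xz])
  show "(cum_Q x z has_real_derivative Q s x z) (at s within {t0..t1})"
  proof -
    have "Q s x z = (\<Sum>d\<in>UNIV. if (\<forall>e. e \<noteq> d \<longrightarrow> z e = x e) then qd s x d (z d) else 0)"
      using xz by (simp add: Qrate_def Qoff_def)
    moreover have "((\<lambda>s. if c then cum_qd x d (z d) s else 0) has_real_derivative
        (if c then qd s x d (z d) else 0)) (at s within {t0..t1})" for c d
      using cum_qd_deriv[OF s] by simp
    ultimately show ?thesis
      unfolding cum_Q_def[abs_def] by (simp only:) (rule DERIV_sum)
  qed
  show "((\<lambda>s. s * QE x z) has_real_derivative QE x z) (at s within {t0..t1})"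
    by (auto intro!: derivative_eq_intros)
  show "QE x z = 0" if "Q s x z = 0"
  proof (rule near_cases[OF xz])
    fix d y assume "y \<noteq> x d" "z = x(d := y)"
    then show ?thesis using that qd_pos[OF s, of y x d] by (simp add: Q_upd)
  qed (simp add: QE_far[OF xz])
next
  fix x z :: "'d \<Rightarrow> 's" assume xz: "x \<noteq> z"
  have "(\<lambda>s. \<Sum>d\<in>UNIV. if (\<forall>e. e \<noteq> d \<longrightarrow> z e = x e) then indicator {t0..t1} s * qd s x d (z d) else 0) \<in> borel_measurable borel"
    by measurable
  also have "(\<lambda>s. \<Sum>d\<in>UNIV. if (\<forall>e. e \<noteq> d \<longrightarrow> z e = x e) then indicator {t0..t1} s * qd s x d (z d) else 0)
     = (\<lambda>s. indicator {t0..t1} s * Q s x z)"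
  proof
    fix s
    show "(\<Sum>d\<in>UNIV. if (\<forall>e. e \<noteq> d \<longrightarrow> z e = x e) then indicator {t0..t1} s * qd s x d (z d) else 0)
       = indicator {t0..t1} s * Q s x z"
      using xz by (cases "s \<in> {t0..t1}") (simp_all add: Qrate_def Qoff_def cong: if_cong)
  qed
  finally show "(\<lambda>s. indicator {t0..t1} s * Q s x z) \<in> borel_measurable borel" .
  show "(\<lambda>s. indicator {t0..t1} s * QE x z) \<in> borel_measurable borel" by measurable
qed

end

section \<open>Lower bounds for the two costs\<close>

text \<open>If \<open>f\<close> has no gauge integral, \<open>integral\<close> is 0 and the
  inequality persists; the infimum \<open>L\<close> can therefore be used without deciding whether
  the cost is integrable.\<close>

lemma ennreal_integral_le_nn_integral:
  fixes f :: "real \<Rightarrow> real"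
  assumes "\<And>s. s \<in> S \<Longrightarrow> 0 \<le> f s"
  shows "ennreal (integral S f) \<le> (\<integral>\<^sup>+s. ennreal (f s) * indicator S s \<partial>lborel)"
proof (cases "f integrable_on S")
  case True
  then have "(f has_integral integral S f) S" by (rule integrable_integral)
  from nn_integral_has_integral_lebesgue'[OF assms this] show ?thesis by simp
qed (simp add: not_integrable_integral)

lemma card_neighbours:
  fixes x :: "'d::finite \<Rightarrow> 's::finite"
  shows "real (card {z. hamming x z = 1}) = real CARD('d) * (real CARD('s) - 1)"
proof -
  have "real (card {z. hamming x z = 1}) = (\<Sum>z\<in>{z. z \<noteq> x}. of_bool (hamming x z = 1))"
  proof -
    have "{z. z \<noteq> x} \<inter> {z. hamming x z = 1} = {z. hamming x z = 1}"
      by (auto simp: hamming_def)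
    then show ?thesis by simp
  qed
  also have "\<dots> = (\<Sum>d\<in>UNIV. \<Sum>y\<in>-{x d}. of_bool (hamming x (x(d := y)) = 1))"
  proof (rule sum_neighbours)
    fix z assume "\<And>d. z \<noteq> x(d := z d)"
    then have "hamming x z \<noteq> 1" unfolding hamming_eq_1_iff by blast
    then show "of_bool (hamming x z = 1) = (0::real)" by simp
  qed
  also have "\<dots> = (\<Sum>d\<in>(UNIV :: 'd set). \<Sum>y\<in>-{x d}. 1)"
    by (intro sum.cong) (auto simp: hamming_upd)
  also have "\<dots> = real CARD('d) * (real CARD('s) - 1)"
  proof -
    have "real (card (- {v :: 's})) = real CARD('s) - 1" for v
      by (simp add: Compl_eq_Diff_UNIV card_Diff_singleton of_nat_diff Suc_leI)
    then show ?thesis by simp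
  qed
  finally show ?thesis .
qed

context euler_step begin

text \<open>The exit rate from \<open>x\<close>. The Euler hazard is \<open>lam x\<close> times the
  elapsed time.\<close>

definition lam :: "('d \<Rightarrow> 's) \<Rightarrow> real" where
  "lam x = (\<Sum>z\<in>{z. z \<noteq> x}. QE x z)"

definition L :: real where
  "L = Inf {integral {t0..t1} (\<lambda>s. 1 / (t1 - t0) * DF (Q t0 x z) (Q s x z)) | x z. hamming x z = 1}"

definition eta :: real where
  "eta = Inf {qd t0 x0 d (x d) * DF (qd t0 x0 d' y) (qd s x d' y)
     | d d' y x s. d' \<noteq> d \<and> y \<noteq> x d' \<and> x d \<noteq> x0 d \<and> hamming x x0 = 1 \<and> s \<in> {t0..t1}}"

lemma sum_ne_UNIV: "(\<Sum>z\<in>UNIV. if z = x then 0 else f z) = (\<Sum>z\<in>{z. z \<noteq> x}. f z :: real)" for x :: "'d \<Rightarrow> 's"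
  by (rule sum.mono_neutral_cong_right) auto

lemma Haz_E: "T \<in> {t0..t1} \<Longrightarrow> s \<in> {t0..t1} \<Longrightarrow> pair.E.Haz x T s = (s - T) * lam x"
  unfolding pair.E.Haz_def pair.E.haz_def lam_def sum_ne_UNIV sum_distrib_left
  by (intro sum.cong) (auto simp: algebra_simps)

lemma lam_sum: "lam x = (\<Sum>d\<in>UNIV. \<Sum>y\<in>-{x d}. if x d = x0 d then qd t0 x0 d y else 0)"
  unfolding lam_def by (subst sum_neighbours) (auto simp: QE_far QE_upd intro!: sum.cong)

lemma lam_start: "lam x0 = - Q t0 x0 x0"
  unfolding lam_def Qrate_def QEuler_def by (auto simp: QEoff_start intro!: sum.cong)

text \<open>In state \<open>x\<close> only coordinates that still agree with \<open>x0\<close> can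
  move, each at its initial rate; so no state is left faster than \<open>x0\<close>.\<close>

lemma lam_le: "lam x \<le> lam x0"
  unfolding lam_sum
proof (rule sum_mono)
  fix d
  have "0 \<le> qd t0 x0 d y" if "y \<in> -{x0 d}" for y
    using qd_pos[of t0 y x0 d] that times by (simp add: less_imp_le)
  then show "(\<Sum>y\<in>-{x d}. if x d = x0 d then qd t0 x0 d y else 0) \<le> (\<Sum>y\<in>-{x0 d}. if x0 d = x0 d then qd t0 x0 d y else 0)"
    by (cases "x d = x0 d") (auto intro!: sum_nonneg)
qed

text \<open>The product is the survival in \<open>x0\<close> until \<open>u\<close> times the
  survival in \<open>x\<close> from \<open>u\<close> until \<open>s\<close>. As
  \<open>lam x \<le> lam x0\<close>, the total exponent is at most
  \<open>(t1 - t0) * lam x0\<close>, and this is at most \<open>ln 2\<close> by the step size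
  condition. The case \<open>u = t0\<close> serves the time before the first jump.\<close>

lemma survival_ge_half:
  assumes "t0 \<le> u" "u \<le> s" "s \<le> t1"
  shows "1 / 2 \<le> exp (- pair.E.Haz x0 t0 u) * exp (- pair.E.Haz x u s)"
proof -
  have l0: "0 \<le> lam x0" unfolding lam_def by (intro sum_nonneg QE_nonneg) auto
  have "(s - u) * lam x \<le> (s - u) * lam x0" using assms lam_le by (intro mult_left_mono) auto
  then have "(u - t0) * lam x0 + (s - u) * lam x \<le> (s - t0) * lam x0" by (simp add: algebra_simps)
  also have "\<dots> \<le> (t1 - t0) * lam x0" using assms l0 by (intro mult_right_mono) auto
  also have "\<dots> \<le> ln 2" using step by (simp add: lam_start)
  finally have "exp (- ln 2) \<le> exp (- ((u - t0) * lam x0 + (s - u) * lam x))" by simp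
  then have "1 / 2 \<le> exp (- ((u - t0) * lam x0)) * exp (- ((s - u) * lam x))"
    by (simp add: exp_add[symmetric] exp_minus[of "ln 2"])
  then show ?thesis using assms by (simp add: Haz_E)
qed

lemma DFS_eq:
  assumes "s \<in> {t0..t1}"
  shows "pair.DFS x s = (\<Sum>d\<in>UNIV. \<Sum>y\<in>-{x d}. DF (QE x (x(d := y))) (Q s x (x(d := y))))"
proof -
  have "pair.DFS x s = (\<Sum>z\<in>UNIV. if z = x then 0 else DF (QE x z) (Q s x z))"
    using assms unfolding pair.DFS_def pair.E.r_def pair.P.r_def by (intro sum.cong) auto
  also have "\<dots> = (\<Sum>d\<in>UNIV. \<Sum>y\<in>-{x d}. DF (QE x (x(d := y))) (Q s x (x(d := y))))"
    unfolding sum_ne_UNIV by (rule sum_neighbours) (simp add: QE_far Q_far)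
  finally show ?thesis .
qed

lemma DF_Q_nonneg: "s \<in> {t0..t1} \<Longrightarrow> hamming x z = 1 \<Longrightarrow> 0 \<le> DF (Q t0 x z) (Q s x z)"
  using pos[rule_format, of t0 x z] pos[rule_format, of s x z] times by (intro DF_nonneg) auto

lemma L_elem_nonneg: "hamming x z = 1 \<Longrightarrow> 0 \<le> integral {t0..t1} (\<lambda>s. 1 / (t1 - t0) * DF (Q t0 x z) (Q s x z))"
proof (cases "(\<lambda>s. 1 / (t1 - t0) * DF (Q t0 x z) (Q s x z)) integrable_on {t0..t1}")
  case True
  assume "hamming x z = 1"
  then have "0 \<le> 1 / (t1 - t0) * DF (Q t0 x z) (Q s x z)" if "s \<in> {t0..t1}" for s
    using DF_Q_nonneg[OF that] times by simp
  then show ?thesis by (rule integral_nonneg[OF True])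
next
  case False
  show ?thesis unfolding not_integrable_integral[OF False] by simp
qed

lemma L_le: "hamming x z = 1 \<Longrightarrow> L \<le> integral {t0..t1} (\<lambda>s. 1 / (t1 - t0) * DF (Q t0 x z) (Q s x z))"
  unfolding L_def by (rule cInf_lower) (use L_elem_nonneg in \<open>auto intro!: bdd_belowI[of _ 0]\<close>)

lemma L_nonneg: "0 \<le> L"
proof -
  obtain y where "y \<noteq> x0 undefined" using ex_other by blast
  then have "hamming x0 (x0(undefined := y)) = 1" by (rule hamming_upd)
  then show ?thesis unfolding L_def by (intro cInf_greatest) (use L_elem_nonneg in auto)
qed

lemma eta_elem_nonneg:
  assumes "d' \<noteq> d" "y \<noteq> x d'" "x d \<noteq> x0 d" "hamming x x0 = 1" "s \<in> {t0..t1}"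
  shows "0 \<le> qd t0 x0 d (x d) * DF (qd t0 x0 d' y) (qd s x d' y)"
proof -
  \<comment> \<open>\<open>x\<close> and \<open>x0\<close> differ in a single coordinate, which must
    be \<open>d\<close>. Hence \<open>x0 d' = x d'\<close>, and \<open>y\<close> is a genuine jump
    target from \<open>x0\<close> too.\<close>
  obtain e where e: "x0 = x(e := x0 e)" using assms(4) unfolding hamming_eq_1_iff by blast
  have ed: "e = d"
  proof (rule ccontr)
    assume "e \<noteq> d"
    then show False using fun_cong[OF e, of d] assms(3) by simp
  qed
  have "x0 d' = x d'" using fun_cong[OF e, of d'] assms(1) ed by simp
  then have "0 < qd t0 x0 d' y" using qd_pos[of t0 y x0 d'] times assms(2) by simp
  moreover have "0 < qd s x d' y" using assms(2,5) by (intro qd_pos)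
  moreover have "0 < qd t0 x0 d (x d)" using qd_pos[of t0 "x d" x0 d] times assms(3) by simp
  ultimately show ?thesis by (intro mult_nonneg_nonneg DF_nonneg) auto
qed

lemma eta_set_nonneg:
  assumes "w \<in> {qd t0 x0 d (x d) * DF (qd t0 x0 d' y) (qd s x d' y)
     | d d' y x s. d' \<noteq> d \<and> y \<noteq> x d' \<and> x d \<noteq> x0 d \<and> hamming x x0 = 1 \<and> s \<in> {t0..t1}}"
  shows "0 \<le> w"
proof -
  obtain d d' y x s where "w = qd t0 x0 d (x d) * DF (qd t0 x0 d' y) (qd s x d' y)"
    and "d' \<noteq> d" "y \<noteq> x d'" "x d \<noteq> x0 d" "hamming x x0 = 1" "s \<in> {t0..t1}"
    using assms by blast
  then show ?thesis using eta_elem_nonneg[of d' d y x s] by simp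
qed

lemma eta_le:
  assumes "d' \<noteq> d" "y \<noteq> x d'" "x d \<noteq> x0 d" "hamming x x0 = 1" "s \<in> {t0..t1}"
  shows "eta \<le> qd t0 x0 d (x d) * DF (qd t0 x0 d' y) (qd s x d' y)"
  unfolding eta_def
proof (rule cInf_lower)
  show "qd t0 x0 d (x d) * DF (qd t0 x0 d' y) (qd s x d' y) \<in> {qd t0 x0 d (x d) * DF (qd t0 x0 d' y) (qd s x d' y)
     | d d' y x s. d' \<noteq> d \<and> y \<noteq> x d' \<and> x d \<noteq> x0 d \<and> hamming x x0 = 1 \<and> s \<in> {t0..t1}}"
    using assms by blast
qed (rule bdd_belowI[OF eta_set_nonneg])

lemma ex_other_coordinate: "\<exists>d'. d' \<noteq> (d::'d)"
proof (rule ccontr)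
  assume "\<not> ?thesis"
  then have "(UNIV::'d set) = {d}" by auto
  then have "CARD('d) = 1" by (metis card_1_singleton_iff One_nat_def)
  then show False using card_d by simp
qed

lemma eta_nonneg: "0 \<le> eta"
  unfolding eta_def
proof (rule cInf_greatest)
  \<comment> \<open>The infimum of an empty set of reals carries no information, so a member is
    exhibited: one coordinate of \<open>x0\<close> is changed, and a different one, available by
    \<open>card_d\<close>, is to jump next.\<close>
  obtain d d' :: 'd where d: "d' \<noteq> d" using ex_other_coordinate by blast
  obtain v where v: "v \<noteq> x0 d" using ex_other by blast
  obtain y where y: "y \<noteq> x0 d'" using ex_other by blast
  let ?x = "x0(d := v)"
  have "d' \<noteq> d \<and> y \<noteq> ?x d' \<and> ?x d \<noteq> x0 d \<and> hamming ?x x0 = 1 \<and> t0 \<in> {t0..t1}"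
    using d v y times hamming_upd'[of v x0 d, OF v] by auto
  then show "{qd t0 x0 d (x d) * DF (qd t0 x0 d' y) (qd s x d' y)
     | d d' y x s. d' \<noteq> d \<and> y \<noteq> x d' \<and> x d \<noteq> x0 d \<and> hamming x x0 = 1 \<and> s \<in> {t0..t1}} \<noteq> {}"
    by blast
qed (rule eta_set_nonneg)

lemma sum_le_sum_subset_ennreal: "(\<Sum>z\<in>A. f z) \<le> (\<Sum>z\<in>UNIV. f z)" for f :: "('d \<Rightarrow> 's) \<Rightarrow> ennreal"
  by (rule sum_mono2) auto

text \<open>At \<open>x0\<close> the Euler rates coincide with the oracle rates at
  \<open>t0\<close>, so \<open>DFS x0 s\<close> sums over the neighbours exactly the costs whose
  time average is bounded below by \<open>L\<close>. Survival contributes 1/2, and the factor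
  \<open>t1 - t0\<close> undoes the average.\<close>

lemma first_cost:
  "ennreal (1 / 4 * (t1 - t0) * real CARD('d) * real CARD('s) * L) \<le> pair.step_cost (t0, x0)"
proof -
  let ?N = "{z. hamming x0 z = 1}" and ?\<tau> = "t1 - t0"
  have \<tau>: "0 < ?\<tau>" using times by simp
  define f where "f z s = 1 / ?\<tau> * DF (pair.E.r x0 z s) (pair.P.r x0 z s)" for z s
  have fm [measurable]: "f z \<in> borel_measurable borel" for z unfolding f_def DF_def by measurable
  have f0: "0 \<le> f z s" for z s unfolding f_def using pair.DF_r_nonneg \<tau> by simp
  have Lf: "ennreal L \<le> (\<integral>\<^sup>+s. ennreal (f z s) * indicator {t0..t1} s \<partial>lborel)" if z: "z \<in> ?N" for z
  proof -
    have ne: "z \<noteq> x0" using z by (auto simp: hamming_def)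
    have QE0: "QE x0 z = Q t0 x0 z" using ne by (simp add: QEuler_def Qrate_def QEoff_start)
    have "ennreal L \<le> ennreal (integral {t0..t1} (\<lambda>s. 1 / ?\<tau> * DF (Q t0 x0 z) (Q s x0 z)))"
      using L_le[of x0 z] z by (intro ennreal_leI) simp
    also have "integral {t0..t1} (\<lambda>s. 1 / ?\<tau> * DF (Q t0 x0 z) (Q s x0 z)) = integral {t0..t1} (f z)"
      using ne by (intro integral_cong) (simp add: f_def pair.E.r_def pair.P.r_def QE0)
    also have "ennreal \<dots> \<le> (\<integral>\<^sup>+s. ennreal (f z s) * indicator {t0..t1} s \<partial>lborel)"
      by (rule ennreal_integral_le_nn_integral) (rule f0)
    finally show ?thesis .
  qed
  \<comment> \<open>The number of neighbours contains \<open>CARD('s) - 1\<close>, which is at least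
    half of \<open>CARD('s)\<close>; with the 1/2 from survival this gives 1/4.\<close>
  have "1 / 4 * ?\<tau> * real CARD('d) * real CARD('s) * L \<le> real (card ?N) * (?\<tau> / 2 * L)"
  proof -
    have "real CARD('s) / 2 \<le> real CARD('s) - 1" using card_s by simp
    then have "real CARD('s) / 2 * (real CARD('d) * (?\<tau> / 2 * L)) \<le> (real CARD('s) - 1) * (real CARD('d) * (?\<tau> / 2 * L))"
      using L_nonneg \<tau> by (intro mult_right_mono) auto
    then show ?thesis unfolding card_neighbours by (simp add: field_simps)
  qed
  then have "ennreal (1 / 4 * ?\<tau> * real CARD('d) * real CARD('s) * L) \<le> ennreal (real (card ?N) * (?\<tau> / 2 * L))"
    by (rule ennreal_leI)
  also have "\<dots> = (\<Sum>z\<in>?N. ennreal (?\<tau> / 2) * ennreal L)"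
    using \<tau> L_nonneg by (simp add: ennreal_mult[symmetric] ennreal_of_nat_eq_real_of_nat)
  also have "\<dots> \<le> (\<Sum>z\<in>?N. ennreal (?\<tau> / 2) * (\<integral>\<^sup>+s. ennreal (f z s) * indicator {t0..t1} s \<partial>lborel))"
    by (intro sum_mono mult_left_mono Lf) auto
  also have "\<dots> \<le> (\<Sum>z\<in>UNIV. ennreal (?\<tau> / 2) * (\<integral>\<^sup>+s. ennreal (f z s) * indicator {t0..t1} s \<partial>lborel))"
    by (rule sum_le_sum_subset_ennreal)
  also have "\<dots> = (\<integral>\<^sup>+s. (\<Sum>z\<in>UNIV. ennreal (?\<tau> / 2) * (ennreal (f z s) * indicator {t0..t1} s)) \<partial>lborel)"
    by (subst nn_integral_sum) (auto simp: nn_integral_cmult)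
  also have "\<dots> \<le> pair.step_cost (t0, x0)"
    unfolding pair.step_cost_def fst_conv snd_conv
  proof (rule nn_integral_mono)
    fix s
    show "(\<Sum>z\<in>UNIV. ennreal (?\<tau> / 2) * (ennreal (f z s) * indicator {t0..t1} s))
       \<le> ennreal (indicator {t0..t1} s * exp (- pair.E.Haz x0 t0 s) * pair.DFS x0 s)"
    proof (cases "s \<in> {t0..t1}")
      case True
      have "(\<Sum>z\<in>UNIV. ennreal (?\<tau> / 2) * (ennreal (f z s) * indicator {t0..t1} s)) = ennreal (\<Sum>z\<in>UNIV. ?\<tau> / 2 * f z s)"
        using True \<tau> f0 by (simp add: ennreal_mult[symmetric] sum_ennreal)
      also have "(\<Sum>z\<in>UNIV. ?\<tau> / 2 * f z s) = 1 / 2 * pair.DFS x0 s"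
      proof -
        have "?\<tau> / 2 * (1 / ?\<tau> * w) = 1 / 2 * w" for w using \<tau> by (simp add: divide_simps)
        then show ?thesis by (simp only: f_def pair.DFS_def sum_distrib_left)
      qed
      also have "ennreal \<dots> \<le> ennreal (exp (- pair.E.Haz x0 t0 s) * pair.DFS x0 s)"
        using survival_ge_half[of t0 s x0] True pair.DFS_nonneg
        by (intro ennreal_leI mult_right_mono) auto
      finally show ?thesis using True by simp
    qed simp
  qed
  finally show ?thesis .
qed

text \<open>After the jump in coordinate \<open>d\<close> all other coordinates keep their frozen
  rates from \<open>x0\<close>, so the cost of each of their moves, multiplied by the rate of the
  first jump, is a member of the set defining \<open>eta\<close>. Moves of \<open>d\<close> itself
  now have Euler rate 0 and a non-negative cost; they are dropped.\<close>

lemma rate_DFS_ge: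
  assumes v: "v \<noteq> x0 d" and s: "s \<in> {t0..t1}"
  shows "(real CARD('d) - 1) * (real CARD('s) - 1) * eta \<le> qd t0 x0 d v * pair.DFS (x0(d := v)) s"
proof -
  let ?x = "x0(d := v)" and ?q = "qd t0 x0 d v"
  have q: "0 < ?q" using qd_pos[of t0 v x0 d] v times by simp
  have card1: "real (card (- {w :: 'a :: finite})) = real CARD('a) - 1" for w
    by (simp add: Compl_eq_Diff_UNIV card_Diff_singleton of_nat_diff Suc_leI)
  have "(real CARD('d) - 1) * (real CARD('s) - 1) * eta = (\<Sum>e\<in>-{d}. \<Sum>y\<in>-{?x e}. eta)"
    by (simp add: card1)
  also have "\<dots> \<le> (\<Sum>e\<in>-{d}. \<Sum>y\<in>-{?x e}. ?q * DF (QE ?x (?x(e := y))) (Q s ?x (?x(e := y))))"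
  proof (intro sum_mono)
    fix e y assume e: "e \<in> -{d}" and y: "y \<in> -{?x e}"
    have "eta \<le> qd t0 x0 d (?x d) * DF (qd t0 x0 e y) (qd s ?x e y)"
      by (rule eta_le[of e d y ?x s]) (use e y v s hamming_upd'[of v x0 d, OF v] in auto)
    moreover have "QE ?x (?x(e := y)) = qd t0 x0 e y" using QE_upd[of y ?x e] e y by simp
    moreover have "Q s ?x (?x(e := y)) = qd s ?x e y" using y by (intro Q_upd) simp
    ultimately show "eta \<le> ?q * DF (QE ?x (?x(e := y))) (Q s ?x (?x(e := y)))" by simp
  qed
  also have "\<dots> \<le> (\<Sum>e\<in>UNIV. \<Sum>y\<in>-{?x e}. ?q * DF (QE ?x (?x(e := y))) (Q s ?x (?x(e := y))))"
  proof (rule sum_mono2)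
    fix e
    have "0 \<le> DF (QE ?x (?x(e := y))) (Q s ?x (?x(e := y)))" if "y \<noteq> ?x e" for y
    proof -
      have "?x \<noteq> ?x(e := y)" using that by (metis fun_upd_same)
      then show ?thesis
        using pair.DF_r_nonneg[of ?x "?x(e := y)" s] s by (simp add: pair.E.r_def pair.P.r_def)
    qed
    then show "0 \<le> (\<Sum>y\<in>-{?x e}. ?q * DF (QE ?x (?x(e := y))) (Q s ?x (?x(e := y))))"
      using q by (intro sum_nonneg mult_nonneg_nonneg) auto
  qed auto
  also have "\<dots> = ?q * pair.DFS ?x s"
    unfolding DFS_eq[OF s] sum_distrib_left ..
  finally show ?thesis .
qed

text \<open>For a fixed first target \<open>z\<close>, the density of a jump at \<open>u\<close>,
  the survival in \<open>z\<close> until \<open>s\<close> and the cost rate at \<open>s\<close>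
  multiply to at least \<open>m\<close>. Integration over the triangle
  \<open>t0 \<le> u \<le> s \<le> t1\<close> then gives \<open>m * (t1 - t0)\<^sup>2 / 2\<close> per
  target.\<close>

lemma second_cost:
  "ennreal (1 / 32 * (real CARD('d))\<^sup>2 * (real CARD('s))\<^sup>2 * (t1 - t0)\<^sup>2 * eta) \<le>
    (\<Sum>z\<in>UNIV. \<integral>\<^sup>+u. pair.step_cost (u, z) * ennreal (indicator {t0..t1} u * pair.E.r x0 z u * exp (- pair.E.Haz x0 t0 u)) \<partial>lborel)"
proof -
  let ?N = "{z. hamming x0 z = 1}" and ?D = "real CARD('d)" and ?S = "real CARD('s)" and ?\<tau> = "t1 - t0"
  define m where "m = 1 / 2 * ((?D - 1) * (?S - 1) * eta)"
  have m0: "0 \<le> m" using card_d card_s eta_nonneg by (simp add: m_def)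
  have I: "ennreal (m * ?\<tau>\<^sup>2 / 2) \<le>
      (\<integral>\<^sup>+u. pair.step_cost (u, z) * ennreal (indicator {t0..t1} u * pair.E.r x0 z u * exp (- pair.E.Haz x0 t0 u)) \<partial>lborel)"
    if z: "z \<in> ?N" for z
  proof -
    obtain d v where v: "v \<noteq> x0 d" and zd: "z = x0(d := v)"
      using z unfolding mem_Collect_eq hamming_eq_1_iff by blast
    have ne: "z \<noteq> x0" using v zd by (metis fun_upd_same)
    \<comment> \<open>The outer integral over the triangle: \<open>t1 - u\<close> is the time left
      after a first jump at \<open>u\<close>.\<close>
    have "((\<lambda>u. - (m * (t1 - u)\<^sup>2 / 2)) has_real_derivative m * (t1 - u)) (at u within {t0..t1})" for u
      by (auto intro!: derivative_eq_intros simp: field_simps)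
    from has_integral_deriv_within[OF this, of t0 t1]
    have "((\<lambda>u. m * (t1 - u)) has_integral (m * ?\<tau>\<^sup>2 / 2)) {t0..t1}" using times by simp
    then have "ennreal (m * ?\<tau>\<^sup>2 / 2) = (\<integral>\<^sup>+u. ennreal (m * (t1 - u)) * indicator {t0..t1} u \<partial>lborel)"
      by (intro nn_integral_has_integral_lebesgue'[symmetric]) (use m0 in auto)
    also have "\<dots> \<le> (\<integral>\<^sup>+u. pair.step_cost (u, z) * ennreal (indicator {t0..t1} u * pair.E.r x0 z u * exp (- pair.E.Haz x0 t0 u)) \<partial>lborel)"
    proof (rule nn_integral_mono)
      fix u
      show "ennreal (m * (t1 - u)) * indicator {t0..t1} u
        \<le> pair.step_cost (u, z) * ennreal (indicator {t0..t1} u * pair.E.r x0 z u * exp (- pair.E.Haz x0 t0 u))"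
      proof (cases "u \<in> {t0..t1}")
        case u: True
        define q where "q = qd t0 x0 d v"
        have q0: "0 < q" using qd_pos[of t0 v x0 d] v times by (simp add: q_def)
        have r: "pair.E.r x0 z u = q"
          using ne u zd QE_upd[of v x0 d, OF v] by (simp add: pair.E.r_def q_def)
        define c where "c = q * exp (- pair.E.Haz x0 t0 u)"
        have c0: "0 \<le> c" using q0 by (simp add: c_def)
        have "ennreal (m * (t1 - u)) = ennreal m * emeasure lborel {u..t1}"
          using u m0 by (simp add: ennreal_mult)
        also have "\<dots> = (\<integral>\<^sup>+s. ennreal m * indicator {u..t1} s \<partial>lborel)"
          by (simp add: nn_integral_cmult_indicator)
        also have "\<dots> \<le> (\<integral>\<^sup>+s. ennreal (indicator {u..t1} s * exp (- pair.E.Haz z u s) * pair.DFS z s) * ennreal c \<partial>lborel)"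
        proof (rule nn_integral_mono)
          fix s
          show "ennreal m * indicator {u..t1} s \<le> ennreal (indicator {u..t1} s * exp (- pair.E.Haz z u s) * pair.DFS z s) * ennreal c"
          proof (cases "s \<in> {u..t1}")
            case s: True
            \<comment> \<open>The rate \<open>q\<close> is taken out of the jump density and
              attached to the cost, because \<open>eta\<close> controls only their product.\<close>
            have "m \<le> (exp (- pair.E.Haz x0 t0 u) * exp (- pair.E.Haz z u s)) * (q * pair.DFS z s)"
              unfolding m_def
            proof (rule mult_mono)
              show "1 / 2 \<le> exp (- pair.E.Haz x0 t0 u) * exp (- pair.E.Haz z u s)"
                using u s by (intro survival_ge_half) auto
              show "(?D - 1) * (?S - 1) * eta \<le> q * pair.DFS z s"
                unfolding q_def zd using u s by (intro rate_DFS_ge[OF v]) auto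
            qed (use card_d card_s eta_nonneg in auto)
            then show ?thesis
              using s c0 pair.DFS_nonneg[of z s] by (simp add: c_def ennreal_mult[symmetric] ennreal_leI mult_ac)
          qed simp
        qed
        also have "\<dots> = pair.step_cost (u, z) * ennreal c"
          unfolding pair.step_cost_def fst_conv snd_conv by (rule nn_integral_multc) measurable
        finally show ?thesis using u by (simp add: r c_def)
      qed simp
    qed
    finally show ?thesis .
  qed
  \<comment> \<open>A factor 1/4 comes from \<open>m\<close> and the triangle. Of the counting
    factors \<open>?D * (?S - 1)\<close> and \<open>(?D - 1) * (?S - 1)\<close>, the three with a
    subtraction are each halved.\<close>
  have "1 / 32 * ?D\<^sup>2 * ?S\<^sup>2 * ?\<tau>\<^sup>2 * eta \<le> real (card ?N) * (m * ?\<tau>\<^sup>2 / 2)"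
  proof -
    have S: "?S / 2 \<le> ?S - 1" and D: "?D / 2 \<le> ?D - 1" using card_s card_d by simp_all
    have "?S / 2 * (?S / 2) * (?D / 2) \<le> (?S - 1) * (?S - 1) * (?D - 1)"
      using card_s card_d by (intro mult_mono S D) auto
    then have "(?S / 2 * (?S / 2) * (?D / 2)) * (?D * eta * ?\<tau>\<^sup>2 / 4) \<le> ((?S - 1) * (?S - 1) * (?D - 1)) * (?D * eta * ?\<tau>\<^sup>2 / 4)"
      using eta_nonneg by (intro mult_right_mono) auto
    then show ?thesis unfolding card_neighbours m_def by (simp add: power2_eq_square mult_ac)
  qed
  then have "ennreal (1 / 32 * ?D\<^sup>2 * ?S\<^sup>2 * ?\<tau>\<^sup>2 * eta) \<le> ennreal (real (card ?N) * (m * ?\<tau>\<^sup>2 / 2))"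
    by (rule ennreal_leI)
  also have "\<dots> = (\<Sum>z\<in>?N. ennreal (m * ?\<tau>\<^sup>2 / 2))"
    using m0 by (simp add: ennreal_of_nat_eq_real_of_nat ennreal_mult[symmetric])
  also have "\<dots> \<le> (\<Sum>z\<in>?N. \<integral>\<^sup>+u. pair.step_cost (u, z) * ennreal (indicator {t0..t1} u * pair.E.r x0 z u * exp (- pair.E.Haz x0 t0 u)) \<partial>lborel)"
    by (intro sum_mono I)
  also have "\<dots> \<le> (\<Sum>z\<in>UNIV. \<integral>\<^sup>+u. pair.step_cost (u, z) * ennreal (indicator {t0..t1} u * pair.E.r x0 z u * exp (- pair.E.Haz x0 t0 u)) \<partial>lborel)"
    by (rule sum_le_sum_subset_ennreal)
  finally show ?thesis .
qed

lemma KL_div_euler_ge: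
  "ereal (1 / 4 * (t1 - t0) * real CARD('d) * real CARD('s) * L + 1 / 32 * (real CARD('d))\<^sup>2 * (real CARD('s))\<^sup>2 * (t1 - t0)\<^sup>2 * eta)
    \<le> KL_div (path_measure (\<lambda>_. QE) t0 t1 x0) (path_measure Q t0 t1 x0)" (is "ereal (?A + ?B) \<le> _")
proof -
  have AB: "0 \<le> ?A" "0 \<le> ?B" using L_nonneg eta_nonneg times by simp_all
  then have "ereal (?A + ?B) = enn2ereal (ennreal ?A + ennreal ?B)"
    by (simp add: ennreal_plus[symmetric] enn2ereal_ennreal del: ennreal_plus)
  also have "\<dots> \<le> enn2ereal (pair.step_cost (t0, x0) +
     (\<Sum>z\<in>UNIV. \<integral>\<^sup>+u. pair.step_cost (u, z) * ennreal (indicator {t0..t1} u * pair.E.r x0 z u * exp (- pair.E.Haz x0 t0 u)) \<partial>lborel))"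
    unfolding less_eq_ennreal.rep_eq[symmetric] by (rule add_mono[OF first_cost second_cost])
  also have "\<dots> \<le> KL_div (path_measure (\<lambda>_. QE) t0 t1 x0) (path_measure Q t0 t1 x0)"
    by (rule pair.KL_div_path_measure_ge)
  finally show ?thesis .
qed

end

theorem theorem3p5:
  fixes p1 :: "('d::finite \<Rightarrow> 's::finite) pmf"
    and p0 :: "'d \<Rightarrow> 's pmf"
    and \<kappa> dk :: "real \<Rightarrow> real"
    and t0 t1 :: real
    and x0 :: "'d \<Rightarrow> 's"
  assumes card_d: "CARD('d) \<ge> 2"
    and card_s: "CARD('s) \<ge> 2"
    and kappa_range: "\<forall>t\<in>{0..1}. \<kappa> t \<in> {0..1}"
    and kappa_mono: "mono_on {0..1} \<kappa>"
    and kappa_cont: "continuous_on {0..1} \<kappa>"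
    and kappa_deriv: "\<forall>t\<in>{0..1}. (\<kappa> has_real_derivative dk t) (at t within {0..1})"
    and kappa0: "\<kappa> 0 = 0" and kappa1: "\<kappa> 1 = 1"
    and times: "0 \<le> t0" "t0 < t1" "t1 \<le> 1"
    and pos: "\<forall>t\<in>{t0..t1}. \<forall>x z. hamming x z = 1 \<longrightarrow> Qrate p1 p0 \<kappa> dk t x z > 0"
    and step: "(t1 - t0) * Qrate p1 p0 \<kappa> dk t0 x0 x0 \<ge> - ln 2"
  shows
    "let \<tau> = t1 - t0;
         Q = Qrate p1 p0 \<kappa> dk;
         P = path_measure Q t0 t1 x0;
         PE = path_measure (\<lambda>_. QEuler p1 p0 \<kappa> dk t0 x0) t0 t1 x0;
         L' = Inf {integral {t0..t1} (\<lambda>s. 1 / \<tau> * DF (Q t0 x z) (Q s x z)) | x z. hamming x z = 1};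
         \<eta> = Inf {Qd p1 p0 \<kappa> dk t0 x0 d (x d) *
                   DF (Qd p1 p0 \<kappa> dk t0 x0 d' y) (Qd p1 p0 \<kappa> dk s x d' y)
                 | d d' y x s. d' \<noteq> d \<and> y \<noteq> x d' \<and> x d \<noteq> x0 d \<and> hamming x x0 = 1 \<and> s \<in> {t0..t1}}
     in KL_div PE P \<ge> ereal (1/4 * \<tau> * CARD('d) * CARD('s) * L'
                            + 1/32 * CARD('d)^2 * CARD('s)^2 * \<tau>^2 * \<eta>)"
proof -
  interpret euler_step p1 p0 \<kappa> dk t0 t1 x0
    by (rule euler_step.intro) fact+
  show ?thesis
    using KL_div_euler_ge unfolding Let_def L_def eta_def by simp
qed

end
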